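(* Let $n\ge1$ and $k\ge0$. The alternating (sign) representation of $S_{n}$ occurs with multiplicity $1$ in $H_{k}\big(\mathrm{cell}(n,2);\mathbb{Q}\big)$ if $n-3k=0$ or $n-3k=1$, and with multiplicity $0$ otherwise.
   Context: A symbol on $[n]=\{1,\dots,n\}$ is a sequence $\alpha_1|\cdots|\alpha_r$ of nonempty blocks, each a string of labels, with every element of $[n]$ occurring exactly once. $\mathrm{cell}(n)$ is the polyhedral cell complex with one cell of dimension $n-r$ for each symbol with $r$ blocks; $f$ is a face of $g$ iff the symbol of $g$ is obtained from that of $f$ by deleting bars and shuffling the merged blocks (keeping the internal order of each original block). $\mathrm{cell}(n,2)$ is the subcomplex of cells all of whose blocks have at most $2$ elements. The boundary of a one-block cell $g$ is $\sum \pm\,\alpha|\beta$ over all ways to split $g$ into two complementary nonempty subwords $\alpha,\beta$, the sign being that of the permutation taking the word $g$ to the word $\alpha\beta$; and $\partial(g_1|g_2)=\partial g_1|g_2+(-1)^{b(g_1)}g_1|\partial g_2$ with $b$ the number of blocks. $S_n$ acts by permuting labels, so $H_k(\mathrm{cell}(n,2);\mathbb{Q})$ is an $S_n$-representation. *)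

theory Defs
  imports "HOL-Algebra.Algebra" "HOL-Algebra.Algebraic_Closure_Type"
begin

section \<open>Linear representations and multiplicities\<close>

definition group_representation ::
  "('g, 'm) monoid_scheme \<Rightarrow> ('k, 'r) ring_scheme \<Rightarrow> ('k, 'v, 'z) module_scheme
    \<Rightarrow> ('g \<Rightarrow> 'v \<Rightarrow> 'v) \<Rightarrow> bool" where
  "group_representation G K V \<rho> \<longleftrightarrow>
     group G \<and> field K \<and> module K V \<and>
     (\<forall>g\<in>carrier G. \<forall>v\<in>carrier V. \<rho> g v \<in> carrier V) \<and>
     (\<forall>g\<in>carrier G. \<forall>v\<in>carrier V. \<forall>w\<in>carrier V. \<rho> g (v \<oplus>\<^bsub>V\<^esub> w) = \<rho> g v \<oplus>\<^bsub>V\<^esub> \<rho> g w) \<and>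
     (\<forall>g\<in>carrier G. \<forall>c\<in>carrier K. \<forall>v\<in>carrier V. \<rho> g (c \<odot>\<^bsub>V\<^esub> v) = c \<odot>\<^bsub>V\<^esub> \<rho> g v) \<and>
     (\<forall>v\<in>carrier V. \<rho> \<one>\<^bsub>G\<^esub> v = v) \<and>
     (\<forall>g\<in>carrier G. \<forall>h\<in>carrier G. \<forall>v\<in>carrier V. \<rho> (g \<otimes>\<^bsub>G\<^esub> h) v = \<rho> g (\<rho> h v))"

definition subrepresentation ::
  "('g, 'm) monoid_scheme \<Rightarrow> ('k, 'r) ring_scheme \<Rightarrow> ('k, 'v, 'z) module_scheme
    \<Rightarrow> ('g \<Rightarrow> 'v \<Rightarrow> 'v) \<Rightarrow> 'v set \<Rightarrow> bool" where
  "subrepresentation G K V \<rho> W \<longleftrightarrow>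
     submodule W K V \<and> (\<forall>g\<in>carrier G. \<forall>w\<in>W. \<rho> g w \<in> W)"

definition irreducible_representation ::
  "('g, 'm) monoid_scheme \<Rightarrow> ('k, 'r) ring_scheme \<Rightarrow> ('k, 'v, 'z) module_scheme
    \<Rightarrow> ('g \<Rightarrow> 'v \<Rightarrow> 'v) \<Rightarrow> bool" where
  "irreducible_representation G K V \<rho> \<longleftrightarrow>
     group_representation G K V \<rho> \<and> carrier V \<noteq> {\<zero>\<^bsub>V\<^esub>} \<and>
     (\<forall>W. subrepresentation G K V \<rho> W \<longrightarrow> W = {\<zero>\<^bsub>V\<^esub>} \<or> W = carrier V)"

definition isomorphic_representations ::
  "('g, 'm) monoid_scheme \<Rightarrow> ('k, 'r) ring_scheme
    \<Rightarrow> ('k, 'u, 'y) module_scheme \<Rightarrow> ('g \<Rightarrow> 'u \<Rightarrow> 'u)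
    \<Rightarrow> ('k, 'v, 'z) module_scheme \<Rightarrow> ('g \<Rightarrow> 'v \<Rightarrow> 'v) \<Rightarrow> bool" where
  "isomorphic_representations G K U \<tau> V \<rho> \<longleftrightarrow>
     (\<exists>f. bij_betw f (carrier U) (carrier V) \<and>
       (\<forall>u\<in>carrier U. \<forall>u'\<in>carrier U. f (u \<oplus>\<^bsub>U\<^esub> u') = f u \<oplus>\<^bsub>V\<^esub> f u') \<and>
       (\<forall>c\<in>carrier K. \<forall>u\<in>carrier U. f (c \<odot>\<^bsub>U\<^esub> u) = c \<odot>\<^bsub>V\<^esub> f u) \<and>
       (\<forall>g\<in>carrier G. \<forall>u\<in>carrier U. f (\<tau> g u) = \<rho> g (f u)))"

text \<open>\<open>V\<close> is the internal direct sum of the irreducible subrepresentations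
  \<open>W 0, \<dots>, W (r - 1)\<close>; the empty sum \<open>r = 0\<close> is the zero space.\<close>

definition irreducible_decomposition ::
  "('g, 'm) monoid_scheme \<Rightarrow> ('k, 'r) ring_scheme \<Rightarrow> ('k, 'v, 'z) module_scheme
    \<Rightarrow> ('g \<Rightarrow> 'v \<Rightarrow> 'v) \<Rightarrow> nat \<Rightarrow> (nat \<Rightarrow> 'v set) \<Rightarrow> bool" where
  "irreducible_decomposition G K V \<rho> r W \<longleftrightarrow>
     (\<forall>i<r. subrepresentation G K V \<rho> (W i) \<and>
            irreducible_representation G K (V\<lparr>carrier := W i\<rparr>) \<rho>) \<and>
     (\<forall>v\<in>carrier V. \<exists>!w. w \<in> (\<Pi>\<^sub>E i\<in>{..<r}. W i) \<and> v = (\<Oplus>\<^bsub>V\<^esub>i\<in>{..<r}. w i))"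

text \<open>The irreducible representation \<open>(U, \<tau>)\<close> occurs in \<open>(V, \<rho>)\<close> with multiplicity \<open>m\<close>:
  \<open>V\<close> splits into finitely many irreducibles, and exactly \<open>m\<close> of them are isomorphic to \<open>U\<close>,
  whichever splitting is chosen.\<close>

definition occurs_with_multiplicity ::
  "('g, 'm) monoid_scheme \<Rightarrow> ('k, 'r) ring_scheme
    \<Rightarrow> ('k, 'u, 'y) module_scheme \<Rightarrow> ('g \<Rightarrow> 'u \<Rightarrow> 'u)
    \<Rightarrow> ('k, 'v, 'z) module_scheme \<Rightarrow> ('g \<Rightarrow> 'v \<Rightarrow> 'v) \<Rightarrow> nat \<Rightarrow> bool" where
  "occurs_with_multiplicity G K U \<tau> V \<rho> m \<longleftrightarrow>
     irreducible_representation G K U \<tau> \<and> group_representation G K V \<rho> \<and>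
     (\<exists>r W. irreducible_decomposition G K V \<rho> r W) \<and>
     (\<forall>r W. irreducible_decomposition G K V \<rho> r W \<longrightarrow>
        card {i. i < r \<and> isomorphic_representations G K U \<tau> (V\<lparr>carrier := W i\<rparr>) \<rho>} = m)"

definition sign_space :: "(rat, rat) module" where
  "sign_space = \<lparr>carrier = UNIV, monoid.mult = (*), one = 1, ring.zero = 0, add = (+), module.smult = (*)\<rparr>"

definition sign_action :: "(nat \<Rightarrow> nat) \<Rightarrow> rat \<Rightarrow> rat" where
  "sign_action \<sigma> x = of_int (sign \<sigma>) * x"

text \<open>The fields \<open>mult\<close> and \<open>one\<close> of the \<open>module\<close> record play no role for
  modules; they are left unspecified here and in \<open>chain_module\<close> below.\<close>

definition quotient_module ::
  "('k, 'v, 'z) module_scheme \<Rightarrow> 'v set \<Rightarrow> ('k, 'v set) module" where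
  "quotient_module M N =
     \<lparr>carrier = a_rcosets\<^bsub>M\<^esub> N, monoid.mult = undefined, one = undefined, ring.zero = N,
      add = set_add M, module.smult = (\<lambda>c A. N <+>\<^bsub>M\<^esub> ((\<lambda>x. c \<odot>\<^bsub>M\<^esub> x) ` A))\<rparr>"

section \<open>The cells of cell(n,w)\<close>

text \<open>The symbol \<open>\<alpha>\<^sub>1|\<dots>|\<alpha>\<^sub>r\<close> is the list of its blocks, each block being a list of labels.\<close>

type_synonym symbol = "nat list list"

definition is_symbol :: "nat \<Rightarrow> symbol \<Rightarrow> bool" where
  "is_symbol n s \<longleftrightarrow> [] \<notin> set s \<and> distinct (concat s) \<and> set (concat s) = {1..n}"

text \<open>The cells of dimension \<open>k\<close> in the subcomplex cell(n,w) of cell(n); note that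
  a symbol on \<open>{1..n}\<close> has at most \<open>n\<close> blocks.\<close>

definition cells :: "nat \<Rightarrow> nat \<Rightarrow> nat \<Rightarrow> symbol set" where
  "cells n w k = {s. is_symbol n s \<and> (\<forall>g\<in>set s. length g \<le> w) \<and> n - length s = k}"

section \<open>The boundary operator\<close>

text \<open>Chains are coefficient functions on symbols. They are not required to have finite support
  a priori, but \<open>cells n w k\<close> is a finite set.\<close>

type_synonym chain = "symbol \<Rightarrow> rat"

definition cell_chain :: "symbol \<Rightarrow> chain" where
  "cell_chain s = (\<lambda>t. if t = s then 1 else 0)"

text \<open>Bilinear extension of the concatenation \<open>s|t\<close> of symbols.\<close>

definition bar :: "chain \<Rightarrow> chain \<Rightarrow> chain" where
  "bar c d = (\<lambda>u. \<Sum>i\<le>length u. c (take i u) * d (drop i u))"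

definition word_sign :: "nat list \<Rightarrow> nat list \<Rightarrow> rat" where
  "word_sign g h = of_int (sign (THE p. p permutes set g \<and> map p g = h))"

text \<open>If the letters of \<open>g\<close> are distinct, a pair \<open>(\<alpha>, \<beta>)\<close> of words is a splitting of \<open>g\<close> into
  complementary subwords iff \<open>g\<close> is a shuffle of \<open>\<alpha>\<close> and \<open>\<beta>\<close>.\<close>

definition splittings :: "nat list \<Rightarrow> (nat list \<times> nat list) set" where
  "splittings g = {(\<alpha>, \<beta>). \<alpha> \<noteq> [] \<and> \<beta> \<noteq> [] \<and> g \<in> shuffles \<alpha> \<beta>}"

definition block_boundary :: "nat list \<Rightarrow> chain" where
  "block_boundary g =
     (\<lambda>u. \<Sum>(\<alpha>, \<beta>)\<in>splittings g. word_sign g (\<alpha> @ \<beta>) * cell_chain [\<alpha>, \<beta>] u)"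

text \<open>The rule \<open>\<partial>(g\<^sub>1|g\<^sub>2) = \<partial>g\<^sub>1|g\<^sub>2 + (-1)\<^bsup>b(g\<^sub>1)\<^esup> g\<^sub>1|\<partial>g\<^sub>2\<close>, with \<open>g\<^sub>1\<close> the first block, so that
  \<open>b(g\<^sub>1) = 1\<close>. The rule for arbitrary \<open>g\<^sub>1\<close> follows, see \<open>cell_boundary_append\<close>.\<close>

fun cell_boundary :: "symbol \<Rightarrow> chain" where
  "cell_boundary [] = (\<lambda>u. 0)"
| "cell_boundary (g # s) =
     (\<lambda>u. bar (block_boundary g) (cell_chain s) u - bar (cell_chain [g]) (cell_boundary s) u)"

lemma bar_cell_chain_left:
  "bar (cell_chain s) d u = (if take (length s) u = s then d (drop (length s) u) else 0)"
proof -
  let ?x = "if take (length s) u = s then d (drop (length s) u) else 0"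
  have "cell_chain s (take i u) * d (drop i u) = (if i = length s then ?x else 0)"
    if "i \<in> {..length u}" for i
  proof (cases "i = length s")
    case False
    then have "take i u \<noteq> s"
      using that by auto
    then show ?thesis
      using False by (simp add: cell_chain_def)
  qed (simp add: cell_chain_def)
  then have "bar (cell_chain s) d u = (\<Sum>i\<le>length u. if i = length s then ?x else 0)"
    unfolding bar_def by (rule sum.cong[OF refl])
  also have "\<dots> = (if length s \<le> length u then ?x else 0)"
    by (simp add: sum.delta)
  also have "\<dots> = ?x"
    by auto
  finally show ?thesis .
qed

lemma bar_assoc: "bar (bar c d) e = bar c (bar d e)"
proof
  fix u :: symbol
  let ?n = "length u"
  let ?f = "\<lambda>j i. c (take j u) * d (drop j (take i u)) * e (drop i u)"
  have "bar (bar c d) e u = (\<Sum>i\<le>?n. \<Sum>j\<le>i. ?f j i)"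
    unfolding bar_def
  proof (rule sum.cong[OF refl])
    fix i assume "i \<in> {..?n}"
    then have "length (take i u) = i" by simp
    then show "(\<Sum>j\<le>length (take i u). c (take j (take i u)) * d (drop j (take i u))) * e (drop i u)
        = (\<Sum>j\<le>i. ?f j i)"
      unfolding sum_distrib_right by (simp add: min_def)
  qed
  also have "\<dots> = (\<Sum>(i, j)\<in>Sigma {..?n} (\<lambda>i. {..i}). ?f j i)"
    by (rule sum.Sigma) auto
  also have "\<dots> = (\<Sum>(j, i)\<in>Sigma {..?n} (\<lambda>j. {..?n - j}). ?f j (i + j))"
    by (rule sum.reindex_bij_witness[of _ "\<lambda>(j, i). (i + j, j)" "\<lambda>(i, j). (j, i - j)"]) auto
  also have "\<dots> = (\<Sum>j\<le>?n. \<Sum>i\<le>?n - j. ?f j (i + j))"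
    by (rule sum.Sigma[symmetric]) auto
  also have "\<dots> = bar c (bar d e) u"
    unfolding bar_def sum_distrib_left
    by (simp add: drop_take mult.assoc)
  finally show "bar (bar c d) e u = bar c (bar d e) u" .
qed

lemma bar_cell_chain: "bar (cell_chain s) (cell_chain t) = cell_chain (s @ t)"
proof
  fix u :: symbol
  have "take (length s) u = s \<and> drop (length s) u = t \<longleftrightarrow> u = s @ t"
    by (metis append_eq_conv_conj)
  then show "bar (cell_chain s) (cell_chain t) u = cell_chain (s @ t) u"
    unfolding bar_cell_chain_left by (auto simp: cell_chain_def)
qed

lemma bar_diff_left: "bar (\<lambda>u. c u - c' u) d = (\<lambda>u. bar c d u - bar c' d u)"
  by (simp add: bar_def algebra_simps sum_subtractf fun_eq_iff)

lemma cell_boundary_append: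
  "cell_boundary (s @ t) u =
     bar (cell_boundary s) (cell_chain t) u + (-1) ^ length s * bar (cell_chain s) (cell_boundary t) u"
proof (induction s arbitrary: u)
  case Nil
  then show ?case
    by (simp add: bar_cell_chain_left) (simp add: bar_def)
next
  case (Cons g s)
  have IH: "cell_boundary (s @ t) = (\<lambda>u. bar (cell_boundary s) (cell_chain t) u
      + (-1) ^ length s * bar (cell_chain s) (cell_boundary t) u)"
    using Cons.IH by blast
  have "bar (cell_chain [g]) (cell_boundary (s @ t)) u =
     bar (cell_chain [g]) (bar (cell_boundary s) (cell_chain t)) u
      + (-1) ^ length s * bar (cell_chain [g]) (bar (cell_chain s) (cell_boundary t)) u"
    unfolding IH by (simp add: bar_cell_chain_left)
  moreover have "bar (cell_chain [g]) (bar (cell_chain s) (cell_boundary t)) =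
      bar (cell_chain (g # s)) (cell_boundary t)"
    by (simp add: bar_assoc[symmetric] bar_cell_chain)
  ultimately show ?case
    by (simp add: bar_diff_left bar_assoc bar_cell_chain)
qed

section \<open>Homology\<close>

definition chains :: "nat \<Rightarrow> nat \<Rightarrow> nat \<Rightarrow> chain set" where
  "chains n w k = {c. \<forall>s. s \<notin> cells n w k \<longrightarrow> c s = 0}"

definition boundary :: "nat \<Rightarrow> nat \<Rightarrow> nat \<Rightarrow> chain \<Rightarrow> chain" where
  "boundary n w k c = (\<lambda>t. \<Sum>s\<in>cells n w k. c s * cell_boundary s t)"

text \<open>In degree 0 every chain is a cycle, since a block of length 1 has no splittings.\<close>

definition cycles :: "nat \<Rightarrow> nat \<Rightarrow> nat \<Rightarrow> chain set" where
  "cycles n w k = {c \<in> chains n w k. boundary n w k c = (\<lambda>t. 0)}"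

definition boundaries :: "nat \<Rightarrow> nat \<Rightarrow> nat \<Rightarrow> chain set" where
  "boundaries n w k = boundary n w (Suc k) ` chains n w (Suc k)"

definition chain_module :: "nat \<Rightarrow> nat \<Rightarrow> nat \<Rightarrow> (rat, chain) module" where
  "chain_module n w k =
     \<lparr>carrier = chains n w k, monoid.mult = undefined, one = undefined, ring.zero = (\<lambda>s. 0),
      add = (\<lambda>c d s. c s + d s), module.smult = (\<lambda>a c s. a * c s)\<rparr>"

definition cell_homology :: "nat \<Rightarrow> nat \<Rightarrow> nat \<Rightarrow> (rat, chain set) module" where
  "cell_homology n w k =
     quotient_module ((chain_module n w k)\<lparr>carrier := cycles n w k\<rparr>) (boundaries n w k)"

text \<open>\<open>chain_action \<sigma>\<close> is the linear extension of the permutation \<open>s \<mapsto> map (map \<sigma>) s\<close> of the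
  symbols; hence the inverse in the argument of the coefficient function.\<close>

definition chain_action :: "(nat \<Rightarrow> nat) \<Rightarrow> chain \<Rightarrow> chain" where
  "chain_action \<sigma> c = (\<lambda>s. c (map (map (inv' \<sigma>)) s))"

definition homology_action :: "(nat \<Rightarrow> nat) \<Rightarrow> chain set \<Rightarrow> chain set" where
  "homology_action \<sigma> A = chain_action \<sigma> ` A"

end

theory Submission
  imports Defs
begin

text \<open>
  A symbol with blocks of length at most two is determined, up to the free action of \<open>S\<^sub>n\<close>, by
  the sequence of its block lengths.  The alternating chains on \<open>cell(n,2)\<close> are therefore functions
  on the words in two letters, \<open>x\<close> for a block of length 1 and \<open>y\<close> for a block of length 2, of
  weight \<open>n\<close>.  A block \<open>ab\<close> has boundary \<open>a|b - b|a\<close>, and the two terms become equal after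
  antisymmetrization, so the boundary becomes the derivation \<open>d\<close> of the free algebra on the odd
  letters \<open>x\<close> and \<open>y\<close> with \<open>d x = 0\<close> and \<open>d y = 2 x x\<close> (\<open>symbol_boundary_sign_chain\<close>).

  The homology of this word complex is found by splitting off the first letter: \<open>x a + y b\<close> is a
  cycle iff \<open>d b = 0\<close> and \<open>d a = 2 x b\<close>.  So, up to the factor 2, left multiplication by \<open>x\<close> from
  the homology in weight \<open>n\<close> to the homology in weight \<open>n + 1\<close> is a connecting map, and its
  cokernel and its kernel make up the homology in weight \<open>n + 2\<close>.  Starting with \<open>1\<close> and \<open>x\<close> in
  weights 0 and 1, one finds by induction that \<open>(x y + y x)\<^sup>m\<close> spans the homology in weight \<open>3 m\<close>,
  that \<open>x (x y + y x)\<^sup>m\<close> spans it in weight \<open>3 m + 1\<close>, and that weight \<open>3 m + 2\<close> is acyclic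
  (\<open>word_homology\<close>).  The number of letters \<open>y\<close> is the dimension \<open>k\<close> of the cell; it is \<open>m\<close> in
  both generators.

  It remains to pass from alternating cycles to the multiplicity of the sign representation in the
  homology.  The standard inner product on rational chains is invariant and positive definite, so
  invariant subspaces have invariant orthogonal complements.  This gives complete reducibility
  (\<open>orthogonal_decomposition\<close>) and identifies the homology with the cycles orthogonal to the
  boundaries (\<open>quotient_representation_iso\<close>).  Hence a vector of the homology on which \<open>S\<^sub>n\<close> acts by
  the sign is represented by an alternating cycle (\<open>homology_sign_vector\<close>).  Conversely, the
  alternating cycle of a generator does not bound any chain, because antisymmetrization commutes
  with the boundary operator (\<open>sign_chain_not_boundary\<close>).  The sign vectors of the homology thus
  form a line or are zero, and the multiplicity is 1 or 0 accordingly (\<open>sign_multiplicity_one\<close>,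
  \<open>sign_multiplicity_zero\<close>).
\<close>

section \<open>The word complex\<close>

text \<open>\<open>False\<close> stands for \<open>x\<close> and \<open>True\<close> for \<open>y\<close>, and a chain is its coefficient function.  A word starting
  with \<open>x x\<close> receives the coefficient of the word with \<open>y\<close> in place of \<open>x x\<close>, twice, since
  \<open>d y = 2 x x\<close>; the first letter is odd, hence the minus sign before the boundary of the rest.\<close>

fun word_boundary :: "(bool list \<Rightarrow> rat) \<Rightarrow> bool list \<Rightarrow> rat" where
  "word_boundary f [] = 0"
| "word_boundary f (a # w) =
     (case w of b # v \<Rightarrow> if a \<or> b then 0 else 2 * f (True # v) | [] \<Rightarrow> 0)
     - word_boundary (\<lambda>v. f (a # v)) w"

fun weight :: "bool list \<Rightarrow> nat" where
  "weight [] = 0"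
| "weight (a # w) = (if a then 2 else 1) + weight w"

definition word_chains :: "nat \<Rightarrow> (bool list \<Rightarrow> rat) set" where
  "word_chains n = {f. \<forall>w. f w \<noteq> 0 \<longrightarrow> weight w = n}"

definition left_mult :: "bool \<Rightarrow> (bool list \<Rightarrow> rat) \<Rightarrow> bool list \<Rightarrow> rat" where
  "left_mult a f = (\<lambda>w. case w of [] \<Rightarrow> 0 | b # v \<Rightarrow> if b = a then f v else 0)"

abbreviation times_x :: "(bool list \<Rightarrow> rat) \<Rightarrow> bool list \<Rightarrow> rat" where "times_x \<equiv> left_mult False"
abbreviation times_y :: "(bool list \<Rightarrow> rat) \<Rightarrow> bool list \<Rightarrow> rat" where "times_y \<equiv> left_mult True"

lemma left_mult_simps [simp]:
  "left_mult a f [] = 0" "left_mult a f (b # v) = (if b = a then f v else 0)"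
  by (simp_all add: left_mult_def)

lemma left_mult_zero [simp]: "left_mult a (\<lambda>w. 0) = (\<lambda>w. 0)"
  by (auto simp: left_mult_def split: list.split)

lemma word_boundary_zero [simp]: "word_boundary (\<lambda>w. 0) w = 0"
  by (induction w) (auto split: list.split)

lemma word_boundary_linear:
  "word_boundary (\<lambda>w. a * f w + b * g w) w = a * word_boundary f w + b * word_boundary g w"
proof (induction w arbitrary: f g)
  case (Cons c w)
  show ?case by (auto simp: Cons.IH algebra_simps split: list.split)
qed auto

lemma word_boundary_add: "word_boundary (\<lambda>w. f w + g w) w = word_boundary f w + word_boundary g w"
  using word_boundary_linear[of 1 f 1 g] by simp

lemma word_boundary_diff: "word_boundary (\<lambda>w. f w - g w) w = word_boundary f w - word_boundary g w"
  using word_boundary_linear[of 1 f "-1" g] by simp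

lemma word_boundary_scale: "word_boundary (\<lambda>w. a * f w) w = a * word_boundary f w"
  using word_boundary_linear[of a f 0 f] by simp

lemmas word_boundary_linear_simps = word_boundary_add word_boundary_diff word_boundary_scale

lemma word_boundary_times_x [simp]: "word_boundary (times_x f) = (\<lambda>w. - times_x (word_boundary f) w)"
proof
  fix w show "word_boundary (times_x f) w = - times_x (word_boundary f) w"
    by (cases w) (auto split: list.split)
qed

lemma word_boundary_times_y [simp]:
  "word_boundary (times_y f) = (\<lambda>w. 2 * times_x (times_x f) w - times_y (word_boundary f) w)"
proof
  fix w show "word_boundary (times_y f) w = 2 * times_x (times_x f) w - times_y (word_boundary f) w"
    by (cases w) (auto split: list.split)
qed

lemma word_chains_decompose:
  assumes f: "f \<in> word_chains n" and n: "n > 0"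
  obtains a b where "f = (\<lambda>w. times_x a w + times_y b w)" "a \<in> word_chains (n - 1)"
    "b \<in> word_chains (n - 2)"
proof
  let ?a = "\<lambda>v. f (False # v)" and ?b = "\<lambda>v. f (True # v)"
  have "f [] = 0" using f n by (auto simp: word_chains_def)
  then show "f = (\<lambda>w. times_x ?a w + times_y ?b w)"
    by (auto simp: fun_eq_iff left_mult_def split: list.split)
  show "?a \<in> word_chains (n - 1)" "?b \<in> word_chains (n - 2)"
    using f by (force simp: word_chains_def)+
qed

lemma times_x_in: "f \<in> word_chains n \<Longrightarrow> times_x f \<in> word_chains (Suc n)"
  by (auto simp: word_chains_def left_mult_def split: list.splits if_splits)

lemma times_y_in: "f \<in> word_chains n \<Longrightarrow> times_y f \<in> word_chains (Suc (Suc n))"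
  by (auto simp: word_chains_def left_mult_def split: list.splits if_splits)

lemma word_chains_linear:
  "f \<in> word_chains n \<Longrightarrow> g \<in> word_chains n \<Longrightarrow> (\<lambda>w. f w + g w) \<in> word_chains n"
  "f \<in> word_chains n \<Longrightarrow> g \<in> word_chains n \<Longrightarrow> (\<lambda>w. f w - g w) \<in> word_chains n"
  "f \<in> word_chains n \<Longrightarrow> (\<lambda>w. c * f w) \<in> word_chains n"
  "f \<in> word_chains n \<Longrightarrow> (\<lambda>w. f w / c) \<in> word_chains n"
  by (force simp: word_chains_def)+

lemmas word_chains_intros = times_x_in times_y_in word_chains_linear

text \<open>The boundary of \<open>x a + y b\<close> is \<open>x (2 x b - d a) - y d b\<close>, and its two parts have no word in
  common.\<close>

lemma word_cycle_iff:
  "word_boundary (\<lambda>w. times_x a w + times_y b w) = (\<lambda>w. 0) \<longleftrightarrow>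
     word_boundary b = (\<lambda>w. 0) \<and> word_boundary a = (\<lambda>w. 2 * times_x b w)" (is "?l \<longleftrightarrow> ?r")
proof
  assume l: ?l
  have *: "- times_x (word_boundary a) w + (2 * times_x (times_x b) w - times_y (word_boundary b) w) = 0" for w
    using fun_cong[OF l, of w] by (simp add: word_boundary_add)
  show ?r
    using *[of "True # _"] *[of "False # _"] by (auto simp: fun_eq_iff)
next
  assume ?r
  then have "word_boundary b = (\<lambda>w. 0)" and "word_boundary a = (\<lambda>w. 2 * times_x b w)" by auto
  note r = this
  show ?l
  proof
    fix w show "word_boundary (\<lambda>w. times_x a w + times_y b w) w = 0"
      unfolding word_boundary_add word_boundary_times_x word_boundary_times_y r by (cases w) auto
  qed
qed

definition acyclic_weight :: "nat \<Rightarrow> bool" where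
  "acyclic_weight n \<longleftrightarrow>
     (\<forall>f\<in>word_chains n. word_boundary f = (\<lambda>w. 0) \<longrightarrow> (\<exists>g\<in>word_chains n. f = word_boundary g))"

text \<open>The class of \<open>z\<close> is a basis of the homology in weight \<open>n\<close>.\<close>

definition spans_homology :: "nat \<Rightarrow> (bool list \<Rightarrow> rat) \<Rightarrow> bool" where
  "spans_homology n z \<longleftrightarrow>
     z \<in> word_chains n \<and> word_boundary z = (\<lambda>w. 0) \<and> (\<nexists>g. g \<in> word_chains n \<and> z = word_boundary g) \<and>
     (\<forall>f\<in>word_chains n. word_boundary f = (\<lambda>w. 0) \<longrightarrow>
        (\<exists>c. \<exists>g\<in>word_chains n. f = (\<lambda>w. c * z w + word_boundary g w)))"

text \<open>For a cycle \<open>x a + y b\<close> write \<open>b = \<beta> z + d b'\<close>.  Then \<open>2 \<beta> x z\<close> is the boundary of \<open>a + 2 x b'\<close>,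
  so that \<open>\<beta> = 0\<close>.  Adding \<open>d (y b')\<close> leaves \<open>x\<close> times a cycle.  This cycle is homologous to a
  multiple of \<open>x z\<close>, and \<open>2 x x z = d (y z)\<close>.\<close>

lemma acyclic_weight_step:
  assumes z: "spans_homology n z" and xz: "spans_homology (Suc n) (times_x z)"
  shows "acyclic_weight (Suc (Suc n))"
  unfolding acyclic_weight_def
proof (intro ballI impI)
  fix f assume f: "f \<in> word_chains (Suc (Suc n))" and cyc: "word_boundary f = (\<lambda>w. 0)"
  obtain a b where fab: "f = (\<lambda>w. times_x a w + times_y b w)" and a: "a \<in> word_chains (Suc n)"
    and b: "b \<in> word_chains n" using word_chains_decompose[OF f] by auto
  from cyc have db: "word_boundary b = (\<lambda>w. 0)" and da: "word_boundary a = (\<lambda>w. 2 * times_x b w)"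
    unfolding fab word_cycle_iff by auto
  obtain \<beta> b' where b': "b' \<in> word_chains n" and bb: "b = (\<lambda>w. \<beta> * z w + word_boundary b' w)"
    using z b db unfolding spans_homology_def by blast
  have zz: "z \<in> word_chains n" "word_boundary z = (\<lambda>w. 0)" using z by (auto simp: spans_homology_def)
  have "\<beta> = 0"
  proof (rule ccontr)
    assume \<beta>: "\<beta> \<noteq> 0"
    \<comment> \<open>from \<open>d (a + 2 x b') = 2 x b - 2 x d b' = 2 \<beta> x z\<close>\<close>
    let ?g = "\<lambda>w. (a w + 2 * times_x b' w) / (2 * \<beta>)"
    have "?g \<in> word_chains (Suc n)" by (intro word_chains_intros a b')
    moreover have "times_x z = word_boundary ?g"
    proof
      fix w
      have "word_boundary ?g w = (word_boundary a w + 2 * word_boundary (times_x b') w) / (2 * \<beta>)"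
        using word_boundary_scale[of "inverse (2*\<beta>)" "\<lambda>w. a w + 2 * times_x b' w" w]
        by (simp add: word_boundary_linear_simps field_simps)
      also have "\<dots> = times_x z w"
        using \<beta> by (simp add: da bb left_mult_def split: list.split)
      finally show "times_x z w = word_boundary ?g w" by simp
    qed
    ultimately show False using xz unfolding spans_homology_def by blast
  qed
  then have bb: "b = word_boundary b'" using bb by auto
  let ?a = "\<lambda>w. a w + 2 * times_x b' w"
  have "?a \<in> word_chains (Suc n)" by (intro word_chains_intros a b')
  moreover have "word_boundary ?a = (\<lambda>w. 0)"
    by (auto simp: word_boundary_linear_simps da bb)
  ultimately obtain \<gamma> g where g: "g \<in> word_chains (Suc n)"
    and aa: "?a = (\<lambda>w. \<gamma> * times_x z w + word_boundary g w)"
    using xz unfolding spans_homology_def by blast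
  \<comment> \<open>from \<open>d (y z) = 2 x x z\<close>, \<open>d (x g) = - x d g\<close> and \<open>d (y b') = 2 x x b' - y d b'\<close>\<close>
  let ?h = "\<lambda>w. (\<gamma> / 2) * times_y z w - times_x g w - times_y b' w"
  have a': "a w = \<gamma> * times_x z w + word_boundary g w - 2 * times_x b' w" for w
    using fun_cong[OF aa, of w] by simp
  have "?h \<in> word_chains (Suc (Suc n))" by (intro word_chains_intros g b' zz)
  moreover have "f = word_boundary ?h"
  proof
    fix w show "f w = word_boundary ?h w"
      unfolding fab word_boundary_diff word_boundary_scale
      by (cases w) (auto simp: bb zz a' simp del: word_boundary.simps)
  qed
  ultimately show "\<exists>g\<in>word_chains (Suc (Suc n)). f = word_boundary g" by blast
qed

text \<open>Since \<open>2 x x z = d (y z)\<close>, left multiplication by \<open>x\<close> annihilates the class of \<open>x z\<close>.  Hence \<open>y x z\<close>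
  can be completed to a cycle, and \<open>x y z\<close> does it.\<close>

definition next_generator :: "(bool list \<Rightarrow> rat) \<Rightarrow> bool list \<Rightarrow> rat" where
  "next_generator z = (\<lambda>w. times_x (times_y z) w + times_y (times_x z) w)"

text \<open>As weight \<open>n + 2\<close> is acyclic, the homology in weight \<open>n + 3\<close> is the kernel of left multiplication by
  \<open>x\<close> on the homology in weight \<open>n + 1\<close>.  This kernel is everything, and \<open>x z\<close> spans it.\<close>

lemma generator_step:
  assumes z: "spans_homology n z" and xz: "spans_homology (Suc n) (times_x z)"
    and ac: "acyclic_weight (Suc (Suc n))"
  shows "spans_homology (Suc (Suc (Suc n))) (next_generator z)"
proof -
  have zz: "z \<in> word_chains n" "word_boundary z = (\<lambda>w. 0)" using z by (auto simp: spans_homology_def)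
  let ?z = "next_generator z"
  have mem: "?z \<in> word_chains (Suc (Suc (Suc n)))"
    unfolding next_generator_def by (intro word_chains_intros zz)
  have cyc: "word_boundary ?z = (\<lambda>w. 0)"
    unfolding next_generator_def word_cycle_iff by (simp add: zz)
  have nb: "?z \<noteq> word_boundary g" if g: "g \<in> word_chains (Suc (Suc (Suc n)))" for g
  proof
    assume eq: "?z = word_boundary g"
    obtain a b where gab: "g = (\<lambda>w. times_x a w + times_y b w)" and a: "a \<in> word_chains (Suc (Suc n))"
      and b: "b \<in> word_chains (Suc n)" using word_chains_decompose[OF g] by auto
    have "times_x z v = word_boundary (\<lambda>w. (-1) * b w) v" for v
      using fun_cong[OF eq, of "True # v"] unfolding gab
      by (simp add: word_boundary_linear_simps next_generator_def word_boundary_scale[of "-1", simplified] del: word_boundary.simps)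
    then have "times_x z = word_boundary (\<lambda>w. (-1) * b w)" by blast
    moreover have "(\<lambda>w. (-1) * b w) \<in> word_chains (Suc n)" by (intro word_chains_intros b)
    ultimately show False using xz unfolding spans_homology_def by blast
  qed
  have span: "\<exists>c. \<exists>g\<in>word_chains (Suc (Suc (Suc n))). f = (\<lambda>w. c * ?z w + word_boundary g w)"
    if f: "f \<in> word_chains (Suc (Suc (Suc n)))" and cyc: "word_boundary f = (\<lambda>w. 0)" for f
  proof -
    obtain a b where fab: "f = (\<lambda>w. times_x a w + times_y b w)" and a: "a \<in> word_chains (Suc (Suc n))"
      and b: "b \<in> word_chains (Suc n)" using word_chains_decompose[OF f] by auto
    from cyc have db: "word_boundary b = (\<lambda>w. 0)" and da: "word_boundary a = (\<lambda>w. 2 * times_x b w)"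
      unfolding fab word_cycle_iff by auto
    obtain \<beta> b' where b': "b' \<in> word_chains (Suc n)"
      and bb: "b = (\<lambda>w. \<beta> * times_x z w + word_boundary b' w)"
      using xz b db unfolding spans_homology_def by blast
    \<comment> \<open>the coefficient of \<open>x\<close> after subtracting \<open>\<beta>\<close> times the new generator and adding \<open>d (y b')\<close>\<close>
    let ?a = "\<lambda>w. a w - \<beta> * times_y z w + 2 * times_x b' w"
    have "?a \<in> word_chains (Suc (Suc n))" by (intro word_chains_intros a b' zz)
    moreover have "word_boundary ?a = (\<lambda>w. 0)"
      by (auto simp: word_boundary_linear_simps da bb zz fun_eq_iff left_mult_def algebra_simps split: list.split)
    ultimately obtain g where g: "g \<in> word_chains (Suc (Suc n))" and aa: "?a = word_boundary g"
      using ac unfolding acyclic_weight_def by blast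
    have a': "a w = word_boundary g w + \<beta> * times_y z w - 2 * times_x b' w" for w
      using fun_cong[OF aa, of w] by simp
    let ?h = "\<lambda>w. (-1) * times_x g w - times_y b' w"
    have "?h \<in> word_chains (Suc (Suc (Suc n)))" by (intro word_chains_intros g b')
    moreover have "f = (\<lambda>w. \<beta> * ?z w + word_boundary ?h w)"
    proof
      fix w show "f w = \<beta> * ?z w + word_boundary ?h w"
        unfolding fab word_boundary_diff word_boundary_scale
        by (cases w) (auto simp: next_generator_def bb zz a' simp del: word_boundary.simps)
    qed
    ultimately show ?thesis by blast
  qed
  show ?thesis
    unfolding spans_homology_def using mem cyc nb span by blast
qed

text \<open>As weight \<open>n\<close> is acyclic, left multiplication by \<open>x\<close> is an isomorphism from the homology in weight
  \<open>n + 1\<close> to the homology in weight \<open>n + 2\<close>.\<close>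

lemma times_x_generator_step:
  assumes ac: "acyclic_weight n" and z: "spans_homology (Suc n) z"
  shows "spans_homology (Suc (Suc n)) (times_x z)"
proof -
  have zz: "z \<in> word_chains (Suc n)" "word_boundary z = (\<lambda>w. 0)"
    and znb: "\<And>g. g \<in> word_chains (Suc n) \<Longrightarrow> z \<noteq> word_boundary g"
    using z by (auto simp: spans_homology_def)
  have mem: "times_x z \<in> word_chains (Suc (Suc n))" by (intro word_chains_intros zz)
  have cyc: "word_boundary (times_x z) = (\<lambda>w. 0)"
    by (simp add: zz)
  have nb: "times_x z \<noteq> word_boundary g" if g: "g \<in> word_chains (Suc (Suc n))" for g
  proof
    assume eq: "times_x z = word_boundary g"
    obtain a b where gab: "g = (\<lambda>w. times_x a w + times_y b w)" and a: "a \<in> word_chains (Suc n)"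
      and b: "b \<in> word_chains n" using word_chains_decompose[OF g] by auto
    have "word_boundary b v = 0" for v
      using fun_cong[OF eq, of "True # v"] unfolding gab word_boundary_add
      by (simp del: word_boundary.simps)
    then obtain b' where b': "b' \<in> word_chains n" and bb: "b = word_boundary b'"
      using ac b unfolding acyclic_weight_def by blast
    have "z v = word_boundary (\<lambda>w. (-1) * a w - 2 * times_x b' w) v" for v
      using fun_cong[OF eq, of "False # v"] unfolding gab word_boundary_linear_simps
      by (simp add: bb del: word_boundary.simps)
    moreover have "(\<lambda>w. (-1) * a w - 2 * times_x b' w) \<in> word_chains (Suc n)" by (intro word_chains_intros a b')
    ultimately show False using znb by blast
  qed
  have span: "\<exists>c. \<exists>g\<in>word_chains (Suc (Suc n)). f = (\<lambda>w. c * times_x z w + word_boundary g w)"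
    if f: "f \<in> word_chains (Suc (Suc n))" and cyc: "word_boundary f = (\<lambda>w. 0)" for f
  proof -
    obtain a b where fab: "f = (\<lambda>w. times_x a w + times_y b w)" and a: "a \<in> word_chains (Suc n)"
      and b: "b \<in> word_chains n" using word_chains_decompose[OF f] by auto
    from cyc have db: "word_boundary b = (\<lambda>w. 0)" and da: "word_boundary a = (\<lambda>w. 2 * times_x b w)"
      unfolding fab word_cycle_iff by auto
    obtain b' where b': "b' \<in> word_chains n" and bb: "b = word_boundary b'"
      using ac b db unfolding acyclic_weight_def by blast
    let ?a = "\<lambda>w. a w + 2 * times_x b' w"
    have "?a \<in> word_chains (Suc n)" by (intro word_chains_intros a b')
    moreover have "word_boundary ?a = (\<lambda>w. 0)"
      by (auto simp: word_boundary_linear_simps da bb)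
    ultimately obtain \<gamma> g where g: "g \<in> word_chains (Suc n)"
      and aa: "?a = (\<lambda>w. \<gamma> * z w + word_boundary g w)"
      using z unfolding spans_homology_def by blast
    have a': "a w = \<gamma> * z w + word_boundary g w - 2 * times_x b' w" for w
      using fun_cong[OF aa, of w] by simp
    let ?h = "\<lambda>w. (-1) * times_x g w - times_y b' w"
    have "?h \<in> word_chains (Suc (Suc n))" by (intro word_chains_intros g b')
    moreover have "f = (\<lambda>w. \<gamma> * times_x z w + word_boundary ?h w)"
    proof
      fix w show "f w = \<gamma> * times_x z w + word_boundary ?h w"
        unfolding fab word_boundary_diff word_boundary_scale
        by (cases w) (auto simp: bb a' simp del: word_boundary.simps)
    qed
    ultimately show ?thesis by blast
  qed
  show ?thesis
    unfolding spans_homology_def using mem cyc nb span by blast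
qed

definition unit_word :: "bool list \<Rightarrow> rat" where
  "unit_word w = (if w = [] then 1 else 0)"

definition generator :: "nat \<Rightarrow> bool list \<Rightarrow> rat" where
  "generator m = (next_generator ^^ m) unit_word"

lemma weight_0 [simp]: "weight w = 0 \<longleftrightarrow> w = []"
  by (cases w) auto

lemma weight_1 [simp]: "weight w = Suc 0 \<longleftrightarrow> w = [False]"
  by (cases w) auto

lemma homology_weight_0: "spans_homology 0 unit_word"
proof -
  have "f w = f [] * unit_word w" "word_boundary f [] = 0" if "f \<in> word_chains 0" for f w
    using that by (auto simp: word_chains_def unit_word_def)
  then have "f = (\<lambda>w. f [] * unit_word w + word_boundary (\<lambda>w. 0) w)" if "f \<in> word_chains 0" for f
    using that by auto
  moreover have "word_boundary unit_word w = 0" for w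
    by (cases w) (auto simp: unit_word_def split: list.split)
  moreover have "unit_word \<noteq> word_boundary g" for g
    by (auto simp: unit_word_def fun_eq_iff intro!: exI[of _ "[]"])
  moreover have "unit_word \<in> word_chains 0" "(\<lambda>w. 0) \<in> word_chains 0"
    by (auto simp: unit_word_def word_chains_def)
  ultimately show ?thesis unfolding spans_homology_def by blast
qed

lemma homology_weight_1: "spans_homology (Suc 0) (times_x unit_word)"
proof -
  have "f w = f [False] * times_x unit_word w" if "f \<in> word_chains (Suc 0)" for f w
    using that by (cases w) (auto simp: word_chains_def unit_word_def)
  then have "f = (\<lambda>w. f [False] * times_x unit_word w + word_boundary (\<lambda>w. 0) w)"
    if "f \<in> word_chains (Suc 0)" for f
    using that by auto
  moreover have "word_boundary (times_x unit_word) = (\<lambda>w. 0)"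
    using homology_weight_0 by (simp add: spans_homology_def)
  moreover have "times_x unit_word \<noteq> word_boundary g" if "g \<in> word_chains (Suc 0)" for g
    by (auto simp: unit_word_def fun_eq_iff intro!: exI[of _ "[False]"])
  moreover have "times_x unit_word \<in> word_chains (Suc 0)" "(\<lambda>w. 0) \<in> word_chains (Suc 0)"
    using homology_weight_0 by (auto simp: spans_homology_def word_chains_def left_mult_def split: list.splits if_splits)
  ultimately show ?thesis unfolding spans_homology_def by blast
qed

lemma word_homology:
  "spans_homology (3 * m) (generator m) \<and> spans_homology (3 * m + 1) (times_x (generator m)) \<and>
   acyclic_weight (3 * m + 2)"
proof (induction m)
  case 0
  then show ?case
    using homology_weight_0 homology_weight_1 acyclic_weight_step[OF homology_weight_0 homology_weight_1] by (simp add: generator_def numeral_2_eq_2)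
next
  case (Suc m)
  have g: "generator (Suc m) = next_generator (generator m)" by (simp add: generator_def)
  have 1: "spans_homology (Suc (3 * m + 2)) (generator (Suc m))"
    unfolding g using generator_step[of "3*m" "generator m"] Suc by simp
  have 2: "spans_homology (Suc (Suc (3 * m + 2))) (times_x (generator (Suc m)))"
    using times_x_generator_step[OF _ 1] Suc by blast
  have "3 * Suc m = Suc (3 * m + 2)" by simp
  then show ?case using 1 2 acyclic_weight_step[OF 1 2] by (simp add: eval_nat_numeral)
qed

text \<open>The boundary operator raises the number of letters by one, so it commutes with the restriction
  to words of prescribed lengths.\<close>

lemma word_boundary_restrict_length:
  "word_boundary (\<lambda>v. if Q (Suc (length v)) then f v else 0) w =
     (if Q (length w) then word_boundary f w else 0)"
proof (induction w arbitrary: f Q)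
  case (Cons a w)
  show ?case
    using Cons.IH[of "\<lambda>l. Q (Suc l)" "\<lambda>v. f (a # v)"] by (auto split: list.split)
qed auto

lemma generator_length: "generator m w \<noteq> 0 \<Longrightarrow> length w = 2 * m"
proof (induction m arbitrary: w)
  case (Suc m)
  then show ?case
    by (auto simp: generator_def next_generator_def left_mult_def split: list.splits if_splits)
qed (auto simp: generator_def unit_word_def split: if_splits)

text \<open>The words of weight \<open>n\<close> with exactly \<open>k\<close> letters \<open>y\<close> are those with \<open>n - k\<close> letters.\<close>

definition graded_word_chains :: "nat \<Rightarrow> nat \<Rightarrow> (bool list \<Rightarrow> rat) set" where
  "graded_word_chains n k = {f. \<forall>w. f w \<noteq> 0 \<longrightarrow> weight w = n \<and> length w + k = n}"

text \<open>Restriction to the words with \<open>n - k\<close> letters turns a result on all words of weight \<open>n\<close> into a result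
  on the part of degree \<open>k\<close>.  The multiple of \<open>z\<close> disappears if \<open>z\<close> has another degree.\<close>

lemma graded_part:
  assumes f: "f \<in> graded_word_chains n k" and z: "\<And>w. z w \<noteq> 0 \<Longrightarrow> length w = l"
    and g: "g \<in> word_chains n" and eq: "f = (\<lambda>w. c * z w + word_boundary g w)"
  shows "\<exists>g\<in>graded_word_chains n (Suc k).
    f = (\<lambda>w. (if l + k = n then c * z w else 0) + word_boundary g w)"
proof
  let ?g = "\<lambda>w. if length w + Suc k = n then g w else 0"
  show "?g \<in> graded_word_chains n (Suc k)"
    using g by (auto simp: graded_word_chains_def word_chains_def)
  have b: "word_boundary ?g w = (if length w + k = n then word_boundary g w else 0)" for w
    using word_boundary_restrict_length[of "\<lambda>l. l + k = n" g w] by simp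
  show "f = (\<lambda>w. (if l + k = n then c * z w else 0) + word_boundary ?g w)"
  proof
    fix w
    have "f w = (if length w + k = n then f w else 0)"
      using f by (auto simp: graded_word_chains_def)
    also have "\<dots> = (if l + k = n then c * z w else 0) + word_boundary ?g w"
      using z[of w] unfolding b eq by (cases "z w = 0") auto
    finally show "f w = \<dots>" .
  qed
qed

lemma graded_subset_word_chains: "graded_word_chains n k \<subseteq> word_chains n"
  by (auto simp: graded_word_chains_def word_chains_def)

lemma graded_homology_line:
  assumes "n = 3 * k \<or> n = 3 * k + 1"
  obtains z where "z \<in> graded_word_chains n k" "word_boundary z = (\<lambda>w. 0)"
    "\<And>g. g \<in> word_chains n \<Longrightarrow> z \<noteq> word_boundary g"
    "\<And>f. f \<in> graded_word_chains n k \<Longrightarrow> word_boundary f = (\<lambda>w. 0) \<Longrightarrow>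
       \<exists>c. \<exists>g\<in>graded_word_chains n (Suc k). f = (\<lambda>w. c * z w + word_boundary g w)"
proof -
  define z where "z = (if n = 3 * k then generator k else times_x (generator k))"
  have z: "spans_homology n z"
    using word_homology[of k] assms by (auto simp: z_def)
  have len: "length w + k = n" if "z w \<noteq> 0" for w
    using assms that generator_length[of k w] generator_length[of k "tl w"]
    by (cases w) (auto simp: z_def split: if_splits)
  then have len': "\<And>w. z w \<noteq> 0 \<Longrightarrow> length w = n - k" by fastforce
  show ?thesis
  proof
    show "z \<in> graded_word_chains n k"
      using z len by (auto simp: spans_homology_def word_chains_def graded_word_chains_def)
    show "word_boundary z = (\<lambda>w. 0)" "\<And>g. g \<in> word_chains n \<Longrightarrow> z \<noteq> word_boundary g"
      using z by (auto simp: spans_homology_def)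
    fix f assume f: "f \<in> graded_word_chains n k" and "word_boundary f = (\<lambda>w. 0)"
    then obtain c g where "g \<in> word_chains n" "f = (\<lambda>w. c * z w + word_boundary g w)"
      using z graded_subset_word_chains unfolding spans_homology_def by blast
    from graded_part[OF f len' this]
    obtain g where "g \<in> graded_word_chains n (Suc k)" "f = (\<lambda>w. c * z w + word_boundary g w)"
      using assms by auto
    then show "\<exists>c. \<exists>g\<in>graded_word_chains n (Suc k). f = (\<lambda>w. c * z w + word_boundary g w)"
      by blast
  qed
qed

text \<open>In weight \<open>n\<close> the homology is zero or spanned by a generator with \<open>n div 3\<close> letters \<open>y\<close>, and this
  generator does not have degree \<open>k\<close>.\<close>

lemma graded_homology_zero:
  assumes nk: "n \<noteq> 3 * k" "n \<noteq> 3 * k + 1"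
    and f: "f \<in> graded_word_chains n k" and cyc: "word_boundary f = (\<lambda>w. 0)"
  shows "\<exists>g\<in>graded_word_chains n (Suc k). f = word_boundary g"
proof -
  obtain c z l g where z: "\<And>w. z w \<noteq> 0 \<Longrightarrow> length w = l" "l + k \<noteq> n"
    and g: "g \<in> word_chains n" "f = (\<lambda>w. c * z w + word_boundary g w)"
  proof -
    define m where "m = n div 3"
    have "n = 3 * m \<or> n = 3 * m + 1 \<or> n = 3 * m + 2" unfolding m_def by presburger
    then consider "n = 3 * m" | "n = 3 * m + 1" | "n = 3 * m + 2" by blast
    then show ?thesis
    proof cases
      case 1
      then obtain c g where "g \<in> word_chains n" "f = (\<lambda>w. c * generator m w + word_boundary g w)"
        using word_homology[of m] f cyc graded_subset_word_chains unfolding spans_homology_def by blast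
      then show ?thesis
        using that[of "generator m" "2 * m"] generator_length 1 nk by auto
    next
      case 2
      then obtain c g where "g \<in> word_chains n" "f = (\<lambda>w. c * times_x (generator m) w + word_boundary g w)"
        using word_homology[of m] f cyc graded_subset_word_chains unfolding spans_homology_def by blast
      moreover have "length w = 2 * m + 1" if "times_x (generator m) w \<noteq> 0" for w
        using that generator_length[of m] by (cases w) (auto split: if_splits)
      ultimately show ?thesis
        using that[of "times_x (generator m)" "2 * m + 1"] 2 nk by auto
    next
      case 3
      then obtain g where "g \<in> word_chains n" "f = word_boundary g"
        using word_homology[of m] f cyc graded_subset_word_chains unfolding acyclic_weight_def by blast
      then show ?thesis
        using that[of "\<lambda>w. 0" "n + 1" g 0] by auto
    qed
  qed
  from graded_part[OF f z(1) g] z(2) show ?thesis by auto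
qed

lemma word_boundary_weight:
  "word_boundary f w \<noteq> 0 \<Longrightarrow> \<exists>v. f v \<noteq> 0 \<and> weight v = weight w"
proof (induction w arbitrary: f)
  case (Cons a w)
  show ?case
  proof (cases "word_boundary (\<lambda>v. f (a # v)) w = 0")
    case True
    then have ne: "(case w of b # v \<Rightarrow> if a \<or> b then 0 else 2 * f (True # v) | [] \<Rightarrow> 0) \<noteq> 0"
      using Cons.prems by simp
    show ?thesis
    proof (cases w)
      case (Cons b v)
      with ne have "\<not> a" "\<not> b" "f (True # v) \<noteq> 0" by (simp_all split: if_splits)
      then show ?thesis by (intro exI[of _ "True # v"]) (simp add: Cons)
    qed (use ne in simp)
  next
    case False
    from Cons.IH[OF this] obtain v where "f (a # v) \<noteq> 0" "weight v = weight w" by blast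
    then show ?thesis by (intro exI[of _ "a # v"]) simp
  qed
qed simp

lemma word_boundary_in_word_chains: "f \<in> word_chains n \<Longrightarrow> word_boundary f \<in> word_chains n"
  using word_boundary_weight[of f] by (fastforce simp: word_chains_def)

section \<open>The boundary operator evaluated symbol by symbol\<close>

text \<open>The contribution of the first two blocks of \<open>t\<close> to the coefficient of \<open>t\<close> in the boundary of \<open>c\<close>: the
  blocks \<open>ab\<close> and \<open>ba\<close> have \<open>a|b\<close> in their boundaries with the signs \<open>1\<close> and \<open>-1\<close>, and \<open>a|b\<close>
  does not occur in the boundary of any other block.\<close>

fun merge_coefficient :: "chain \<Rightarrow> symbol \<Rightarrow> rat" where
  "merge_coefficient c ([a] # [b] # t) = c ([a, b] # t) - c ([b, a] # t)"
| "merge_coefficient c t = 0"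

text \<open>The boundary operator, evaluated at the symbol that is split rather than summed over the cells:
  the coefficient at \<open>t\<close> collects the symbols that arise from \<open>t\<close> by merging two neighbouring
  blocks of length one.  This form makes sense for all chains and allows induction over \<open>t\<close>.\<close>

fun symbol_boundary :: "chain \<Rightarrow> chain" where
  "symbol_boundary c [] = 0"
| "symbol_boundary c (h # t) = merge_coefficient c (h # t) - symbol_boundary (\<lambda>s. c (h # s)) t"

lemma merge_coefficient_cases:
  obtains x y v where "t = [x] # [y] # v"
  | "\<nexists>x y v. t = [x] # [y] # v" "\<And>c. merge_coefficient c t = 0"
proof (cases "\<exists>x y v. t = [x] # [y] # v")
  case False
  have "merge_coefficient c t = 0" for c
    using False by (cases "(c, t)" rule: merge_coefficient.cases) simp_all
  with False show ?thesis by (rule that(2))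
qed (use that in blast)

lemma merge_coefficient_nonzero:
  assumes "merge_coefficient c t \<noteq> 0"
  shows "\<exists>x y v. t = [x] # [y] # v"
proof (rule merge_coefficient_cases[of t])
  assume "\<And>c. merge_coefficient c t = 0"
  then show ?thesis using assms by simp
qed simp

lemma merge_coefficient_zero [simp]: "merge_coefficient (\<lambda>s. 0) t = 0"
  by (rule merge_coefficient_cases[of t]) simp_all

lemma symbol_boundary_zero [simp]: "symbol_boundary (\<lambda>s. 0) t = 0"
  by (induction t) simp_all

lemma merge_coefficient_linear:
  "merge_coefficient (\<lambda>s. a * c s + b * d s) t = a * merge_coefficient c t + b * merge_coefficient d t"
  by (rule merge_coefficient_cases[of t]) (simp_all add: algebra_simps)

lemma symbol_boundary_linear:
  "symbol_boundary (\<lambda>s. a * c s + b * d s) t = a * symbol_boundary c t + b * symbol_boundary d t"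
  by (induction t arbitrary: c d) (auto simp: merge_coefficient_linear algebra_simps)

lemma merge_coefficient_map:
  "merge_coefficient (\<lambda>s. c (map (map \<tau>) s)) t = merge_coefficient c (map (map \<tau>) t)"
proof (rule merge_coefficient_cases[of t])
  assume t: "\<nexists>x y v. t = [x] # [y] # v" and "\<And>c. merge_coefficient c t = 0"
  moreover have "merge_coefficient c (map (map \<tau>) t) = 0"
    by (rule merge_coefficient_cases[of "map (map \<tau>) t"]) (use t in \<open>auto simp: map_eq_Cons_conv\<close>)
  ultimately show ?thesis by simp
qed simp

lemma symbol_boundary_diff:
  "symbol_boundary (\<lambda>s. c s - d s) t = symbol_boundary c t - symbol_boundary d t"
  using symbol_boundary_linear[of 1 c "-1" d t] by simp

lemma symbol_boundary_scale: "symbol_boundary (\<lambda>s. a * c s) t = a * symbol_boundary c t"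
  using symbol_boundary_linear[of a c 0 c t] by simp

lemma symbol_boundary_add: "symbol_boundary (\<lambda>s. c s + d s) t = symbol_boundary c t + symbol_boundary d t"
  using symbol_boundary_linear[of 1 c 1 d t] by simp

lemma symbol_boundary_sum:
  "finite A \<Longrightarrow> symbol_boundary (\<lambda>s. \<Sum>i\<in>A. c i s) t = (\<Sum>i\<in>A. symbol_boundary (c i) t)"
  by (induction A rule: finite_induct) (simp_all add: symbol_boundary_add)

lemma symbol_boundary_map:
  "symbol_boundary (\<lambda>s. c (map (map \<tau>) s)) t = symbol_boundary c (map (map \<tau>) t)"
proof (induction t arbitrary: c)
  case (Cons h t)
  then show ?case
    using merge_coefficient_map[of c \<tau> "h # t"] Cons.IH[of "\<lambda>s. c (map \<tau> h # s)"] by simp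
qed simp

text \<open>Two disjoint pairs of neighbouring blocks can be merged in either order, and two overlapping
  pairs cannot both be merged, because a merged block has length two.\<close>

lemma symbol_boundary_merge_tail:
  "merge_coefficient (symbol_boundary c) (h # t) = symbol_boundary (\<lambda>s. merge_coefficient c (h # s)) t"
proof (cases "length h = 1")
  case True
  then obtain a where h: "h = [a]" by (cases h) auto
  show ?thesis
  proof (cases t)
    case (Cons g u)
    show ?thesis
    proof (cases "length g = 1")
      case True
      then obtain b where g: "g = [b]" by (cases g) auto
      have 1: "merge_coefficient (\<lambda>s. merge_coefficient c ([a] # s)) ([b] # u) = 0"
        by (rule merge_coefficient_cases[of "[b] # u"]) auto
      have 2: "symbol_boundary (\<lambda>s. c ([a, b] # s) - c ([b, a] # s)) u
        = symbol_boundary (\<lambda>s. c ([a, b] # s)) u - symbol_boundary (\<lambda>s. c ([b, a] # s)) u"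
        using symbol_boundary_linear[of 1 "\<lambda>s. c ([a, b] # s)" "-1" "\<lambda>s. c ([b, a] # s)"] by simp
      show ?thesis using 1 2 by (simp add: Cons h g)
    next
      case False
      then have "merge_coefficient c ([a] # g # s) = 0" for c s
        by (rule_tac merge_coefficient_cases[of "[a] # g # s"]) simp_all
      moreover have "merge_coefficient c (g # s) = 0" for c s
        by (rule_tac merge_coefficient_cases[of "g # s"]) (use False in simp_all)
      ultimately show ?thesis by (simp add: Cons h)
    qed
  qed (simp add: h)
next
  case False
  then have "merge_coefficient c (h # u) = 0" for c u
    by (rule_tac merge_coefficient_cases[of "h # u"]) simp_all
  then show ?thesis by simp
qed

lemma symbol_boundary_boundary: "symbol_boundary (symbol_boundary c) t = 0"
proof (induction t arbitrary: c)
  case (Cons h t)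
  have "symbol_boundary (\<lambda>s. symbol_boundary c (h # s)) t
    = symbol_boundary (\<lambda>s. merge_coefficient c (h # s)) t
      - symbol_boundary (symbol_boundary (\<lambda>s. c (h # s))) t"
    unfolding symbol_boundary.simps(2) symbol_boundary_diff ..
  then have "symbol_boundary (\<lambda>s. symbol_boundary c (h # s)) t
    = merge_coefficient (symbol_boundary c) (h # t)"
    unfolding Cons.IH symbol_boundary_merge_tail by simp
  then show ?case
    by (simp only: symbol_boundary.simps(2)[of "symbol_boundary c"] diff_self)
qed simp

definition small_blocks :: "symbol \<Rightarrow> bool" where
  "small_blocks s \<longleftrightarrow> (\<forall>g\<in>set s. g \<noteq> [] \<and> length g \<le> 2)"

lemma small_blocks_simps [simp]:
  "small_blocks []" "small_blocks (g # s) \<longleftrightarrow> g \<noteq> [] \<and> length g \<le> 2 \<and> small_blocks s"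
  by (auto simp: small_blocks_def)

text \<open>Merging two blocks preserves the labels and removes one bar.\<close>

lemma symbol_boundary_support:
  assumes "symbol_boundary c t \<noteq> 0"
  shows "\<exists>s. c s \<noteq> 0 \<and> mset (concat s) = mset (concat t) \<and> length t = Suc (length s) \<and>
    (small_blocks s \<longrightarrow> small_blocks t)"
  using assms
proof (induction t arbitrary: c)
  case (Cons h t)
  show ?case
  proof (cases "merge_coefficient c (h # t) = 0")
    case False
    then have "\<exists>a b u. h # t = [a] # [b] # u"
      by (rule merge_coefficient_nonzero)
    then obtain a b u where ht: "h = [a]" "t = [b] # u" by blast
    with False have "c ([a, b] # u) \<noteq> 0 \<or> c ([b, a] # u) \<noteq> 0" by auto
    then show ?thesis
    proof
      assume "c ([a, b] # u) \<noteq> 0"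
      then show ?thesis by (intro exI[of _ "[a, b] # u"]) (simp add: ht)
    next
      assume "c ([b, a] # u) \<noteq> 0"
      then show ?thesis by (intro exI[of _ "[b, a] # u"]) (simp add: ht)
    qed
  next
    case True
    then have "symbol_boundary (\<lambda>s. c (h # s)) t \<noteq> 0" using Cons.prems by simp
    from Cons.IH[OF this] obtain s where "c (h # s) \<noteq> 0" "mset (concat s) = mset (concat t)"
      "length t = Suc (length s)" "small_blocks s \<longrightarrow> small_blocks t" by blast
    then show ?thesis by (intro exI[of _ "h # s"]) simp
  qed
qed simp

lemma word_sign_swap: "a \<noteq> b \<Longrightarrow> word_sign [a, b] [b, a] = -1"
proof -
  assume ab: "a \<noteq> b"
  have "(THE p. p permutes {a, b} \<and> map p [a, b] = [b, a]) = transpose a b"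
  proof (rule the_equality)
    show "transpose a b permutes {a, b} \<and> map (transpose a b) [a, b] = [b, a]"
      by (auto intro: permutes_swap_id)
    fix p assume p: "p permutes {a, b} \<and> map p [a, b] = [b, a]"
    show "p = transpose a b"
    proof
      fix x show "p x = transpose a b x"
        using p by (cases "x \<in> {a, b}") (auto simp: permutes_def transpose_def)
    qed
  qed
  then show ?thesis using ab by (simp add: word_sign_def sign_swap_id)
qed

lemma word_sign_self: "word_sign g g = 1"
proof -
  have "(THE p. p permutes set g \<and> map p g = g) = id"
  proof (rule the_equality)
    fix p assume p: "p permutes set g \<and> map p g = g"
    then have "map p g = map id g" by simp
    then have "\<forall>x\<in>set g. p x = id x" by (simp only: map_eq_conv)
    moreover have "\<forall>x. x \<notin> set g \<longrightarrow> p x = id x" using p permutes_not_in[of p "set g"] by simp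
    ultimately show "p = id" by blast
  qed (auto simp: permutes_id)
  then show ?thesis by (simp add: word_sign_def)
qed

lemma splittings_singleton: "splittings [a] = {}"
proof -
  have "\<not> (\<alpha> \<noteq> [] \<and> \<beta> \<noteq> [] \<and> [a] \<in> shuffles \<alpha> \<beta>)" for \<alpha> \<beta>
    using length_shuffles[of "[a]" \<alpha> \<beta>] by (cases \<alpha>; cases \<beta>) auto
  then show ?thesis unfolding splittings_def by blast
qed

lemma splittings_pair: "a \<noteq> b \<Longrightarrow> splittings [a, b] = {([a], [b]), ([b], [a])}"
proof -
  have "\<alpha> \<noteq> [] \<and> \<beta> \<noteq> [] \<and> [a, b] \<in> shuffles \<alpha> \<beta> \<longleftrightarrow>
      (\<alpha> = [a] \<and> \<beta> = [b]) \<or> (\<alpha> = [b] \<and> \<beta> = [a])" (is "?l \<longleftrightarrow> ?r") for \<alpha> \<beta>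
  proof
    assume l: ?l
    then have "length \<alpha> + length \<beta> = 2" using length_shuffles[of "[a, b]" \<alpha> \<beta>] by simp
    with l have "length \<alpha> = 1" "length \<beta> = 1" by (cases \<alpha>; cases \<beta>; simp)+
    then obtain x y where "\<alpha> = [x]" "\<beta> = [y]"
      by (metis One_nat_def length_0_conv length_Suc_conv)
    with l show ?r by auto
  next
    assume ?r
    then show ?l by auto
  qed
  then show ?thesis unfolding splittings_def by blast
qed

lemma block_boundary_singleton: "block_boundary [a] = (\<lambda>u. 0)"
  by (simp add: block_boundary_def splittings_singleton)

lemma block_boundary_pair:
  "a \<noteq> b \<Longrightarrow> block_boundary [a, b] = (\<lambda>u. cell_chain [[a], [b]] u - cell_chain [[b], [a]] u)"
  by (simp add: block_boundary_def splittings_pair word_sign_swap word_sign_self)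

text \<open>The boundary of a block of length two consists of symbols with two blocks, so only the cut after
  the second block of \<open>h # t\<close> contributes to \<open>bar\<close>.\<close>

lemma cell_boundary_recursion:
  assumes "length g = 1 \<or> length g = 2 \<and> distinct g"
  shows "cell_boundary (g # s) (h # t) =
    merge_coefficient (cell_chain (g # s)) (h # t) - (if g = h then cell_boundary s t else 0)"
proof -
  let ?u = "h # t"
  have z: "block_boundary g v = 0" if "length v \<noteq> 2" for v
  proof -
    from assms consider a where "g = [a]" | a b where "g = [a, b]" "a \<noteq> b"
      by (auto simp: length_Suc_conv numeral_2_eq_2)
    then show ?thesis
      using that by cases (auto simp: block_boundary_singleton block_boundary_pair cell_chain_def)
  qed
  have "bar (block_boundary g) (cell_chain s) ?u =
      (\<Sum>i\<le>length ?u. if i = 2 then block_boundary g (take 2 ?u) * cell_chain s (drop 2 ?u) else 0)"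
    unfolding bar_def
  proof (intro sum.cong refl)
    fix i assume "i \<in> {..length ?u}"
    then show "block_boundary g (take i ?u) * cell_chain s (drop i ?u) =
      (if i = 2 then block_boundary g (take 2 ?u) * cell_chain s (drop 2 ?u) else 0)"
      using z[of "take i ?u"] by auto
  qed
  also have "\<dots> = block_boundary g (take 2 ?u) * cell_chain s (drop 2 ?u)"
  proof (cases "2 \<le> length ?u")
    case False
    then have "length (take 2 ?u) \<noteq> 2" by simp
    then have "block_boundary g (take 2 ?u) = 0" by (rule z)
    then show ?thesis by (simp only: mult_zero_left if_cancel sum.neutral_const)
  qed (simp only: sum.delta finite_atMost atMost_iff if_True)
  also have "\<dots> = merge_coefficient (cell_chain (g # s)) ?u"
  proof (cases "length g = 1")
    case True
    then obtain a where "g = [a]" by (auto simp: length_Suc_conv)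
    moreover have "merge_coefficient (cell_chain ([a] # s)) ?u = 0"
      by (rule merge_coefficient_cases[of ?u]) (auto simp: cell_chain_def)
    ultimately show ?thesis by (simp add: block_boundary_singleton)
  next
    case False
    then obtain a b where g: "g = [a, b]" and ab: "a \<noteq> b"
      using assms by (auto simp: length_Suc_conv numeral_2_eq_2)
    show ?thesis
    proof (cases "\<exists>x y v. h = [x] \<and> t = [y] # v")
      case True
      then obtain x y v where ht: "h = [x]" "t = [y] # v" by blast
      then show ?thesis
        by (simp add: g block_boundary_pair[OF ab] cell_chain_def)
    next
      case False
      then have "block_boundary g (take 2 ?u) = 0"
      proof -
        have "take 2 ?u \<noteq> [[x], [y]]" for x y using False by (cases t) auto
        then show ?thesis by (simp only: g block_boundary_pair[OF ab] cell_chain_def if_False diff_0_right)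
      qed
      then show ?thesis using False by (rule_tac merge_coefficient_cases[of ?u]) auto
    qed
  qed
  finally have 1: "bar (block_boundary g) (cell_chain s) ?u = merge_coefficient (cell_chain (g # s)) ?u" .
  have 2: "bar (cell_chain [g]) (cell_boundary s) ?u = (if g = h then cell_boundary s t else 0)"
    unfolding bar_cell_chain_left by auto
  show ?thesis unfolding cell_boundary.simps 1 2 ..
qed

lemma cell_boundary_Nil_right: "cell_boundary s [] = 0"
proof (induction s)
  case (Cons g s)
  have "block_boundary g [] = 0"
    by (auto simp: block_boundary_def cell_chain_def intro!: sum.neutral)
  then show ?case by (simp add: bar_def[of "block_boundary g"] bar_cell_chain_left)
qed simp

lemma merge_coefficient_sum:
  "finite S \<Longrightarrow> merge_coefficient (\<lambda>u. \<Sum>s\<in>S. f s u) t = (\<Sum>s\<in>S. merge_coefficient (f s) t)"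
  by (rule merge_coefficient_cases[of t]) (simp_all add: sum_subtractf)

text \<open>Each block has to be \<open>distinct\<close>, since the boundary of the block \<open>aa\<close> would be \<open>a|a\<close>, whereas
  \<open>merge_coefficient\<close> subtracts \<open>c\<close> from itself at such a block.\<close>

lemma sum_cell_boundary:
  assumes "finite S" and S: "\<And>s. c s \<noteq> 0 \<Longrightarrow> s \<in> S \<and> small_blocks s \<and> (\<forall>g\<in>set s. distinct g)"
  shows "(\<Sum>s\<in>S. c s * cell_boundary s t) = symbol_boundary c t"
  using assms
proof (induction t arbitrary: c S)
  case Nil
  then show ?case by (simp add: cell_boundary_Nil_right)
next
  case (Cons h t)
  let ?T = "{s. h # s \<in> S}"
  have fin: "finite ?T"
    using finite_vimageI[OF Cons.prems(1), of "\<lambda>s. h # s"] by (simp add: vimage_def inj_def)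
  have IH: "(\<Sum>s\<in>?T. c (h # s) * cell_boundary s t) = symbol_boundary (\<lambda>s. c (h # s)) t"
  proof (rule Cons.IH[OF fin])
    fix s assume "c (h # s) \<noteq> 0"
    from Cons.prems(2)[OF this]
    show "s \<in> ?T \<and> small_blocks s \<and> (\<forall>g\<in>set s. distinct g)" by simp
  qed
  let ?r = "\<lambda>s. if s \<noteq> [] \<and> hd s = h then c s * cell_boundary (tl s) t else 0"
  have summand: "c s * cell_boundary s (h # t) =
      merge_coefficient (\<lambda>u. c s * cell_chain s u) (h # t) - ?r s" for s
  proof (cases "c s = 0")
    case False
    note s = Cons.prems(2)[OF False]
    show ?thesis
    proof (cases s)
      case Nil
      have "merge_coefficient (\<lambda>u. c s * cell_chain s u) (h # t) = 0"
        by (rule merge_coefficient_cases[of "h # t"]) (simp_all add: Nil cell_chain_def)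
      then show ?thesis by (simp add: Nil)
    next
      case (Cons g u)
      then have "length g = 1 \<or> length g = 2 \<and> distinct g"
        using s by (cases g; cases "tl g") auto
      from cell_boundary_recursion[OF this, of u h t] show ?thesis
        using merge_coefficient_linear[of "c s" "cell_chain s" 0 "cell_chain s" "h # t"]
        by (auto simp: Cons right_diff_distrib simp del: cell_boundary.simps merge_coefficient.simps)
    qed
  qed simp
  have "(\<Sum>s\<in>S. c s * cell_boundary s (h # t)) =
      merge_coefficient (\<lambda>u. \<Sum>s\<in>S. c s * cell_chain s u) (h # t) - (\<Sum>s\<in>S. ?r s)"
    unfolding summand sum_subtractf merge_coefficient_sum[OF Cons.prems(1)] ..
  also have "(\<lambda>u. \<Sum>s\<in>S. c s * cell_chain s u) = c"
  proof
    fix u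
    have "(\<Sum>s\<in>S. c s * cell_chain s u) = (\<Sum>s\<in>S. if s = u then c u else 0)"
      by (rule sum.cong) (auto simp: cell_chain_def)
    also have "\<dots> = c u"
      using Cons.prems(1) Cons.prems(2)[of u] by (auto simp: sum.delta)
    finally show "(\<Sum>s\<in>S. c s * cell_chain s u) = c u" .
  qed
  also have "(\<Sum>s\<in>S. ?r s) = (\<Sum>s\<in>{s\<in>S. s \<noteq> [] \<and> hd s = h}. c s * cell_boundary (tl s) t)"
    using Cons.prems(1) by (simp add: sum.inter_filter)
  also have "\<dots> = (\<Sum>s\<in>?T. c (h # s) * cell_boundary s t)"
    by (rule sum.reindex_bij_witness[of _ "\<lambda>s. h # s" tl]) auto
  finally show ?case unfolding IH symbol_boundary.simps .
qed

section \<open>Alternating chains\<close>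

lemma finite_cells: "finite (cells n w k)"
proof (rule finite_subset)
  show "finite {s :: symbol. set s \<subseteq> {g. set g \<subseteq> {1..n} \<and> length g \<le> n} \<and> length s \<le> n}"
    by (intro finite_lists_length_le) simp
  show "cells n w k \<subseteq> {s. set s \<subseteq> {g. set g \<subseteq> {1..n} \<and> length g \<le> n} \<and> length s \<le> n}"
  proof
    fix s assume "s \<in> cells n w k"
    then have s: "[] \<notin> set s" "distinct (concat s)" "set (concat s) = {1..n}"
      by (auto simp: cells_def is_symbol_def)
    have len: "length (concat s) = n"
      using distinct_card[OF s(2)] s(3) by simp
    have "length s \<le> length (concat s)"
      using s(1)
    proof (induction s)
      case (Cons g s)
      then show ?case by (cases g) auto
    qed simp
    moreover have "length g \<le> length (concat s)" if "g \<in> set s" for g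
      using that by (induction s) auto
    moreover have "set g \<subseteq> set (concat s)" if "g \<in> set s" for g
      using that by auto
    ultimately show "s \<in> {s. set s \<subseteq> {g. set g \<subseteq> {1..n} \<and> length g \<le> n} \<and> length s \<le> n}"
      using s(3) len by auto
  qed
qed

lemma cells_iff:
  "s \<in> cells n 2 k \<longleftrightarrow>
     small_blocks s \<and> distinct (concat s) \<and> set (concat s) = {1..n} \<and> n - length s = k"
  by (auto simp: cells_def is_symbol_def small_blocks_def)

lemma boundary_eq_symbol_boundary:
  assumes "c \<in> chains n 2 k"
  shows "boundary n 2 k c = symbol_boundary c"
  unfolding boundary_def
proof (intro ext sum_cell_boundary finite_cells)
  fix s assume "c s \<noteq> 0"
  then have "s \<in> cells n 2 k" using assms by (auto simp: chains_def)
  then show "s \<in> cells n 2 k \<and> small_blocks s \<and> (\<forall>g\<in>set s. distinct g)"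
    by (auto simp: cells_iff distinct_concat_iff)
qed

lemma symbol_boundary_in_chains:
  assumes "c \<in> chains n 2 (Suc k)"
  shows "symbol_boundary c \<in> chains n 2 k"
  unfolding chains_def
proof (intro CollectI allI impI, rule ccontr)
  fix t assume t: "t \<notin> cells n 2 k" and "symbol_boundary c t \<noteq> 0"
  from symbol_boundary_support[OF this(2)] obtain s where "c s \<noteq> 0"
    and m: "mset (concat s) = mset (concat t)" "length t = Suc (length s)"
      "small_blocks s \<longrightarrow> small_blocks t" by blast
  then have "s \<in> cells n 2 (Suc k)" using assms by (auto simp: chains_def)
  then have "t \<in> cells n 2 k"
    using m mset_eq_imp_distinct_iff[OF m(1)] mset_eq_setD[OF m(1)] by (auto simp: cells_iff)
  with t show False ..
qed

text \<open>The permutation with one-line notation \<open>w\<close>.\<close>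

definition word_perm :: "nat list \<Rightarrow> nat \<Rightarrow> nat" where
  "word_perm w i = (if i \<in> {1..length w} then w ! (i - 1) else i)"

text \<open>The value 0 on lists that are no arrangement of \<open>{1..n}\<close> makes the swap rule below hold for all
  lists.\<close>

definition standard_sign :: "nat \<Rightarrow> nat list \<Rightarrow> rat" where
  "standard_sign n w =
     (if distinct w \<and> set w = {1..n} then of_int (sign (word_perm w)) else 0)"

lemma word_perm_permutes:
  assumes "distinct w" "set w = {1..n}"
  shows "word_perm w permutes {1..n}" "map (word_perm w) [1..<Suc n] = w"
proof -
  have len: "length w = n" using distinct_card[OF assms(1)] assms(2) by simp
  show m: "map (word_perm w) [1..<Suc n] = w"
    by (rule nth_equalityI) (simp_all add: len word_perm_def del: upt_Suc)
  have "word_perm w ` {1..n} = set (map (word_perm w) [1..<Suc n])" by auto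
  then have im: "word_perm w ` {1..n} = {1..n}" unfolding m assms(2) .
  then have "inj_on (word_perm w) {1..n}" by (intro eq_card_imp_inj_on) simp_all
  with im show "word_perm w permutes {1..n}"
    by (intro bij_imp_permutes) (auto simp: bij_betw_def word_perm_def len)
qed

lemma standard_sign_map:
  assumes \<sigma>: "\<sigma> permutes {1..n}"
  shows "standard_sign n (map \<sigma> w) = of_int (sign \<sigma>) * standard_sign n w"
proof (cases "distinct w \<and> set w = {1..n}")
  case True
  have len: "length w = n" using True distinct_card[of w] by simp
  have "word_perm (map \<sigma> w) = \<sigma> \<circ> word_perm w"
    using permutes_not_in[OF \<sigma>] by (auto simp: word_perm_def fun_eq_iff len)
  moreover have "sign (\<sigma> \<circ> word_perm w) = sign \<sigma> * sign (word_perm w)"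
    using \<sigma> word_perm_permutes(1)[of w n] True
    by (intro sign_compose) (auto simp: permutation_permutes)
  moreover have "distinct (map \<sigma> w)" "set (map \<sigma> w) = {1..n}"
    using True permutes_inj_on[OF \<sigma>] permutes_image[OF \<sigma>] by (auto simp: distinct_map)
  ultimately show ?thesis using True by (simp add: standard_sign_def)
next
  case False
  have "distinct (map \<sigma> w) \<longleftrightarrow> distinct w"
    using permutes_inj_on[OF \<sigma>] by (simp add: distinct_map)
  moreover have "\<sigma> ` set w = \<sigma> ` {1..n} \<longleftrightarrow> set w = {1..n}"
    by (rule inj_image_eq_iff[OF permutes_inj[OF \<sigma>]])
  ultimately show ?thesis
    using False permutes_image[OF \<sigma>] by (auto simp: standard_sign_def)
qed

text \<open>Exchanging two neighbouring labels \<open>a\<close> and \<open>b\<close> is the action of the transposition of \<open>a\<close> and \<open>b\<close> on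
  the values.\<close>

lemma standard_sign_swap:
  "standard_sign n (u @ a # b # v) = - standard_sign n (u @ b # a # v)"
proof (cases "distinct (u @ a # b # v) \<and> set (u @ a # b # v) = {1..n}")
  case True
  have "map (transpose a b) (u @ b # a # v) = u @ a # b # v"
    using True by (auto intro!: map_idI simp: transpose_def)
  moreover have "transpose a b permutes {1..n}"
    using True by (intro permutes_swap_id) auto
  ultimately show ?thesis
    using standard_sign_map[of "transpose a b" n "u @ b # a # v"] True
    by (simp add: sign_swap_id)
next
  case False
  moreover have "set (u @ b # a # v) = set (u @ a # b # v)" "distinct (u @ b # a # v) = distinct (u @ a # b # v)"
    by auto
  ultimately show ?thesis by (simp only: standard_sign_def) simp
qed

definition shape :: "symbol \<Rightarrow> bool list" where
  "shape s = map (\<lambda>g. length g = 2) s"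

definition signed_chain :: "(nat list \<Rightarrow> rat) \<Rightarrow> (bool list \<Rightarrow> rat) \<Rightarrow> chain" where
  "signed_chain \<epsilon> f = (\<lambda>s. if small_blocks s then \<epsilon> (concat s) * f (shape s) else 0)"

lemma signed_chain_zero: "signed_chain \<epsilon> (\<lambda>w. 0) = (\<lambda>s. 0)"
  by (simp add: signed_chain_def fun_eq_iff)

lemma short_block_iff: "g \<noteq> [] \<and> length g \<le> 2 \<longleftrightarrow> (\<exists>a. g = [a]) \<or> (\<exists>a b. g = [a, b])"
  by (cases g; cases "tl g") auto

text \<open>At neighbouring blocks \<open>a|b\<close> the two merged symbols contribute with \<open>\<epsilon> (\<dots>ab\<dots>) - \<epsilon> (\<dots>ba\<dots>)\<close>, which
  is \<open>2 \<epsilon> (\<dots>ab\<dots>)\<close>.  This is the origin of the rule \<open>d y = 2 x x\<close>.  The function \<open>\<epsilon>\<close> is arbitrary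
  because the induction replaces it by \<open>\<lambda>w. \<epsilon> (h @ w)\<close> when the first block \<open>h\<close> is split off.\<close>

lemma symbol_boundary_signed:
  assumes "\<And>u a b v. \<epsilon> (u @ a # b # v) = - \<epsilon> (u @ b # a # v)"
  shows "symbol_boundary (signed_chain \<epsilon> f) t = signed_chain \<epsilon> (word_boundary f) t"
  using assms
proof (induction t arbitrary: \<epsilon> f)
  case Nil
  then show ?case by (simp add: signed_chain_def shape_def)
next
  case (Cons h t)
  show ?case
  proof (cases "h \<noteq> [] \<and> length h \<le> 2")
    case False
    then have "(\<lambda>s. signed_chain \<epsilon> f (h # s)) = (\<lambda>s. 0)"
      by (auto simp: signed_chain_def)
    moreover have "merge_coefficient (signed_chain \<epsilon> f) (h # t) = 0"
      by (rule merge_coefficient_cases[of "h # t"]) (use False in auto)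
    moreover have "signed_chain \<epsilon> (word_boundary f) (h # t) = 0"
      using False by (auto simp: signed_chain_def)
    ultimately show ?thesis by simp
  next
    case True
    let ?a = "length h = 2"
    have "(\<lambda>s. signed_chain \<epsilon> f (h # s)) = signed_chain (\<lambda>w. \<epsilon> (h @ w)) (\<lambda>v. f (?a # v))"
      using True by (auto simp: signed_chain_def shape_def)
    note tail_chain = this
    have swap: "\<epsilon> (h @ u @ a # b # v) = - \<epsilon> (h @ u @ b # a # v)" for u a b v
      using Cons.prems[of "h @ u" a b v] by (simp only: append_assoc)
    have tail: "symbol_boundary (\<lambda>s. signed_chain \<epsilon> f (h # s)) t =
        signed_chain (\<lambda>w. \<epsilon> (h @ w)) (word_boundary (\<lambda>v. f (?a # v))) t"
      unfolding tail_chain by (rule Cons.IH) (rule swap)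
    have head: "merge_coefficient (signed_chain \<epsilon> f) (h # t) =
      (if small_blocks t then \<epsilon> (concat (h # t)) *
        (case shape t of b # v \<Rightarrow> if ?a \<or> b then 0 else 2 * f (True # v) | [] \<Rightarrow> 0) else 0)"
    proof (rule merge_coefficient_cases[of "h # t"])
      fix x y v assume "h # t = [x] # [y] # v"
      then have ht: "h = [x]" "t = [y] # v" by simp_all
      have "\<epsilon> (y # x # concat v) = - \<epsilon> (x # y # concat v)"
        using Cons.prems[of "[]" y x "concat v"] by (simp only: append_Nil)
      then show ?thesis by (simp add: ht signed_chain_def shape_def)
    next
      assume n: "\<nexists>x y v. h # t = [x] # [y] # v" and z: "\<And>c. merge_coefficient c (h # t) = 0"
      have "(case shape t of b # v \<Rightarrow> if ?a \<or> b then 0 else 2 * f (True # v) | [] \<Rightarrow> 0) = 0"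
        if small: "small_blocks t"
      proof (cases t)
        case (Cons g v)
        with small have "g \<noteq> [] \<and> length g \<le> 2" by simp
        with n True have "length h = 2 \<or> length g = 2"
          unfolding short_block_iff Cons by fastforce
        then show ?thesis by (auto simp: Cons shape_def)
      qed (simp add: shape_def)
      then show ?thesis unfolding z by (cases "small_blocks t") (simp_all only: if_True if_False mult_zero_right)
    qed
    show ?thesis
      unfolding symbol_boundary.simps tail head
      using True by (auto simp: signed_chain_def shape_def right_diff_distrib)
  qed
qed

text \<open>The symbol of shape \<open>w\<close> whose labels, read from left to right, are \<open>xs\<close>.\<close>

fun split_blocks :: "bool list \<Rightarrow> nat list \<Rightarrow> symbol" where
  "split_blocks [] xs = []"
| "split_blocks (a # w) xs = take (if a then 2 else 1) xs # split_blocks w (drop (if a then 2 else 1) xs)"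

lemma split_blocks_shape: "small_blocks s \<Longrightarrow> split_blocks (shape s) (concat s) = s"
proof (induction s)
  case (Cons g s)
  then show ?case using short_block_iff[of g] by (auto simp: shape_def)
qed (simp add: shape_def)

lemma split_blocks_props:
  "weight w = length xs \<Longrightarrow> small_blocks (split_blocks w xs) \<and>
     concat (split_blocks w xs) = xs \<and> shape (split_blocks w xs) = w"
proof (induction w arbitrary: xs)
  case (Cons a w)
  then have "weight w = length (drop (if a then 2 else 1) xs)" by auto
  from Cons.IH[OF this] show ?case
    using Cons.prems by (auto simp: shape_def split: if_splits)
qed (auto simp: shape_def)

lemma length_split_blocks [simp]: "length (split_blocks w xs) = length w"
  by (induction w arbitrary: xs) auto

lemma split_blocks_map: "split_blocks w (map \<sigma> xs) = map (map \<sigma>) (split_blocks w xs)"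
  by (induction w arbitrary: xs) (auto simp: take_map drop_map)

lemma weight_shape: "small_blocks s \<Longrightarrow> weight (shape s) = length (concat s)"
proof (induction s)
  case (Cons g s)
  then show ?case using short_block_iff[of g] by (auto simp: shape_def)
qed (simp add: shape_def)

lemma length_le_weight: "length w \<le> weight w"
  by (induction w) auto

definition alternating :: "nat \<Rightarrow> chain \<Rightarrow> bool" where
  "alternating n c \<longleftrightarrow>
     (\<forall>\<sigma>. \<sigma> permutes {1..n} \<longrightarrow> chain_action \<sigma> c = (\<lambda>s. of_int (sign \<sigma>) * c s))"

abbreviation sign_chain :: "nat \<Rightarrow> (bool list \<Rightarrow> rat) \<Rightarrow> chain" where
  "sign_chain n \<equiv> signed_chain (standard_sign n)"

definition chain_word :: "nat \<Rightarrow> chain \<Rightarrow> bool list \<Rightarrow> rat" where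
  "chain_word n c = (\<lambda>w. if weight w = n then c (split_blocks w [1..<Suc n]) else 0)"

lemma small_blocks_map [simp]: "small_blocks (map (map \<sigma>) s) = small_blocks s"
  by (simp add: small_blocks_def)

lemma shape_map [simp]: "shape (map (map \<sigma>) s) = shape s"
  by (simp add: shape_def)

lemma alternating_sign_chain: "alternating n (sign_chain n f)"
  unfolding alternating_def
proof (intro allI impI ext)
  fix \<sigma> s assume \<sigma>: "\<sigma> permutes {1..n}"
  have "sign (inv' \<sigma>) = sign \<sigma>"
    using \<sigma> by (intro sign_inverse) (auto simp: permutation_permutes)
  then show "chain_action \<sigma> (sign_chain n f) s = of_int (sign \<sigma>) * sign_chain n f s"
    using standard_sign_map[OF permutes_inv[OF \<sigma>], of "concat s"]
    by (simp add: chain_action_def signed_chain_def map_concat)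
qed

lemma sign_chain_in_chains:
  assumes "f \<in> graded_word_chains n k"
  shows "sign_chain n f \<in> chains n 2 k"
  using assms
  by (auto simp: chains_def cells_iff signed_chain_def standard_sign_def graded_word_chains_def shape_def)

lemma standard_sign_upt: "standard_sign n [Suc 0..<Suc n] = 1"
proof -
  have "word_perm [Suc 0..<Suc n] = id"
    by (auto simp: word_perm_def fun_eq_iff simp del: upt_Suc)
  moreover have "set [Suc 0..<Suc n] = {1..n}" by auto
  ultimately show ?thesis by (simp add: standard_sign_def del: upt_Suc)
qed

lemma chain_word_sign_chain:
  assumes "f \<in> word_chains n" shows "chain_word n (sign_chain n f) = f"
proof
  fix w
  have "f w = 0" if "weight w \<noteq> n" using assms that by (auto simp: word_chains_def)
  then show "chain_word n (sign_chain n f) w = f w"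
    using split_blocks_props[of w "[1..<Suc n]"]
    by (auto simp: chain_word_def signed_chain_def standard_sign_upt simp del: upt_Suc)
qed

lemma chain_word_graded:
  assumes "c \<in> chains n 2 k"
  shows "chain_word n c \<in> graded_word_chains n k"
  unfolding graded_word_chains_def
proof (intro CollectI allI impI)
  fix w assume "chain_word n c w \<noteq> 0"
  then have w: "weight w = n" and "c (split_blocks w [1..<Suc n]) \<noteq> 0"
    by (auto simp: chain_word_def simp del: upt_Suc split: if_splits)
  then have "split_blocks w [1..<Suc n] \<in> cells n 2 k" using assms by (auto simp: chains_def)
  then have "n - length w = k" by (simp add: cells_iff del: upt_Suc)
  then show "weight w = n \<and> length w + k = n" using w length_le_weight[of w] by simp
qed

text \<open>The group \<open>S\<^sub>n\<close> acts simply transitively on the symbols of a given shape, so an alternating chain is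
  determined by its values at the symbols with increasing labels.\<close>

lemma sign_chain_chain_word:
  assumes c: "c \<in> chains n 2 k" and alt: "alternating n c"
  shows "sign_chain n (chain_word n c) = c"
proof
  fix s
  show "sign_chain n (chain_word n c) s = c s"
  proof (cases "small_blocks s \<and> distinct (concat s) \<and> set (concat s) = {1..n}")
    case True
    define p where "p = word_perm (concat s)"
    have p: "p permutes {1..n}" and m: "map p [1..<Suc n] = concat s"
      using word_perm_permutes[of "concat s" n] True by (auto simp: p_def simp del: upt_Suc)
    have w: "weight (shape s) = n"
      using True weight_shape[of s] distinct_card[of "concat s"] by simp
    have s: "s = map (map p) (split_blocks (shape s) [1..<Suc n])"
      unfolding split_blocks_map[symmetric] m using split_blocks_shape True by simp
    have "map (map (inv' p)) s = split_blocks (shape s) [1..<Suc n]"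
      by (subst s) (simp add: o_def permutes_inverses[OF p] del: upt_Suc)
    then have "c (split_blocks (shape s) [1..<Suc n]) = chain_action p c s"
      by (simp add: chain_action_def)
    also have "\<dots> = of_int (sign p) * c s"
      using alt p by (simp add: alternating_def)
    finally have "sign_chain n (chain_word n c) s = of_int (sign p) * (of_int (sign p) * c s)"
      using True w unfolding p_def
      by (simp only: signed_chain_def standard_sign_def chain_word_def if_True simp_thms)
    also have "\<dots> = of_int (sign p * sign p) * c s" by (simp only: of_int_mult mult.assoc)
    finally show ?thesis by simp
  next
    case False
    then have "s \<notin> cells n 2 k" by (auto simp: cells_iff)
    then have "c s = 0" using c by (simp add: chains_def)
    then show ?thesis using False by (auto simp: signed_chain_def standard_sign_def)
  qed
qed

lemma symbol_boundary_sign_chain: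
  "symbol_boundary (sign_chain n f) = sign_chain n (word_boundary f)"
  using symbol_boundary_signed[of "standard_sign n", OF standard_sign_swap] by blast

section \<open>Transport of representations\<close>

text \<open>The map whose existence \<open>isomorphic_representations\<close> asserts.  It is named because the proof
  transports structure along one explicit map.\<close>

definition representation_iso ::
  "('g, 'm) monoid_scheme \<Rightarrow> ('k, 'r) ring_scheme
    \<Rightarrow> ('k, 'u, 'y) module_scheme \<Rightarrow> ('g \<Rightarrow> 'u \<Rightarrow> 'u)
    \<Rightarrow> ('k, 'v, 'z) module_scheme \<Rightarrow> ('g \<Rightarrow> 'v \<Rightarrow> 'v) \<Rightarrow> ('u \<Rightarrow> 'v) \<Rightarrow> bool" where
  "representation_iso G K U \<tau> V \<rho> f \<longleftrightarrow>
     bij_betw f (carrier U) (carrier V) \<and>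
       (\<forall>u\<in>carrier U. \<forall>u'\<in>carrier U. f (u \<oplus>\<^bsub>U\<^esub> u') = f u \<oplus>\<^bsub>V\<^esub> f u') \<and>
       (\<forall>c\<in>carrier K. \<forall>u\<in>carrier U. f (c \<odot>\<^bsub>U\<^esub> u) = c \<odot>\<^bsub>V\<^esub> f u) \<and>
       (\<forall>g\<in>carrier G. \<forall>u\<in>carrier U. f (\<tau> g u) = \<rho> g (f u))"

lemma representation_isoD:
  assumes "representation_iso G K U \<tau> V \<rho> f"
  shows "bij_betw f (carrier U) (carrier V)"
    "u \<in> carrier U \<Longrightarrow> f u \<in> carrier V"
    "u \<in> carrier U \<Longrightarrow> u' \<in> carrier U \<Longrightarrow> f (u \<oplus>\<^bsub>U\<^esub> u') = f u \<oplus>\<^bsub>V\<^esub> f u'"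
    "c \<in> carrier K \<Longrightarrow> u \<in> carrier U \<Longrightarrow> f (c \<odot>\<^bsub>U\<^esub> u) = c \<odot>\<^bsub>V\<^esub> f u"
    "g \<in> carrier G \<Longrightarrow> u \<in> carrier U \<Longrightarrow> f (\<tau> g u) = \<rho> g (f u)"
  using assms by (auto simp: representation_iso_def bij_betw_def)

lemma group_representationD:
  assumes "group_representation G K V \<rho>"
  shows "group G" "field K" "module K V" "abelian_group V" "cring K"
    "g \<in> carrier G \<Longrightarrow> v \<in> carrier V \<Longrightarrow> \<rho> g v \<in> carrier V"
    "g \<in> carrier G \<Longrightarrow> v \<in> carrier V \<Longrightarrow> w \<in> carrier V \<Longrightarrow> \<rho> g (v \<oplus>\<^bsub>V\<^esub> w) = \<rho> g v \<oplus>\<^bsub>V\<^esub> \<rho> g w"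
    "g \<in> carrier G \<Longrightarrow> c \<in> carrier K \<Longrightarrow> v \<in> carrier V \<Longrightarrow> \<rho> g (c \<odot>\<^bsub>V\<^esub> v) = c \<odot>\<^bsub>V\<^esub> \<rho> g v"
    "v \<in> carrier V \<Longrightarrow> \<rho> \<one>\<^bsub>G\<^esub> v = v"
    "g \<in> carrier G \<Longrightarrow> h \<in> carrier G \<Longrightarrow> v \<in> carrier V \<Longrightarrow> \<rho> (g \<otimes>\<^bsub>G\<^esub> h) v = \<rho> g (\<rho> h v)"
  using assms by (auto simp: group_representation_def module_def)

lemma submodule_iff:
  assumes "module K V"
  shows "submodule W K V \<longleftrightarrow> W \<subseteq> carrier V \<and> \<zero>\<^bsub>V\<^esub> \<in> W \<and>
    (\<forall>v\<in>W. \<forall>w\<in>W. v \<oplus>\<^bsub>V\<^esub> w \<in> W) \<and> (\<forall>c\<in>carrier K. \<forall>v\<in>W. c \<odot>\<^bsub>V\<^esub> v \<in> W)"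
proof -
  interpret module K V by fact
  show ?thesis
  proof
    assume W: "submodule W K V"
    then have "\<zero>\<^bsub>V\<^esub> \<in> W"
      using subgroup.one_closed[of W "add_monoid V"] by (simp add: submodule_def)
    with submoduleE[OF W] show "W \<subseteq> carrier V \<and> \<zero>\<^bsub>V\<^esub> \<in> W \<and>
      (\<forall>v\<in>W. \<forall>w\<in>W. v \<oplus>\<^bsub>V\<^esub> w \<in> W) \<and> (\<forall>c\<in>carrier K. \<forall>v\<in>W. c \<odot>\<^bsub>V\<^esub> v \<in> W)" by blast
  next
    assume W: "W \<subseteq> carrier V \<and> \<zero>\<^bsub>V\<^esub> \<in> W \<and>
      (\<forall>v\<in>W. \<forall>w\<in>W. v \<oplus>\<^bsub>V\<^esub> w \<in> W) \<and> (\<forall>c\<in>carrier K. \<forall>v\<in>W. c \<odot>\<^bsub>V\<^esub> v \<in> W)"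
    have "\<ominus>\<^bsub>V\<^esub> v \<in> W" if v: "v \<in> W" for v
    proof -
      have "\<ominus>\<^bsub>V\<^esub> v = (\<ominus>\<^bsub>K\<^esub> \<one>\<^bsub>K\<^esub>) \<odot>\<^bsub>V\<^esub> v" using W v by (auto simp: smult_l_minus)
      moreover have "(\<ominus>\<^bsub>K\<^esub> \<one>\<^bsub>K\<^esub>) \<odot>\<^bsub>V\<^esub> v \<in> W" using W v by simp
      ultimately show ?thesis by simp
    qed
    then show "submodule W K V" using W by (intro submoduleI) auto
  qed
qed

lemma subrepresentation_iff:
  assumes "module K V"
  shows "subrepresentation G K V \<rho> W \<longleftrightarrow> W \<subseteq> carrier V \<and> \<zero>\<^bsub>V\<^esub> \<in> W \<and>
    (\<forall>v\<in>W. \<forall>w\<in>W. v \<oplus>\<^bsub>V\<^esub> w \<in> W) \<and> (\<forall>c\<in>carrier K. \<forall>v\<in>W. c \<odot>\<^bsub>V\<^esub> v \<in> W) \<and>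
    (\<forall>g\<in>carrier G. \<forall>v\<in>W. \<rho> g v \<in> W)"
  unfolding subrepresentation_def submodule_iff[OF assms] by blast

lemma group_representation_restrict:
  assumes V: "group_representation G K V \<rho>" and W: "subrepresentation G K V \<rho> W"
  shows "group_representation G K (V\<lparr>carrier := W\<rparr>) \<rho>"
proof -
  note D = group_representationD[OF V]
  have "submodule W K V" using W by (simp add: subrepresentation_def)
  then have "module K (V\<lparr>carrier := W\<rparr>)" by (rule submodule.submodule_is_module[OF _ D(3)])
  moreover have "W \<subseteq> carrier V" "\<forall>g\<in>carrier G. \<forall>v\<in>W. \<rho> g v \<in> W"
    using W by (auto simp: subrepresentation_iff[OF D(3)])
  ultimately show ?thesis
    using D by (auto simp: group_representation_def subset_iff)
qed

text \<open>A bijection that respects all operations carries the axioms from \<open>U\<close> to \<open>V\<close>.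
  This reduces the axioms for a quotient space to those for a space of functions.\<close>

lemma group_representation_transport:
  assumes U: "group_representation G K U \<tau>" and f: "representation_iso G K U \<tau> V \<rho> f"
    and zero: "f \<zero>\<^bsub>U\<^esub> = \<zero>\<^bsub>V\<^esub>"
  shows "group_representation G K V \<rho>"
proof -
  note D = group_representationD[OF U] and F = representation_isoD[OF f]
  interpret U: module K U by (rule D(3))
  have surj: "\<exists>u\<in>carrier U. v = f u" if "v \<in> carrier V" for v
    using F(1) that by (auto simp: bij_betw_def)
  have "abelian_group V"
  proof (rule abelian_groupI)
    show "\<zero>\<^bsub>V\<^esub> \<in> carrier V" using F(2)[OF U.M.zero_closed] zero by simp
    fix x assume "x \<in> carrier V"
    then obtain u where u: "u \<in> carrier U" "x = f u" using surj by blast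
    show "\<zero>\<^bsub>V\<^esub> \<oplus>\<^bsub>V\<^esub> x = x"
      using F(3)[OF U.M.zero_closed u(1)] u by (simp add: zero)
    have "f (\<ominus>\<^bsub>U\<^esub> u) \<oplus>\<^bsub>V\<^esub> x = \<zero>\<^bsub>V\<^esub>"
      using F(3)[of "\<ominus>\<^bsub>U\<^esub> u" u] u zero by (simp add: U.M.l_neg)
    then show "\<exists>y\<in>carrier V. y \<oplus>\<^bsub>V\<^esub> x = \<zero>\<^bsub>V\<^esub>"
      using F(2)[of "\<ominus>\<^bsub>U\<^esub> u"] u by blast
    fix y assume "y \<in> carrier V"
    then obtain u' where u': "u' \<in> carrier U" "y = f u'" using surj by blast
    show "x \<oplus>\<^bsub>V\<^esub> y \<in> carrier V"
      using F(2,3) u u' by (metis U.M.add.m_closed)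
    show "x \<oplus>\<^bsub>V\<^esub> y = y \<oplus>\<^bsub>V\<^esub> x"
      using F(3) u u' by (metis U.M.add.m_comm)
    fix z assume "z \<in> carrier V"
    then obtain u'' where u'': "u'' \<in> carrier U" "z = f u''" using surj by blast
    have "f (u \<oplus>\<^bsub>U\<^esub> u' \<oplus>\<^bsub>U\<^esub> u'') = f (u \<oplus>\<^bsub>U\<^esub> (u' \<oplus>\<^bsub>U\<^esub> u''))"
      using u u' u'' by (simp add: U.M.a_assoc)
    then show "x \<oplus>\<^bsub>V\<^esub> y \<oplus>\<^bsub>V\<^esub> z = x \<oplus>\<^bsub>V\<^esub> (y \<oplus>\<^bsub>V\<^esub> z)"
      using u u' u'' by (simp add: F(3))
  qed
  moreover note D(5)
  ultimately have "module K V"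
  proof (intro moduleI)
    fix a x assume a: "a \<in> carrier K" and "x \<in> carrier V"
    then obtain u where u: "u \<in> carrier U" "x = f u" using surj by blast
    show "a \<odot>\<^bsub>V\<^esub> x \<in> carrier V"
      using F(2)[of "a \<odot>\<^bsub>U\<^esub> u"] a u by (simp add: F(4))
    fix b assume b: "b \<in> carrier K"
    have "f ((a \<oplus>\<^bsub>K\<^esub> b) \<odot>\<^bsub>U\<^esub> u) = f (a \<odot>\<^bsub>U\<^esub> u \<oplus>\<^bsub>U\<^esub> b \<odot>\<^bsub>U\<^esub> u)"
      using a b u by (simp add: U.smult_l_distr)
    then show "(a \<oplus>\<^bsub>K\<^esub> b) \<odot>\<^bsub>V\<^esub> x = a \<odot>\<^bsub>V\<^esub> x \<oplus>\<^bsub>V\<^esub> b \<odot>\<^bsub>V\<^esub> x"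
      using a b u by (simp add: F(3,4))
    have "f ((a \<otimes>\<^bsub>K\<^esub> b) \<odot>\<^bsub>U\<^esub> u) = f (a \<odot>\<^bsub>U\<^esub> (b \<odot>\<^bsub>U\<^esub> u))"
      using a b u by (simp add: U.smult_assoc1)
    then show "(a \<otimes>\<^bsub>K\<^esub> b) \<odot>\<^bsub>V\<^esub> x = a \<odot>\<^bsub>V\<^esub> (b \<odot>\<^bsub>V\<^esub> x)"
      using a b u by (simp add: F(4))
  next
    fix a x y assume a: "a \<in> carrier K" and "x \<in> carrier V" "y \<in> carrier V"
    then obtain u u' where u: "u \<in> carrier U" "x = f u" "u' \<in> carrier U" "y = f u'" using surj by blast
    have "f (a \<odot>\<^bsub>U\<^esub> (u \<oplus>\<^bsub>U\<^esub> u')) = f (a \<odot>\<^bsub>U\<^esub> u \<oplus>\<^bsub>U\<^esub> a \<odot>\<^bsub>U\<^esub> u')"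
      using a u by (simp add: U.smult_r_distr)
    then show "a \<odot>\<^bsub>V\<^esub> (x \<oplus>\<^bsub>V\<^esub> y) = a \<odot>\<^bsub>V\<^esub> x \<oplus>\<^bsub>V\<^esub> a \<odot>\<^bsub>V\<^esub> y"
      using a u by (simp add: F(3,4))
  next
    fix x assume "x \<in> carrier V"
    then obtain u where u: "u \<in> carrier U" "x = f u" using surj by blast
    show "\<one>\<^bsub>K\<^esub> \<odot>\<^bsub>V\<^esub> x = x" using F(4)[of "\<one>\<^bsub>K\<^esub>" u] u by simp
  qed
  moreover have "\<rho> g (f u) = f (\<tau> g u)" if "g \<in> carrier G" "u \<in> carrier U" for g u
    using F(5)[OF that] by simp
  note act = this
  ultimately show ?thesis
    unfolding group_representation_def
  proof (intro conjI ballI)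
    show "group G" "field K" by (fact D)+
    fix v assume "v \<in> carrier V"
    then obtain u where u: "u \<in> carrier U" "v = f u" using surj by blast
    show "\<rho> \<one>\<^bsub>G\<^esub> v = v"
      using act[of "\<one>\<^bsub>G\<^esub>" u] u D(9) group.is_monoid[OF D(1)] by (simp add: monoid.one_closed)
  next
    fix g v assume g: "g \<in> carrier G" and "v \<in> carrier V"
    then obtain u where u: "u \<in> carrier U" "v = f u" using surj by blast
    show "\<rho> g v \<in> carrier V" using act g u D(6) F(2) by simp
    fix c assume c: "c \<in> carrier K"
    show "\<rho> g (c \<odot>\<^bsub>V\<^esub> v) = c \<odot>\<^bsub>V\<^esub> \<rho> g v"
      using act[of g "c \<odot>\<^bsub>U\<^esub> u"] act[of g u] g u c D(6,8) by (simp add: F(4))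
  next
    fix g v w assume g: "g \<in> carrier G" and "v \<in> carrier V" "w \<in> carrier V"
    then obtain u u' where u: "u \<in> carrier U" "v = f u" "u' \<in> carrier U" "w = f u'" using surj by blast
    show "\<rho> g (v \<oplus>\<^bsub>V\<^esub> w) = \<rho> g v \<oplus>\<^bsub>V\<^esub> \<rho> g w"
      using act[of g "u \<oplus>\<^bsub>U\<^esub> u'"] act[of g u] act[of g u'] g u D(6,7) by (simp add: F(3))
  next
    fix g h v assume g: "g \<in> carrier G" "h \<in> carrier G" and "v \<in> carrier V"
    then obtain u where u: "u \<in> carrier U" "v = f u" using surj by blast
    show "\<rho> (g \<otimes>\<^bsub>G\<^esub> h) v = \<rho> g (\<rho> h v)"
      using act[of "g \<otimes>\<^bsub>G\<^esub> h" u] act[of g "\<tau> h u"] act[of h u] g u D(6,10)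
        monoid.m_closed[OF group.is_monoid[OF D(1)]] by simp
  qed
qed

lemma representation_iso_zero:
  assumes U: "group_representation G K U \<tau>" and f: "representation_iso G K U \<tau> V \<rho> f"
    and V: "abelian_group V"
  shows "f \<zero>\<^bsub>U\<^esub> = \<zero>\<^bsub>V\<^esub>"
proof -
  interpret U: module K U by (rule group_representationD[OF U])
  interpret V: abelian_group V by fact
  have z: "f \<zero>\<^bsub>U\<^esub> \<in> carrier V" using representation_isoD(2)[OF f U.M.zero_closed] .
  have "f \<zero>\<^bsub>U\<^esub> \<oplus>\<^bsub>V\<^esub> f \<zero>\<^bsub>U\<^esub> = f \<zero>\<^bsub>U\<^esub>"
    using representation_isoD(3)[OF f U.M.zero_closed U.M.zero_closed] by simp
  then show ?thesis using z by (simp add: V.add.l_cancel_one)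
qed

lemma representation_iso_inverse:
  assumes U: "group_representation G K U \<tau>" and f: "representation_iso G K U \<tau> V \<rho> f"
  shows "representation_iso G K V \<rho> U \<tau> (inv_into (carrier U) f)"
proof -
  note D = group_representationD[OF U] and F = representation_isoD[OF f]
  interpret U: module K U by (rule D(3))
  let ?h = "inv_into (carrier U) f"
  have hf: "?h (f u) = u" if "u \<in> carrier U" for u
    using F(1) that by (simp add: bij_betw_def)
  have surj: "\<exists>u\<in>carrier U. v = f u" if "v \<in> carrier V" for v
    using F(1) that by (auto simp: bij_betw_def)
  show ?thesis
    unfolding representation_iso_def
  proof (intro conjI ballI)
    show "bij_betw ?h (carrier V) (carrier U)" by (rule bij_betw_inv_into[OF F(1)])
    fix v v' assume "v \<in> carrier V" "v' \<in> carrier V"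
    then obtain u u' where u: "u \<in> carrier U" "v = f u" "u' \<in> carrier U" "v' = f u'" using surj by blast
    then show "?h (v \<oplus>\<^bsub>V\<^esub> v') = ?h v \<oplus>\<^bsub>U\<^esub> ?h v'"
      using hf[of "u \<oplus>\<^bsub>U\<^esub> u'"] by (simp add: F(3) hf)
  next
    fix c v assume c: "c \<in> carrier K" and "v \<in> carrier V"
    then obtain u where u: "u \<in> carrier U" "v = f u" using surj by blast
    then show "?h (c \<odot>\<^bsub>V\<^esub> v) = c \<odot>\<^bsub>U\<^esub> ?h v"
      using hf[of "c \<odot>\<^bsub>U\<^esub> u"] c by (simp add: F(4) hf)
  next
    fix g v assume g: "g \<in> carrier G" and "v \<in> carrier V"
    then obtain u where u: "u \<in> carrier U" "v = f u" using surj by blast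
    then show "?h (\<rho> g v) = \<tau> g (?h v)"
      using hf[of "\<tau> g u"] g D(6) by (simp add: F(5) hf)
  qed
qed

lemma subrepresentation_image:
  assumes U: "group_representation G K U \<tau>" and V: "group_representation G K V \<rho>"
    and f: "representation_iso G K U \<tau> V \<rho> f" and W: "subrepresentation G K U \<tau> W"
  shows "subrepresentation G K V \<rho> (f ` W)"
proof -
  note F = representation_isoD[OF f]
  have W': "W \<subseteq> carrier U" "\<zero>\<^bsub>U\<^esub> \<in> W" "\<And>v w. v \<in> W \<Longrightarrow> w \<in> W \<Longrightarrow> v \<oplus>\<^bsub>U\<^esub> w \<in> W"
    "\<And>c v. c \<in> carrier K \<Longrightarrow> v \<in> W \<Longrightarrow> c \<odot>\<^bsub>U\<^esub> v \<in> W" "\<And>g v. g \<in> carrier G \<Longrightarrow> v \<in> W \<Longrightarrow> \<tau> g v \<in> W"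
    using W by (auto simp: subrepresentation_iff[OF group_representationD(3)[OF U]])
  have zero: "f \<zero>\<^bsub>U\<^esub> = \<zero>\<^bsub>V\<^esub>"
    by (rule representation_iso_zero[OF U f group_representationD(4)[OF V]])
  show ?thesis
    unfolding subrepresentation_iff[OF group_representationD(3)[OF V]]
  proof (intro conjI ballI)
    show "f ` W \<subseteq> carrier V" using W'(1) F(2) by blast
    show "\<zero>\<^bsub>V\<^esub> \<in> f ` W" using W'(2) zero by (metis imageI)
    fix v w assume "v \<in> f ` W" "w \<in> f ` W"
    then obtain x y where xy: "x \<in> W" "y \<in> W" "v = f x" "w = f y" by blast
    then have "v \<oplus>\<^bsub>V\<^esub> w = f (x \<oplus>\<^bsub>U\<^esub> y)" using F(3)[of x y] W'(1) by (simp add: subset_iff)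
    then show "v \<oplus>\<^bsub>V\<^esub> w \<in> f ` W" using W'(3) xy by simp
  next
    fix c v assume c: "c \<in> carrier K" and "v \<in> f ` W"
    then obtain x where x: "x \<in> W" "v = f x" by blast
    then have "c \<odot>\<^bsub>V\<^esub> v = f (c \<odot>\<^bsub>U\<^esub> x)" using F(4)[of c x] W'(1) c by (simp add: subset_iff)
    then show "c \<odot>\<^bsub>V\<^esub> v \<in> f ` W" using W'(4) x c by simp
  next
    fix g v assume g: "g \<in> carrier G" and "v \<in> f ` W"
    then obtain x where x: "x \<in> W" "v = f x" by blast
    then have "\<rho> g v = f (\<tau> g x)" using F(5)[of g x] W'(1) g by (simp add: subset_iff)
    then show "\<rho> g v \<in> f ` W" using W'(5) x g by simp
  qed
qed

lemma representation_iso_restrict: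
  assumes f: "representation_iso G K U \<tau> V \<rho> f" and W: "W \<subseteq> carrier U"
  shows "representation_iso G K (U\<lparr>carrier := W\<rparr>) \<tau> (V\<lparr>carrier := f ` W\<rparr>) \<rho> f"
  using representation_isoD[OF f] W
  by (auto simp: representation_iso_def bij_betw_def subset_iff intro: inj_on_subset)

lemma irreducible_representation_transport:
  assumes U: "irreducible_representation G K U \<tau>" and V: "group_representation G K V \<rho>"
    and f: "representation_iso G K U \<tau> V \<rho> f"
  shows "irreducible_representation G K V \<rho>"
  unfolding irreducible_representation_def
proof (intro conjI allI impI)
  have U': "group_representation G K U \<tau>" using U by (simp add: irreducible_representation_def)
  note F = representation_isoD[OF f]
  have zero: "f \<zero>\<^bsub>U\<^esub> = \<zero>\<^bsub>V\<^esub>"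
    by (rule representation_iso_zero[OF U' f group_representationD(4)[OF V]])
  have im: "f ` carrier U = carrier V" using F(1) by (simp add: bij_betw_def)
  let ?h = "inv_into (carrier U) f"
  have h: "representation_iso G K V \<rho> U \<tau> ?h" by (rule representation_iso_inverse[OF U' f])
  have fh: "f (?h v) = v" if "v \<in> carrier V" for v
    using that im by (simp add: f_inv_into_f)
  show "group_representation G K V \<rho>" by (rule V)
  show "carrier V \<noteq> {\<zero>\<^bsub>V\<^esub>}"
  proof
    assume "carrier V = {\<zero>\<^bsub>V\<^esub>}"
    then have c: "f u = f \<zero>\<^bsub>U\<^esub>" if "u \<in> carrier U" for u using F(2)[OF that] zero by simp
    have z: "\<zero>\<^bsub>U\<^esub> \<in> carrier U"
      using abelian_groupE(2)[OF group_representationD(4)[OF U']] .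
    have "inj_on f (carrier U)" using F(1) by (simp add: bij_betw_def)
    then have "u = \<zero>\<^bsub>U\<^esub>" if "u \<in> carrier U" for u
      using c[OF that] that z by (rule inj_onD)
    with z have "carrier U = {\<zero>\<^bsub>U\<^esub>}" by blast
    then show False using U by (simp add: irreducible_representation_def)
  qed
  fix Y assume Y: "subrepresentation G K V \<rho> Y"
  have YV: "Y \<subseteq> carrier V"
    using Y by (simp add: subrepresentation_iff[OF group_representationD(3)[OF V]])
  have "subrepresentation G K U \<tau> (?h ` Y)" by (rule subrepresentation_image[OF V U' h Y])
  then have "?h ` Y = {\<zero>\<^bsub>U\<^esub>} \<or> ?h ` Y = carrier U"
    using U by (simp add: irreducible_representation_def)
  then have "f ` ?h ` Y = {\<zero>\<^bsub>V\<^esub>} \<or> f ` ?h ` Y = carrier V"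
    by (elim disjE) (simp_all only: image_insert image_empty zero im simp_thms)
  moreover have "f ` ?h ` Y = Y"
  proof -
    have "f ` ?h ` Y = (\<lambda>v. v) ` Y"
      unfolding image_image using fh YV by (intro image_cong) auto
    then show ?thesis by simp
  qed
  ultimately show "Y = {\<zero>\<^bsub>V\<^esub>} \<or> Y = carrier V" by simp
qed

lemma representation_iso_finsum:
  assumes U: "group_representation G K U \<tau>" and V: "abelian_group V"
    and f: "representation_iso G K U \<tau> V \<rho> f" and A: "finite A" "w \<in> A \<rightarrow> carrier U"
  shows "f (\<Oplus>\<^bsub>U\<^esub>i\<in>A. w i) = (\<Oplus>\<^bsub>V\<^esub>i\<in>A. f (w i))"
proof -
  interpret U: module K U by (rule group_representationD[OF U])
  interpret V: abelian_group V by fact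
  note F = representation_isoD[OF f]
  from A show ?thesis
  proof (induction A)
    case empty
    then show ?case by (simp add: representation_iso_zero[OF U f V])
  next
    case (insert i A)
    have "w \<in> A \<rightarrow> carrier U" "w i \<in> carrier U" using insert.prems by auto
    moreover from this have "(\<lambda>i. f (w i)) \<in> A \<rightarrow> carrier V" "f (w i) \<in> carrier V"
      using F(2) by auto
    ultimately show ?case
      using insert.hyps insert.IH by (simp add: F(3))
  qed
qed

lemma irreducible_decomposition_transport:
  assumes U: "group_representation G K U \<tau>" and V: "group_representation G K V \<rho>"
    and f: "representation_iso G K U \<tau> V \<rho> f" and W: "irreducible_decomposition G K U \<tau> r W"
  shows "irreducible_decomposition G K V \<rho> r (\<lambda>i. f ` W i)"
  unfolding irreducible_decomposition_def
proof (intro conjI allI impI ballI)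
  note F = representation_isoD[OF f]
  have Wi: "subrepresentation G K U \<tau> (W i)" "irreducible_representation G K (U\<lparr>carrier := W i\<rparr>) \<tau>"
    "W i \<subseteq> carrier U" if "i < r" for i
    using W that by (auto simp: irreducible_decomposition_def subrepresentation_iff[OF group_representationD(3)[OF U]])
  fix i assume i: "i < r"
  show s: "subrepresentation G K V \<rho> (f ` W i)"
    by (rule subrepresentation_image[OF U V f Wi(1)[OF i]])
  show "irreducible_representation G K (V\<lparr>carrier := f ` W i\<rparr>) \<rho>"
    by (rule irreducible_representation_transport[OF Wi(2)[OF i] group_representation_restrict[OF V s]
          representation_iso_restrict[OF f Wi(3)[OF i]]])
next
  note F = representation_isoD[OF f]
  have WU: "W i \<subseteq> carrier U" if "i < r" for i
    using W that by (auto simp: irreducible_decomposition_def subrepresentation_iff[OF group_representationD(3)[OF U]])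
  have inj: "inj_on f (carrier U)" using F(1) by (simp add: bij_betw_def)
  have sum: "f (\<Oplus>\<^bsub>U\<^esub>i\<in>{..<r}. w i) = (\<Oplus>\<^bsub>V\<^esub>i\<in>{..<r}. f (w i))"
    if "w \<in> (\<Pi>\<^sub>E i\<in>{..<r}. W i)" for w
    using that WU by (intro representation_iso_finsum[OF U group_representationD(4)[OF V] f]) (auto simp: PiE_iff)
  interpret U: module K U by (rule group_representationD[OF U])
  interpret V: module K V by (rule group_representationD[OF V])
  fix v assume v: "v \<in> carrier V"
  then obtain u where u: "u \<in> carrier U" "v = f u" using F(1) by (auto simp: bij_betw_def)
  have "\<exists>!w. w \<in> (\<Pi>\<^sub>E i\<in>{..<r}. W i) \<and> u = (\<Oplus>\<^bsub>U\<^esub>i\<in>{..<r}. w i)"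
    using W u(1) by (simp add: irreducible_decomposition_def)
  then obtain w where w: "w \<in> (\<Pi>\<^sub>E i\<in>{..<r}. W i)" "u = (\<Oplus>\<^bsub>U\<^esub>i\<in>{..<r}. w i)"
    and uniq: "\<And>w'. w' \<in> (\<Pi>\<^sub>E i\<in>{..<r}. W i) \<Longrightarrow> u = (\<Oplus>\<^bsub>U\<^esub>i\<in>{..<r}. w' i) \<Longrightarrow> w' = w"
    by (elim ex1E conjE) blast
  show "\<exists>!w. w \<in> (\<Pi>\<^sub>E i\<in>{..<r}. f ` W i) \<and> v = (\<Oplus>\<^bsub>V\<^esub>i\<in>{..<r}. w i)"
  proof (rule ex1I)
    let ?w = "restrict (\<lambda>i. f (w i)) {..<r}"
    have "(\<Oplus>\<^bsub>V\<^esub>i\<in>{..<r}. ?w i) = (\<Oplus>\<^bsub>V\<^esub>i\<in>{..<r}. f (w i))"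
      using w(1) WU F(2) by (intro V.M.finsum_cong') (auto simp: PiE_iff Pi_iff subset_iff)
    then show "?w \<in> (\<Pi>\<^sub>E i\<in>{..<r}. f ` W i) \<and> v = (\<Oplus>\<^bsub>V\<^esub>i\<in>{..<r}. ?w i)"
      using w sum[OF w(1)] u by (auto simp: PiE_iff)
    fix w' assume w': "w' \<in> (\<Pi>\<^sub>E i\<in>{..<r}. f ` W i) \<and> v = (\<Oplus>\<^bsub>V\<^esub>i\<in>{..<r}. w' i)"
    let ?x = "restrict (\<lambda>i. inv_into (carrier U) f (w' i)) {..<r}"
    have x: "?x i \<in> W i \<and> f (?x i) = w' i" if "i < r" for i
    proof -
      have "w' i \<in> f ` W i" using w' that by (simp add: PiE_iff)
      then obtain y where "y \<in> W i" "w' i = f y" by blast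
      then show ?thesis using WU[OF that] inj that by (auto simp: inv_into_f_f)
    qed
    have xP: "?x \<in> (\<Pi>\<^sub>E i\<in>{..<r}. W i)" using x by (auto simp: PiE_iff)
    have xU: "?x \<in> {..<r} \<rightarrow> carrier U"
    proof (rule funcsetI)
      fix i assume "i \<in> {..<r}"
      then have "?x i \<in> W i" "W i \<subseteq> carrier U" using x[of i] WU[of i] by simp_all
      then show "?x i \<in> carrier U" by (rule subsetD[rotated])
    qed
    have "(\<Oplus>\<^bsub>V\<^esub>i\<in>{..<r}. f (?x i)) = (\<Oplus>\<^bsub>V\<^esub>i\<in>{..<r}. w' i)"
    proof (rule V.M.finsum_cong')
      show "w' \<in> {..<r} \<rightarrow> carrier V"
      proof (rule funcsetI)
        fix i assume "i \<in> {..<r}"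
        then have "w' i = f (?x i)" "?x i \<in> carrier U" using x[of i] funcset_mem[OF xU] by auto
        then show "w' i \<in> carrier V" using F(2)[of "?x i"] by (simp only:)
      qed
      show "f (?x i) = w' i" if "i \<in> {..<r}" for i using x that by simp
    qed simp
    with sum[OF xP] w' u have "f u = f (\<Oplus>\<^bsub>U\<^esub>i\<in>{..<r}. ?x i)" by simp
    moreover have "(\<Oplus>\<^bsub>U\<^esub>i\<in>{..<r}. ?x i) \<in> carrier U" using xU by (rule U.M.finsum_closed)
    ultimately have "u = (\<Oplus>\<^bsub>U\<^esub>i\<in>{..<r}. ?x i)" using inj u(1) by (auto dest: inj_onD)
    then have xw: "?x = w" by (rule uniq[OF xP])
    show "w' = ?w"
    proof
      fix i show "w' i = ?w i"
        using x[of i] xw w' by (cases "i < r") (auto simp: PiE_iff extensional_def)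
    qed
  qed
qed

section \<open>Multiplicity of the sign representation\<close>

abbreviation rat_field :: "rat ring" where "rat_field \<equiv> ring_of_type_algebra"

lemma rat_field_simps [simp]:
  "carrier rat_field = UNIV" "x \<oplus>\<^bsub>rat_field\<^esub> y = x + y" "x \<otimes>\<^bsub>rat_field\<^esub> y = x * y"
  "\<zero>\<^bsub>rat_field\<^esub> = 0" "\<one>\<^bsub>rat_field\<^esub> = 1"
  by (simp_all add: ring_of_type_algebra_def)

lemma sign_space_simps [simp]:
  "carrier sign_space = UNIV" "x \<oplus>\<^bsub>sign_space\<^esub> y = x + y" "x \<odot>\<^bsub>sign_space\<^esub> y = x * y"
  "\<zero>\<^bsub>sign_space\<^esub> = 0"
  by (simp_all add: sign_space_def)

lemma sign_representation: "group_representation (sym_group n) rat_field sign_space sign_action"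
proof -
  have "abelian_group sign_space"
    by (rule abelian_groupI) (auto intro: exI[of _ "- _"] simp: ac_simps)
  then have "module rat_field sign_space"
    by (intro moduleI cring_from_type_algebra) (simp_all add: algebra_simps)
  moreover have "sign (\<sigma> \<circ> \<tau>) = sign \<sigma> * sign \<tau>" if "\<sigma> permutes {1..n}" "\<tau> permutes {1..n}" for \<sigma> \<tau>
    using that by (intro sign_compose) (auto simp: permutation_permutes)
  ultimately show ?thesis
    unfolding group_representation_def
    by (auto simp: sign_action_def sym_group_mult sym_group_one sym_group_carrier algebra_simps
        field_from_type_algebra sym_group_is_group)
qed

lemma sign_irreducible: "irreducible_representation (sym_group n) rat_field sign_space sign_action"
  unfolding irreducible_representation_def
proof (intro conjI allI impI sign_representation)
  have "(1::rat) \<notin> {0}" by simp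
  then show "carrier sign_space \<noteq> {\<zero>\<^bsub>sign_space\<^esub>}" unfolding sign_space_simps by blast
  fix W assume "subrepresentation (sym_group n) rat_field sign_space sign_action W"
  then have W: "0 \<in> W" "\<And>c x. x \<in> W \<Longrightarrow> c * x \<in> W"
    by (auto simp: subrepresentation_iff[OF group_representationD(3)[OF sign_representation]])
  show "W = {\<zero>\<^bsub>sign_space\<^esub>} \<or> W = carrier sign_space"
  proof (cases "W \<subseteq> {0}")
    case False
    then obtain w where w: "w \<in> W" "w \<noteq> 0" by auto
    have "x \<in> W" for x using W(2)[OF w(1), of "x / w"] w(2) by simp
    then show ?thesis by auto
  qed (use W(1) in auto)
qed

lemma additive_finsum:
  assumes V: "abelian_group V" and w: "finite A" "w \<in> A \<rightarrow> carrier V"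
    and h: "\<And>x. x \<in> carrier V \<Longrightarrow> h x \<in> carrier V"
      "\<And>x y. x \<in> carrier V \<Longrightarrow> y \<in> carrier V \<Longrightarrow> h (x \<oplus>\<^bsub>V\<^esub> y) = h x \<oplus>\<^bsub>V\<^esub> h y"
  shows "h (\<Oplus>\<^bsub>V\<^esub>i\<in>A. w i) = (\<Oplus>\<^bsub>V\<^esub>i\<in>A. h (w i))"
proof -
  interpret abelian_group V by fact
  have "h \<zero>\<^bsub>V\<^esub> \<oplus>\<^bsub>V\<^esub> h \<zero>\<^bsub>V\<^esub> = h \<zero>\<^bsub>V\<^esub>"
    using h(2)[of "\<zero>\<^bsub>V\<^esub>" "\<zero>\<^bsub>V\<^esub>"] by simp
  then have zero: "h \<zero>\<^bsub>V\<^esub> = \<zero>\<^bsub>V\<^esub>" using h(1)[of "\<zero>\<^bsub>V\<^esub>"] by (simp add: add.l_cancel_one)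
  from w show ?thesis
  proof (induction A)
    case (insert i A)
    then have "w \<in> A \<rightarrow> carrier V" "w i \<in> carrier V" "(\<lambda>i. h (w i)) \<in> A \<rightarrow> carrier V" "h (w i) \<in> carrier V"
      using h(1) by auto
    then show ?case using insert.hyps insert.IH by (simp add: h(2))
  qed (simp add: zero)
qed

definition sign_vector :: "nat \<Rightarrow> (rat, 'v, 'z) module_scheme \<Rightarrow> ((nat \<Rightarrow> nat) \<Rightarrow> 'v \<Rightarrow> 'v) \<Rightarrow> 'v \<Rightarrow> bool" where
  "sign_vector n V \<rho> v \<longleftrightarrow>
     v \<in> carrier V \<and> (\<forall>\<sigma>\<in>carrier (sym_group n). \<rho> \<sigma> v = of_int (sign \<sigma>) \<odot>\<^bsub>V\<^esub> v)"

lemma sign_vector_of_iso: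
  assumes V: "group_representation (sym_group n) rat_field V \<rho>"
    and iso: "isomorphic_representations (sym_group n) rat_field sign_space sign_action V \<rho>"
  obtains v where "sign_vector n V \<rho> v" "v \<noteq> \<zero>\<^bsub>V\<^esub>"
proof -
  obtain f where f: "representation_iso (sym_group n) rat_field sign_space sign_action V \<rho> f"
    using iso unfolding isomorphic_representations_def representation_iso_def by blast
  note F = representation_isoD[OF f]
  have "\<rho> \<sigma> (f 1) = of_int (sign \<sigma>) \<odot>\<^bsub>V\<^esub> f 1" if "\<sigma> \<in> carrier (sym_group n)" for \<sigma>
    using F(5)[OF that, of 1] F(4)[of "of_int (sign \<sigma>)" 1] by (simp add: sign_action_def)
  moreover have "f 1 \<noteq> \<zero>\<^bsub>V\<^esub>"
  proof
    assume "f 1 = \<zero>\<^bsub>V\<^esub>"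
    also have "\<dots> = f 0"
      using representation_iso_zero[OF sign_representation f group_representationD(4)[OF V]] by simp
    finally have "f 1 = f 0" .
    moreover have "inj f" using F(1) by (simp add: bij_betw_def)
    ultimately show False by (simp add: inj_eq)
  qed
  moreover have "f 1 \<in> carrier V" using F(2) by simp
  ultimately show ?thesis by (intro that) (auto simp: sign_vector_def)
qed

text \<open>The line through \<open>v\<close> is a subrepresentation, hence all of \<open>V\<close>.\<close>

lemma iso_of_sign_vector:
  assumes V: "irreducible_representation (sym_group n) rat_field V \<rho>"
    and v: "sign_vector n V \<rho> v" "v \<noteq> \<zero>\<^bsub>V\<^esub>"
  shows "isomorphic_representations (sym_group n) rat_field sign_space sign_action V \<rho>"
proof -
  have V': "group_representation (sym_group n) rat_field V \<rho>"
    using V by (simp add: irreducible_representation_def)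
  interpret module rat_field V by (rule group_representationD[OF V'])
  have vV: "v \<in> carrier V" and sgn: "\<And>\<sigma>. \<sigma> \<in> carrier (sym_group n) \<Longrightarrow> \<rho> \<sigma> v = of_int (sign \<sigma>) \<odot>\<^bsub>V\<^esub> v"
    using v(1) by (auto simp: sign_vector_def)
  let ?f = "\<lambda>c. c \<odot>\<^bsub>V\<^esub> v"
  have cl: "?f c \<in> carrier V" for c using smult_closed[of c v] vV by simp
  have add: "?f (c + d) = ?f c \<oplus>\<^bsub>V\<^esub> ?f d" for c d
    using smult_l_distr[of c d v] vV by simp
  have scale: "?f (c * d) = c \<odot>\<^bsub>V\<^esub> ?f d" for c d
    using smult_assoc1[of c d v] vV by simp
  have act: "\<rho> \<sigma> (?f c) = ?f (of_int (sign \<sigma>) * c)" if "\<sigma> \<in> carrier (sym_group n)" for \<sigma> c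
  proof -
    have "\<rho> \<sigma> (?f c) = c \<odot>\<^bsub>V\<^esub> \<rho> \<sigma> v"
      using group_representationD(8)[OF V' that _ vV, of c] by simp
    also have "\<dots> = ?f (c * of_int (sign \<sigma>))" unfolding sgn[OF that] scale ..
    finally show ?thesis by (simp only: mult.commute)
  qed
  have zero: "?f 0 = \<zero>\<^bsub>V\<^esub>" using smult_l_null[OF vV] by simp
  have one: "?f 1 = v" using smult_one[OF vV] by simp
  have rng: "?f c \<in> range ?f" for c by blast
  have inj: "inj ?f"
  proof (rule injI)
    fix c d assume eq: "?f c = ?f d"
    show "c = d"
    proof (rule ccontr)
      assume "c \<noteq> d"
      have "?f (c - d) \<oplus>\<^bsub>V\<^esub> ?f d = ?f d" using add[of "c - d" d] eq by simp
      then have "?f (c - d) = \<zero>\<^bsub>V\<^esub>" using cl by (metis M.add.l_cancel_one M.a_comm)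
      then have "inverse (c - d) \<odot>\<^bsub>V\<^esub> ?f (c - d) = \<zero>\<^bsub>V\<^esub>"
        using smult_r_null[of "inverse (c - d)"] by simp
      then have "?f (inverse (c - d) * (c - d)) = \<zero>\<^bsub>V\<^esub>" by (simp only: scale)
      then show False using \<open>c \<noteq> d\<close> one v(2) by simp
    qed
  qed
  have "subrepresentation (sym_group n) rat_field V \<rho> (range ?f)"
    unfolding subrepresentation_iff[OF group_representationD(3)[OF V']]
  proof (intro conjI ballI)
    show "range ?f \<subseteq> carrier V" using cl by blast
    show "\<zero>\<^bsub>V\<^esub> \<in> range ?f" by (rule range_eqI[of _ _ 0]) (simp only: zero)
    fix x y assume "x \<in> range ?f" "y \<in> range ?f"
    then obtain c d where "x = ?f c" "y = ?f d" by blast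
    then show "x \<oplus>\<^bsub>V\<^esub> y \<in> range ?f" by (simp only: add[symmetric] rng)
  next
    fix a x assume "x \<in> range ?f"
    then obtain c where "x = ?f c" by blast
    then show "a \<odot>\<^bsub>V\<^esub> x \<in> range ?f" by (simp only: scale[symmetric] rng)
  next
    fix \<sigma> x assume "\<sigma> \<in> carrier (sym_group n)" "x \<in> range ?f"
    then obtain c where "x = ?f c" by blast
    then show "\<rho> \<sigma> x \<in> range ?f" using act[OF \<open>\<sigma> \<in> _\<close>, of c] by (simp only: rng)
  qed
  then have "range ?f = {\<zero>\<^bsub>V\<^esub>} \<or> range ?f = carrier V"
    using V by (simp add: irreducible_representation_def)
  moreover have "v \<in> range ?f" by (rule range_eqI[of _ _ 1]) (simp only: one)
  ultimately have "range ?f = carrier V" using v(2) by blast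
  then show ?thesis
    unfolding isomorphic_representations_def using inj act
    by (intro exI[of _ ?f]) (simp add: bij_betw_def add scale sign_action_def)
qed

lemma decomposition_summand:
  assumes V: "group_representation G K V \<rho>" and W: "irreducible_decomposition G K V \<rho> r W" and i: "i < r"
  shows "irreducible_representation G K (V\<lparr>carrier := W i\<rparr>) \<rho>"
    "group_representation G K (V\<lparr>carrier := W i\<rparr>) \<rho>" "subrepresentation G K V \<rho> (W i)" "W i \<subseteq> carrier V"
  using W i group_representation_restrict[OF V]
  by (auto simp: irreducible_decomposition_def subrepresentation_iff[OF group_representationD(3)[OF V]])

text \<open>A summand isomorphic to the sign representation would contain a nonzero sign vector.\<close>

lemma sign_multiplicity_zero:
  assumes V: "group_representation (sym_group n) rat_field V \<rho>"
    and dec: "irreducible_decomposition (sym_group n) rat_field V \<rho> r0 W0"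
    and none: "\<And>v. sign_vector n V \<rho> v \<Longrightarrow> v = \<zero>\<^bsub>V\<^esub>"
  shows "occurs_with_multiplicity (sym_group n) rat_field sign_space sign_action V \<rho> 0"
  unfolding occurs_with_multiplicity_def
proof (intro conjI allI impI sign_irreducible V exI[of _ r0] exI[of _ W0] dec)
  fix r W assume W: "irreducible_decomposition (sym_group n) rat_field V \<rho> r W"
  have "\<not> isomorphic_representations (sym_group n) rat_field sign_space sign_action (V\<lparr>carrier := W i\<rparr>) \<rho>"
    if i: "i < r" for i
  proof
    assume "isomorphic_representations (sym_group n) rat_field sign_space sign_action (V\<lparr>carrier := W i\<rparr>) \<rho>"
    then obtain v where "sign_vector n (V\<lparr>carrier := W i\<rparr>) \<rho> v" "v \<noteq> \<zero>\<^bsub>V\<^esub>"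
      using sign_vector_of_iso[OF decomposition_summand(2)[OF V W i]] by auto
    then show False using none[of v] decomposition_summand(4)[OF V W i] by (auto simp: sign_vector_def)
  qed
  then show "card {i. i < r \<and> isomorphic_representations (sym_group n) rat_field sign_space sign_action
      (V\<lparr>carrier := W i\<rparr>) \<rho>} = 0" by simp
qed

text \<open>The components of \<open>v0\<close> in the summands are sign vectors, because components are unique.  A nonzero
  component makes its summand isomorphic to the sign representation.  Two summands of this kind
  would both contain the line through \<open>v0\<close>, which is impossible in a direct sum.\<close>

lemma sign_multiplicity_one:
  assumes V: "group_representation (sym_group n) rat_field V \<rho>"
    and dec: "irreducible_decomposition (sym_group n) rat_field V \<rho> r0 W0"
    and v0: "sign_vector n V \<rho> v0" "v0 \<noteq> \<zero>\<^bsub>V\<^esub>"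
    and line: "\<And>v. sign_vector n V \<rho> v \<Longrightarrow> \<exists>c. v = c \<odot>\<^bsub>V\<^esub> v0"
  shows "occurs_with_multiplicity (sym_group n) rat_field sign_space sign_action V \<rho> 1"
  unfolding occurs_with_multiplicity_def
proof (intro conjI allI impI sign_irreducible V exI[of _ r0] exI[of _ W0] dec)
  fix r W assume W: "irreducible_decomposition (sym_group n) rat_field V \<rho> r W"
  interpret module rat_field V by (rule group_representationD[OF V])
  note summand = decomposition_summand[OF V W]
  have sub: "\<zero>\<^bsub>V\<^esub> \<in> W i" "\<And>c v. v \<in> W i \<Longrightarrow> c \<odot>\<^bsub>V\<^esub> v \<in> W i"
    "\<And>\<sigma> v. \<sigma> \<in> carrier (sym_group n) \<Longrightarrow> v \<in> W i \<Longrightarrow> \<rho> \<sigma> v \<in> W i" if "i < r" for i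
    using summand(3)[OF that] by (auto simp: subrepresentation_iff[OF group_representationD(3)[OF V]])
  have ex1: "\<exists>!w. w \<in> (\<Pi>\<^sub>E i\<in>{..<r}. W i) \<and> v = (\<Oplus>\<^bsub>V\<^esub>i\<in>{..<r}. w i)" if "v \<in> carrier V" for v
    using W that by (simp add: irreducible_decomposition_def)
  have uniq: "w i = w' i" if "\<And>i. i < r \<Longrightarrow> w i \<in> W i" "\<And>i. i < r \<Longrightarrow> w' i \<in> W i"
    "(\<Oplus>\<^bsub>V\<^esub>i\<in>{..<r}. w i) = (\<Oplus>\<^bsub>V\<^esub>i\<in>{..<r}. w' i)" "i < r" for w w' i
  proof -
    have cl: "w \<in> {..<r} \<rightarrow> carrier V" "w' \<in> {..<r} \<rightarrow> carrier V"
      using that(1,2) summand(4) by (auto simp: Pi_iff subset_iff)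
    have r1: "(\<Oplus>\<^bsub>V\<^esub>i\<in>{..<r}. restrict w {..<r} i) = (\<Oplus>\<^bsub>V\<^esub>i\<in>{..<r}. w i)"
      using cl by (intro M.finsum_cong') auto
    have r2: "(\<Oplus>\<^bsub>V\<^esub>i\<in>{..<r}. restrict w' {..<r} i) = (\<Oplus>\<^bsub>V\<^esub>i\<in>{..<r}. w' i)"
      using cl by (intro M.finsum_cong') auto
    have "restrict w {..<r} = restrict w' {..<r}"
      using ex1[OF M.finsum_closed[OF cl(1)]] that(1-3)
      by (elim ex1E) (metis (no_types, lifting) r1 r2 lessThan_iff restrict_PiE_iff)
    then show ?thesis using that(4) by (metis lessThan_iff restrict_apply')
  qed
  have v0V: "v0 \<in> carrier V" using v0 by (simp add: sign_vector_def)
  from ex1[OF v0V] obtain w where w: "\<And>i. i < r \<Longrightarrow> w i \<in> W i" "v0 = (\<Oplus>\<^bsub>V\<^esub>i\<in>{..<r}. w i)"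
    by (auto simp: PiE_iff)
  have wV: "w \<in> {..<r} \<rightarrow> carrier V" using w(1) summand(4) by (auto simp: Pi_iff subset_iff)
  have wsign: "sign_vector n V \<rho> (w i)" if i: "i < r" for i
    unfolding sign_vector_def
  proof (intro conjI ballI)
    show "w i \<in> carrier V" using wV i by auto
    fix \<sigma> assume \<sigma>: "\<sigma> \<in> carrier (sym_group n)"
    have "(\<Oplus>\<^bsub>V\<^esub>i\<in>{..<r}. \<rho> \<sigma> (w i)) = \<rho> \<sigma> v0"
      unfolding w(2) by (rule additive_finsum[OF M.abelian_group_axioms, symmetric])
        (use wV \<sigma> group_representationD(6,7)[OF V] in auto)
    also have "\<dots> = of_int (sign \<sigma>) \<odot>\<^bsub>V\<^esub> v0"
      using v0(1) \<sigma> by (simp add: sign_vector_def)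
    also have "\<dots> = (\<Oplus>\<^bsub>V\<^esub>i\<in>{..<r}. of_int (sign \<sigma>) \<odot>\<^bsub>V\<^esub> w i)"
      unfolding w(2) by (rule additive_finsum[OF M.abelian_group_axioms])
        (use wV in \<open>auto simp: smult_r_distr\<close>)
    finally show "\<rho> \<sigma> (w i) = of_int (sign \<sigma>) \<odot>\<^bsub>V\<^esub> w i"
      by (rule uniq[OF _ _ _ i, rotated 2]) (use w(1) sub \<sigma> in auto)
  qed
  let ?iso = "\<lambda>i. isomorphic_representations (sym_group n) rat_field sign_space sign_action (V\<lparr>carrier := W i\<rparr>) \<rho>"
  have ex: "\<exists>i<r. ?iso i"
  proof (rule ccontr)
    assume none: "\<not> ?thesis"
    have "w i = \<zero>\<^bsub>V\<^esub>" if i: "i < r" for i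
    proof (rule ccontr)
      assume "w i \<noteq> \<zero>\<^bsub>V\<^esub>"
      moreover have "sign_vector n (V\<lparr>carrier := W i\<rparr>) \<rho> (w i)"
        using wsign[OF i] w(1)[OF i] by (simp add: sign_vector_def)
      ultimately have "?iso i" by (intro iso_of_sign_vector[OF summand(1)[OF i]]) simp_all
      with none i show False by blast
    qed
    then have "v0 = (\<Oplus>\<^bsub>V\<^esub>i\<in>{..<r}. \<zero>\<^bsub>V\<^esub>)"
      unfolding w(2) by (intro M.finsum_cong') auto
    then show False using v0(2) by simp
  qed
  have unique: "i = j" if ij: "i < r" "j < r" "?iso i" "?iso j" for i j
  proof (rule ccontr)
    assume ne: "i \<noteq> j"
    obtain x where x: "sign_vector n (V\<lparr>carrier := W i\<rparr>) \<rho> x" "x \<noteq> \<zero>\<^bsub>V\<^esub>"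
      using sign_vector_of_iso[OF summand(2)[OF ij(1)] ij(3)] by auto
    obtain y where y: "sign_vector n (V\<lparr>carrier := W j\<rparr>) \<rho> y" "y \<noteq> \<zero>\<^bsub>V\<^esub>"
      using sign_vector_of_iso[OF summand(2)[OF ij(2)] ij(4)] by auto
    have xW: "x \<in> W i" "x \<in> carrier V" and yW: "y \<in> W j" "y \<in> carrier V"
      using x(1) y(1) summand(4) ij by (auto simp: sign_vector_def)
    have "sign_vector n V \<rho> x" "sign_vector n V \<rho> y"
      using x(1) y(1) xW yW by (auto simp: sign_vector_def)
    then obtain a b where ab: "x = a \<odot>\<^bsub>V\<^esub> v0" "y = b \<odot>\<^bsub>V\<^esub> v0" using line by metis
    have "b \<noteq> 0" using y(2) ab(2) smult_l_null[OF v0V] by auto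
    then have "x = (a / b) \<odot>\<^bsub>V\<^esub> y"
      using smult_assoc1[of "a / b" b v0] v0V by (simp add: ab)
    then have xj: "x \<in> W j" using sub(2)[OF ij(2) yW(1)] by simp
    let ?d = "\<lambda>k l. if k = l then x else \<zero>\<^bsub>V\<^esub>"
    have d: "(\<Oplus>\<^bsub>V\<^esub>l\<in>{..<r}. ?d k l) = x" if "k < r" for k
      using M.finsum_singleton[of k "{..<r}" "\<lambda>_. x"] that xW by simp
    have "?d i i = ?d j i"
      by (rule uniq[OF _ _ _ ij(1)]) (use sub(1) xW xj d ij in auto)
    then show False using ne x(2) by simp
  qed
  from ex obtain i where "i < r" "?iso i" by blast
  then have "{i. i < r \<and> ?iso i} = {i}" using unique by blast
  then show "card {i. i < r \<and> ?iso i} = 1" by simp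
qed

section \<open>Orthogonality over the rationals\<close>

definition inner_on :: "'a set \<Rightarrow> ('a \<Rightarrow> rat) \<Rightarrow> ('a \<Rightarrow> rat) \<Rightarrow> rat" where
  "inner_on S c d = (\<Sum>s\<in>S. c s * d s)"

definition supported_on :: "'a set \<Rightarrow> ('a \<Rightarrow> rat) set" where
  "supported_on S = {c. \<forall>s. s \<notin> S \<longrightarrow> c s = 0}"

definition function_subspace :: "('a \<Rightarrow> rat) set \<Rightarrow> bool" where
  "function_subspace U \<longleftrightarrow> (\<lambda>s. 0) \<in> U \<and> (\<forall>c\<in>U. \<forall>d\<in>U. (\<lambda>s. c s + d s) \<in> U) \<and>
     (\<forall>a. \<forall>c\<in>U. (\<lambda>s. a * c s) \<in> U)"

lemma function_subspaceD:
  assumes "function_subspace U"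
  shows "(\<lambda>s. 0) \<in> U" "c \<in> U \<Longrightarrow> d \<in> U \<Longrightarrow> (\<lambda>s. c s + d s) \<in> U"
    "c \<in> U \<Longrightarrow> (\<lambda>s. a * c s) \<in> U" "c \<in> U \<Longrightarrow> d \<in> U \<Longrightarrow> (\<lambda>s. c s - d s) \<in> U"
proof -
  show "(\<lambda>s. 0) \<in> U" using assms by (simp add: function_subspace_def)
  show add: "(\<lambda>s. c s + d s) \<in> U" if "c \<in> U" "d \<in> U" for c d
    using assms that by (simp add: function_subspace_def)
  show scale: "(\<lambda>s. a * c s) \<in> U" if "c \<in> U" for a c
    using assms that by (simp add: function_subspace_def)
  show "(\<lambda>s. c s - d s) \<in> U" if "c \<in> U" "d \<in> U"
    using add[OF that(1) scale[OF that(2), of "-1"]] by simp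
qed

lemma function_subspace_sum:
  assumes "function_subspace U" "finite I" "\<And>i. i \<in> I \<Longrightarrow> v i \<in> U"
  shows "(\<lambda>s. \<Sum>i\<in>I. v i s) \<in> U"
  using assms(2,3)
proof (induction I)
  case empty
  then show ?case using function_subspaceD(1)[OF assms(1)] by simp
next
  case (insert i I)
  then show ?case using function_subspaceD(2)[OF assms(1), of "v i" "\<lambda>s. \<Sum>i\<in>I. v i s"] by simp
qed

lemma inner_on_commute: "inner_on S c d = inner_on S d c"
  by (simp add: inner_on_def mult.commute)

lemma inner_on_linear:
  "inner_on S (\<lambda>s. c s + c' s) d = inner_on S c d + inner_on S c' d"
  "inner_on S (\<lambda>s. c s - c' s) d = inner_on S c d - inner_on S c' d"
  "inner_on S (\<lambda>s. a * c s) d = a * inner_on S c d"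
  "inner_on S (\<lambda>s. 0) d = 0"
  by (simp_all add: inner_on_def algebra_simps sum.distrib sum_subtractf sum_distrib_left)

lemma inner_on_linear_right:
  "inner_on S c (\<lambda>s. d s + d' s) = inner_on S c d + inner_on S c d'"
  "inner_on S c (\<lambda>s. d s - d' s) = inner_on S c d - inner_on S c d'"
  "inner_on S c (\<lambda>s. a * d s) = a * inner_on S c d"
  "inner_on S c (\<lambda>s. 0) = 0"
  unfolding inner_on_commute[of S c] by (rule inner_on_linear)+

lemma inner_on_sum: "inner_on S (\<lambda>s. \<Sum>i\<in>I. v i s) d = (\<Sum>i\<in>I. inner_on S (v i) d)"
  unfolding inner_on_def sum_distrib_right by (rule sum.swap)

lemma inner_on_nonneg: "inner_on S c c \<ge> 0"
  by (simp add: inner_on_def sum_nonneg)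

lemma inner_on_eq_0:
  assumes "finite S" "c \<in> supported_on S" "inner_on S c c = 0"
  shows "c = (\<lambda>s. 0)"
proof
  fix s
  have "\<forall>s\<in>S. c s * c s = 0"
    using assms(3) sum_nonneg_eq_0_iff[OF assms(1), of "\<lambda>s. c s * c s"] by (simp add: inner_on_def)
  then show "c s = 0" using assms(2) by (auto simp: supported_on_def)
qed

definition orthogonal_family :: "'a set \<Rightarrow> nat \<Rightarrow> (nat \<Rightarrow> 'a \<Rightarrow> rat) \<Rightarrow> bool" where
  "orthogonal_family S r v \<longleftrightarrow>
     (\<forall>i<r. v i \<in> supported_on S \<and> v i \<noteq> (\<lambda>s. 0)) \<and>
     (\<forall>i<r. \<forall>j<r. i \<noteq> j \<longrightarrow> inner_on S (v i) (v j) = 0)"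

definition family_projection ::
  "'a set \<Rightarrow> nat \<Rightarrow> (nat \<Rightarrow> 'a \<Rightarrow> rat) \<Rightarrow> ('a \<Rightarrow> rat) \<Rightarrow> 'a \<Rightarrow> rat" where
  "family_projection S r v x =
     (\<lambda>s. \<Sum>i<r. inner_on S x (v i) / inner_on S (v i) (v i) * v i s)"

lemma family_projection_orthogonal:
  assumes "finite S" and v: "orthogonal_family S r v" and j: "j < r"
  shows "inner_on S (\<lambda>s. x s - family_projection S r v x s) (v j) = 0"
proof -
  have "inner_on S (family_projection S r v x) (v j) =
      (\<Sum>i<r. inner_on S x (v i) / inner_on S (v i) (v i) * inner_on S (v i) (v j))"
    unfolding family_projection_def inner_on_sum inner_on_linear ..
  also have "\<dots> = (\<Sum>i<r. if i = j then inner_on S x (v j) / inner_on S (v j) (v j) * inner_on S (v j) (v j) else 0)"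
    using v j by (intro sum.cong) (auto simp: orthogonal_family_def)
  also have "\<dots> = inner_on S x (v j)"
    using v j inner_on_eq_0[OF assms(1), of "v j"] by (auto simp: orthogonal_family_def)
  finally show ?thesis by (simp add: inner_on_linear)
qed

lemma bessel:
  assumes "finite S" and v: "orthogonal_family S r v"
  shows "(\<Sum>i<r. (inner_on S x (v i))\<^sup>2 / inner_on S (v i) (v i)) \<le> inner_on S x x"
proof -
  let ?p = "family_projection S r v x" and ?q = "\<lambda>s. x s - family_projection S r v x s"
  have "inner_on S ?p ?q = (\<Sum>i<r. inner_on S x (v i) / inner_on S (v i) (v i) * inner_on S (v i) ?q)"
    unfolding family_projection_def inner_on_sum inner_on_linear ..
  also have "\<dots> = 0"
    using family_projection_orthogonal[OF assms, of _ x]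
    by (intro sum.neutral) (simp add: inner_on_commute[of S _ ?q])
  finally have pq: "inner_on S ?p x = inner_on S ?p ?p"
    by (simp add: inner_on_linear_right)
  have "0 \<le> inner_on S ?q ?q" by (rule inner_on_nonneg)
  also have "\<dots> = inner_on S x x - inner_on S ?p x"
    using pq by (simp add: inner_on_linear inner_on_linear_right inner_on_commute[of S x ?p])
  also have "inner_on S ?p x = (\<Sum>i<r. (inner_on S x (v i))\<^sup>2 / inner_on S (v i) (v i))"
    unfolding family_projection_def inner_on_sum inner_on_linear
    by (simp add: inner_on_commute[of S _ x] power2_eq_square)
  finally show ?thesis by simp
qed

text \<open>Bessel's inequality for the indicator function of a point \<open>s\<close> says that the sum of
  \<open>v i s\<^sup>2 / \<langle>v i, v i\<rangle>\<close> over \<open>i\<close> is at most 1.  Summing over \<open>s\<close>, each \<open>i\<close> contributes exactly 1.  The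
  bound does the work of a dimension count: it provides families of maximal length.\<close>

lemma orthogonal_family_bound:
  assumes "finite S" and v: "orthogonal_family S r v"
  shows "r \<le> card S"
proof -
  have ind: "inner_on S (\<lambda>t. if t = s then 1 else 0) c = c s" if "s \<in> S" for s c
  proof -
    have "inner_on S (\<lambda>t. if t = s then 1 else 0) c = (\<Sum>t\<in>S. if t = s then c t else 0)"
      unfolding inner_on_def by (rule sum.cong) auto
    also have "\<dots> = c s" using assms(1) that by simp
    finally show ?thesis .
  qed
  have N: "inner_on S (v i) (v i) \<noteq> 0" if "i < r" for i
    using inner_on_eq_0[OF assms(1), of "v i"] v that by (auto simp: orthogonal_family_def)
  have "of_nat r = (\<Sum>i<r. (\<Sum>s\<in>S. (v i s)\<^sup>2) / inner_on S (v i) (v i))"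
    using N by (simp add: inner_on_def power2_eq_square)
  also have "\<dots> = (\<Sum>s\<in>S. \<Sum>i<r. (v i s)\<^sup>2 / inner_on S (v i) (v i))"
    unfolding sum_divide_distrib by (rule sum.swap)
  also have "\<dots> \<le> (\<Sum>s\<in>S. 1)"
  proof (rule sum_mono)
    fix s assume s: "s \<in> S"
    show "(\<Sum>i<r. (v i s)\<^sup>2 / inner_on S (v i) (v i)) \<le> 1"
      using bessel[OF assms, of "\<lambda>t. if t = s then 1 else 0"] unfolding ind[OF s] by simp
  qed
  also have "\<dots> = of_nat (card S)" by simp
  finally show ?thesis by (simp only: of_nat_le_iff)
qed

text \<open>An orthogonal family in \<open>W\<close> of maximal length spans \<open>W\<close>, since otherwise the difference of a vector
  of \<open>W\<close> and its Fourier sum would prolong it.  The Fourier sum is then the projection onto \<open>W\<close>.\<close>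

lemma orthogonal_projection_exists:
  assumes fin: "finite S" and W: "function_subspace W" "W \<subseteq> supported_on S"
  shows "\<exists>p\<in>W. \<forall>w\<in>W. inner_on S (\<lambda>s. x s - p s) w = 0"
proof -
  let ?P = "\<lambda>r. \<exists>v. orthogonal_family S r v \<and> (\<forall>i<r. v i \<in> W)"
  have "?P 0" by (simp add: orthogonal_family_def)
  moreover have "\<forall>r. ?P r \<longrightarrow> r \<le> card S" using orthogonal_family_bound[OF fin] by blast
  ultimately obtain r where r: "?P r" "\<forall>r'. ?P r' \<longrightarrow> r' \<le> r"
    using GreatestI_nat[of ?P 0 "card S"] Greatest_le_nat[of ?P _ "card S"] by blast
  from r(1) obtain v where v: "orthogonal_family S r v" and vW: "\<forall>i<r. v i \<in> W" by blast
  let ?p = "family_projection S r v"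
  have pW: "?p y \<in> W" for y
    unfolding family_projection_def using vW
    by (intro function_subspace_sum[OF W(1)] function_subspaceD(3)[OF W(1)]) auto
  have span: "w = ?p w" if w: "w \<in> W" for w
  proof (rule ccontr)
    assume ne: "w \<noteq> ?p w"
    let ?q = "\<lambda>s. w s - ?p w s"
    have qW: "?q \<in> W" by (rule function_subspaceD(4)[OF W(1) w pW])
    have q0: "?q \<noteq> (\<lambda>s. 0)" using ne by (auto simp: fun_eq_iff)
    have qv: "inner_on S ?q (v j) = 0" if "j < r" for j
      by (rule family_projection_orthogonal[OF fin v that])
    then have vq: "inner_on S (v j) ?q = 0" if "j < r" for j
      using that by (simp add: inner_on_commute[of S "v j"])
    have "orthogonal_family S (Suc r) (v(r := ?q))"
      using v qW q0 W(2) qv vq by (auto simp: orthogonal_family_def less_Suc_eq)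
    moreover have "\<forall>i<Suc r. (v(r := ?q)) i \<in> W" using vW qW by (auto simp: less_Suc_eq)
    ultimately have "Suc r \<le> r" using r(2) by blast
    then show False by simp
  qed
  have "inner_on S (\<lambda>s. x s - ?p x s) w = 0" if "w \<in> W" for w
  proof -
    have "inner_on S (?p w) (\<lambda>s. x s - ?p x s) =
      (\<Sum>i<r. inner_on S w (v i) / inner_on S (v i) (v i) * inner_on S (v i) (\<lambda>s. x s - ?p x s))"
      unfolding family_projection_def[of S r v w] inner_on_sum inner_on_linear ..
    also have "\<dots> = 0"
    proof (intro sum.neutral ballI)
      fix i assume "i \<in> {..<r}"
      then have "inner_on S (v i) (\<lambda>s. x s - ?p x s) = 0"
        using family_projection_orthogonal[OF fin v, of i x]
        by (simp only: inner_on_commute[of S "v i"] lessThan_iff)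
      then show "inner_on S w (v i) / inner_on S (v i) (v i) * inner_on S (v i) (\<lambda>s. x s - ?p x s) = 0"
        by (simp only: mult_zero_right)
    qed
    finally show ?thesis
      unfolding span[OF that, symmetric] inner_on_commute[of S w] .
  qed
  with pW show ?thesis by blast
qed

section \<open>Complete reducibility for orthogonal actions\<close>

locale orthogonal_action = group G for G :: "('g, 'm) monoid_scheme" (structure) +
  fixes S :: "'a set" and act :: "'g \<Rightarrow> ('a \<Rightarrow> rat) \<Rightarrow> 'a \<Rightarrow> rat"
  assumes finite_support: "finite S"
    and act_supported: "g \<in> carrier G \<Longrightarrow> c \<in> supported_on S \<Longrightarrow> act g c \<in> supported_on S"
    and act_add: "g \<in> carrier G \<Longrightarrow> act g (\<lambda>s. c s + d s) = (\<lambda>s. act g c s + act g d s)"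
    and act_scale: "g \<in> carrier G \<Longrightarrow> act g (\<lambda>s. a * c s) = (\<lambda>s. a * act g c s)"
    and act_one: "act \<one> c = c"
    and act_mult: "g \<in> carrier G \<Longrightarrow> h \<in> carrier G \<Longrightarrow> act (g \<otimes> h) c = act g (act h c)"
    and act_inner: "g \<in> carrier G \<Longrightarrow> c \<in> supported_on S \<Longrightarrow> d \<in> supported_on S \<Longrightarrow>
      inner_on S (act g c) (act g d) = inner_on S c d"
begin

definition invariant :: "('a \<Rightarrow> rat) set \<Rightarrow> bool" where
  "invariant U \<longleftrightarrow> function_subspace U \<and> U \<subseteq> supported_on S \<and> (\<forall>g\<in>carrier G. \<forall>c\<in>U. act g c \<in> U)"

definition perp :: "('a \<Rightarrow> rat) set \<Rightarrow> ('a \<Rightarrow> rat) set \<Rightarrow> ('a \<Rightarrow> rat) set" where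
  "perp U W = {c \<in> U. \<forall>w\<in>W. inner_on S c w = 0}"

lemma invariant_perp:
  assumes U: "invariant U" and W: "W \<subseteq> supported_on S" "\<And>g w. g \<in> carrier G \<Longrightarrow> w \<in> W \<Longrightarrow> act g w \<in> W"
  shows "invariant (perp U W)"
  unfolding invariant_def
proof (intro conjI ballI)
  have fs: "function_subspace U" using U by (simp add: invariant_def)
  show "function_subspace (perp U W)"
    using function_subspaceD[OF fs] by (simp add: function_subspace_def perp_def inner_on_linear)
  show "perp U W \<subseteq> supported_on S" using U by (auto simp: perp_def invariant_def)
  fix g c assume g: "g \<in> carrier G" and c: "c \<in> perp U W"
  have "inner_on S (act g c) w = 0" if w: "w \<in> W" for w
  proof -
    have w': "act (inv g) w \<in> W" using W(2) g w by simp
    have "act g (act (inv g) w) = w"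
      using g by (simp add: act_mult[symmetric] act_one)
    then have "inner_on S (act g c) w = inner_on S (act g c) (act g (act (inv g) w))" by simp
    also have "\<dots> = inner_on S c (act (inv g) w)"
      using c U w' W(1) by (intro act_inner g) (auto simp: perp_def invariant_def)
    also have "\<dots> = 0" using c w' by (simp add: perp_def)
    finally show ?thesis .
  qed
  then show "act g c \<in> perp U W" using c g U by (simp add: perp_def invariant_def)
qed

definition orthogonal_summands :: "('a \<Rightarrow> rat) set \<Rightarrow> nat \<Rightarrow> (nat \<Rightarrow> ('a \<Rightarrow> rat) set) \<Rightarrow> bool" where
  "orthogonal_summands U r W \<longleftrightarrow>
     (\<forall>i<r. invariant (W i) \<and> W i \<subseteq> U \<and> W i \<noteq> {\<lambda>s. 0}) \<and>
     (\<forall>i<r. \<forall>j<r. i \<noteq> j \<longrightarrow> (\<forall>c\<in>W i. \<forall>d\<in>W j. inner_on S c d = 0))"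

lemma orthogonal_summands_bound:
  assumes "orthogonal_summands U r W"
  shows "r \<le> card S"
proof -
  have "\<forall>i. \<exists>v. i < r \<longrightarrow> v \<in> W i \<and> v \<noteq> (\<lambda>s. 0)"
  proof (intro allI)
    fix i show "\<exists>v. i < r \<longrightarrow> v \<in> W i \<and> v \<noteq> (\<lambda>s. 0)"
    proof (cases "i < r")
      case True
      then have "(\<lambda>s. 0) \<in> W i" "W i \<noteq> {\<lambda>s. 0}"
        using assms by (auto simp: orthogonal_summands_def invariant_def function_subspace_def)
      then show ?thesis by blast
    qed simp
  qed
  from choice[OF this] obtain v where v: "\<forall>i. i < r \<longrightarrow> v i \<in> W i \<and> v i \<noteq> (\<lambda>s. 0)" ..
  have "orthogonal_family S r v"
    unfolding orthogonal_family_def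
  proof (intro conjI allI impI)
    fix i assume "i < r"
    then have "v i \<in> W i" "v i \<noteq> (\<lambda>s. 0)" "W i \<subseteq> supported_on S"
      using v assms by (simp_all add: orthogonal_summands_def invariant_def)
    then show "v i \<in> supported_on S" "v i \<noteq> (\<lambda>s. 0)" by blast+
  next
    fix i j assume "i < r" "j < r" "i \<noteq> j"
    then show "inner_on S (v i) (v j) = 0"
      using v assms by (simp add: orthogonal_summands_def)
  qed
  then show ?thesis by (rule orthogonal_family_bound[OF finite_support])
qed

lemma orthogonal_summands_extend:
  assumes W: "orthogonal_summands U r W"
    and Z: "invariant Z" "Z \<subseteq> U" "Z \<noteq> {\<lambda>s. 0}" "\<And>i c d. i < r \<Longrightarrow> c \<in> W i \<Longrightarrow> d \<in> Z \<Longrightarrow> inner_on S d c = 0"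
  shows "orthogonal_summands U (Suc r) (W(r := Z))"
proof -
  have Z': "inner_on S c d = 0" if "i < r" "c \<in> W i" "d \<in> Z" for i c d
    using Z(4)[OF that] by (simp only: inner_on_commute[of S c d])
  show ?thesis
    unfolding orthogonal_summands_def
  proof (intro conjI allI impI ballI)
    fix i assume "i < Suc r"
    then show "invariant ((W(r := Z)) i)" "(W(r := Z)) i \<subseteq> U" "(W(r := Z)) i \<noteq> {\<lambda>s. 0}"
      using W Z(1,2,3) by (auto simp: orthogonal_summands_def less_Suc_eq)
  next
    fix i j c d assume ij: "i < Suc r" "j < Suc r" "i \<noteq> j"
      and cd: "c \<in> (W(r := Z)) i" "d \<in> (W(r := Z)) j"
    consider "i = r" "j < r" | "j = r" "i < r" | "i < r" "j < r" using ij by linarith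
    then show "inner_on S c d = 0"
    proof cases
      case 1
      then show ?thesis using cd Z(4)[of j d c] by simp
    next
      case 2
      then show ?thesis using cd Z'[of i c d] by simp
    next
      case 3
      then show ?thesis using cd ij(3) W by (simp add: orthogonal_summands_def)
    qed
  qed
qed

text \<open>Take as many pairwise orthogonal nonzero invariant subspaces as possible.  A summand with a
  proper nonzero invariant subspace could be replaced by this subspace and its orthogonal
  complement in the summand.  A nonzero vector of \<open>U\<close> orthogonal to all summands would make the
  orthogonal complement of their sum a further summand.\<close>

theorem orthogonal_decomposition:
  assumes U: "invariant U"
  obtains r W where "orthogonal_summands U r W"
    "\<And>i Y. i < r \<Longrightarrow> invariant Y \<Longrightarrow> Y \<subseteq> W i \<Longrightarrow> Y = {\<lambda>s. 0} \<or> Y = W i"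
    "\<And>u. u \<in> U \<Longrightarrow> \<exists>w. (\<forall>i<r. w i \<in> W i) \<and> u = (\<lambda>s. \<Sum>i<r. w i s)"
proof -
  let ?P = "\<lambda>r. \<exists>W. orthogonal_summands U r W"
  have "?P 0" by (simp add: orthogonal_summands_def)
  moreover have "\<forall>r. ?P r \<longrightarrow> r \<le> card S" using orthogonal_summands_bound by blast
  ultimately obtain r where r: "?P r" and max: "\<forall>r'. ?P r' \<longrightarrow> r' \<le> r"
    using GreatestI_nat[of ?P 0 "card S"] Greatest_le_nat[of ?P _ "card S"] by blast
  from r obtain W where W: "orthogonal_summands U r W" by blast
  have Wi: "invariant (W i)" "W i \<subseteq> U" "function_subspace (W i)" "W i \<subseteq> supported_on S" if "i < r" for i
    using W that by (auto simp: orthogonal_summands_def invariant_def)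
  have orth: "inner_on S c d = 0" if "i < r" "j < r" "i \<noteq> j" "c \<in> W i" "d \<in> W j" for i j c d
    using W that by (auto simp: orthogonal_summands_def)
  have fsU: "function_subspace U" using U by (simp add: invariant_def)
  show ?thesis
  proof (rule that[OF W])
    fix i Y assume i: "i < r" and Y: "invariant Y" "Y \<subseteq> W i"
    show "Y = {\<lambda>s. 0} \<or> Y = W i"
    proof (rule ccontr)
      assume neg: "\<not> ?thesis"
      \<comment> \<open>replace the summand \<open>W i\<close> by \<open>Y\<close> and its complement, which contradicts the choice of \<open>r\<close>\<close>
      let ?Z = "perp (W i) Y"
      have fY: "function_subspace Y" "Y \<subseteq> supported_on S" using Y by (auto simp: invariant_def)
      from neg Y obtain x where x: "x \<in> W i" "x \<notin> Y" by blast
      obtain p where p: "p \<in> Y" "\<forall>w\<in>Y. inner_on S (\<lambda>s. x s - p s) w = 0"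
        using orthogonal_projection_exists[OF finite_support fY] by blast
      have "(\<lambda>s. x s - p s) \<in> W i"
        using function_subspaceD(4)[OF Wi(3)[OF i] x(1)] p(1) Y(2) by blast
      then have xp: "(\<lambda>s. x s - p s) \<in> ?Z" using p(2) by (simp add: perp_def)
      have "(\<lambda>s. x s - p s) \<noteq> (\<lambda>s. 0)"
      proof
        assume "(\<lambda>s. x s - p s) = (\<lambda>s. 0)"
        then have "x = p" by (auto simp: fun_eq_iff)
        with x(2) p(1) show False by simp
      qed
      with xp have Z0: "?Z \<noteq> {\<lambda>s. 0}" by blast
      have Zinv: "invariant ?Z"
        using Y(1) by (intro invariant_perp Wi(1)[OF i] fY(2)) (auto simp: invariant_def)
      have sub: "(W(i := Y)) j \<subseteq> W j" for j using Y(2) by simp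
      have "orthogonal_summands U r (W(i := Y))"
        unfolding orthogonal_summands_def
      proof (intro conjI allI impI ballI)
        fix j assume "j < r"
        then show "invariant ((W(i := Y)) j)" "(W(i := Y)) j \<subseteq> U" "(W(i := Y)) j \<noteq> {\<lambda>s. 0}"
          using W Y neg by (auto simp: orthogonal_summands_def)
      next
        fix j l c d assume "j < r" "l < r" "j \<noteq> l" "c \<in> (W(i := Y)) j" "d \<in> (W(i := Y)) l"
        then show "inner_on S c d = 0" using sub orth by blast
      qed
      then have "orthogonal_summands U (Suc r) ((W(i := Y))(r := ?Z))"
      proof (rule orthogonal_summands_extend[OF _ Zinv _ Z0])
        show "?Z \<subseteq> U" using Wi(2)[OF i] by (auto simp: perp_def)
        fix j c d assume "j < r" "c \<in> (W(i := Y)) j" "d \<in> ?Z"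
        then show "inner_on S d c = 0"
          using orth[OF i, of j d c] by (cases "j = i") (auto simp: perp_def)
      qed
      then have "Suc r \<le> r" using max by blast
      then show False by simp
    qed
  next
    fix u assume u: "u \<in> U"
    have "\<forall>i. \<exists>p. i < r \<longrightarrow> p \<in> W i \<and> (\<forall>w\<in>W i. inner_on S (\<lambda>s. u s - p s) w = 0)"
    proof (intro allI)
      fix i show "\<exists>p. i < r \<longrightarrow> p \<in> W i \<and> (\<forall>w\<in>W i. inner_on S (\<lambda>s. u s - p s) w = 0)"
      proof (cases "i < r")
        case True
        then show ?thesis
          using orthogonal_projection_exists[OF finite_support Wi(3,4)[OF True], of u] by blast
      qed simp
    qed
    from choice[OF this] obtain p where
      "\<forall>i. i < r \<longrightarrow> p i \<in> W i \<and> (\<forall>w\<in>W i. inner_on S (\<lambda>s. u s - p i s) w = 0)" ..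
    then have p: "\<And>i. i < r \<Longrightarrow> p i \<in> W i"
      "\<And>i w. i < r \<Longrightarrow> w \<in> W i \<Longrightarrow> inner_on S (\<lambda>s. u s - p i s) w = 0" by blast+
    let ?q = "\<lambda>s. u s - (\<Sum>i<r. p i s)"
    let ?C = "perp U (\<Union>i<r. W i)"
    have qU: "?q \<in> U"
    proof (rule function_subspaceD(4)[OF fsU u], rule function_subspace_sum[OF fsU])
      fix i assume "i \<in> {..<r}"
      then show "p i \<in> U" using p(1) Wi(2) by auto
    qed simp
    have "inner_on S ?q w = 0" if j: "j < r" "w \<in> W j" for j w
    proof -
      have "inner_on S (\<lambda>s. \<Sum>i<r. p i s) w = (\<Sum>i<r. if i = j then inner_on S (p j) w else 0)"
        unfolding inner_on_sum using orth[OF _ j(1) _ _ j(2)] p(1)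
        by (intro sum.cong) auto
      then show ?thesis using p(2)[OF j] j(1) by (simp add: inner_on_linear)
    qed
    with qU have qC: "?q \<in> ?C" by (auto simp: perp_def)
    have "?C = {\<lambda>s. 0}"
    proof (rule ccontr)
      assume C0: "?C \<noteq> {\<lambda>s. 0}"
      have "invariant ?C"
      proof (rule invariant_perp[OF U])
        show "(\<Union>i<r. W i) \<subseteq> supported_on S" using Wi(4) by (intro UN_least) simp
        fix g w assume "g \<in> carrier G" "w \<in> (\<Union>i<r. W i)"
        then show "act g w \<in> (\<Union>i<r. W i)"
          using Wi(1) unfolding invariant_def by blast
      qed
      then have "orthogonal_summands U (Suc r) (W(r := ?C))"
        by (rule orthogonal_summands_extend[OF W _ _ C0]) (auto simp: perp_def)
      then have "Suc r \<le> r" using max by blast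
      then show False by simp
    qed
    with qC have "?q = (\<lambda>s. 0)" by blast
    then have "u = (\<lambda>s. \<Sum>i<r. p i s)" by (auto simp: fun_eq_iff)
    with p(1) show "\<exists>w. (\<forall>i<r. w i \<in> W i) \<and> u = (\<lambda>s. \<Sum>i<r. w i s)" by blast
  qed
qed

lemma orthogonal_sum_unique:
  assumes W: "orthogonal_summands U r W"
    and w: "\<And>i. i < r \<Longrightarrow> w i \<in> W i" "\<And>i. i < r \<Longrightarrow> w' i \<in> W i"
    and eq: "(\<lambda>s. \<Sum>i<r. w i s) = (\<lambda>s. \<Sum>i<r. w' i s)" and j: "j < r"
  shows "w j = w' j"
proof -
  let ?d = "\<lambda>i s. w i s - w' i s"
  have d: "?d i \<in> W i" if "i < r" for i
    using W that w by (intro function_subspaceD(4)) (auto simp: orthogonal_summands_def invariant_def)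
  have "(\<lambda>s. \<Sum>i<r. ?d i s) = (\<lambda>s. 0)"
    using eq by (simp add: sum_subtractf fun_eq_iff)
  then have "0 = inner_on S (\<lambda>s. \<Sum>i<r. ?d i s) (?d j)" by (simp add: inner_on_linear(4))
  also have "\<dots> = (\<Sum>i<r. if i = j then inner_on S (?d j) (?d j) else 0)"
    unfolding inner_on_sum using W d j by (intro sum.cong) (auto simp: orthogonal_summands_def)
  also have "\<dots> = inner_on S (?d j) (?d j)" using j by simp
  finally have "?d j = (\<lambda>s. 0)"
    using W d[OF j] j by (intro inner_on_eq_0[OF finite_support]) (auto simp: orthogonal_summands_def invariant_def)
  then show ?thesis by (auto simp: fun_eq_iff)
qed

end

section \<open>Quotients of function spaces\<close>

definition function_module :: "('a \<Rightarrow> rat) set \<Rightarrow> (rat, 'a \<Rightarrow> rat) module" where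
  "function_module U =
     \<lparr>carrier = U, monoid.mult = undefined, one = undefined, ring.zero = (\<lambda>s. 0),
      add = (\<lambda>c d s. c s + d s), module.smult = (\<lambda>a c s. a * c s)\<rparr>"

lemma function_module_simps [simp]:
  "carrier (function_module U) = U" "c \<oplus>\<^bsub>function_module U\<^esub> d = (\<lambda>s. c s + d s)"
  "a \<odot>\<^bsub>function_module U\<^esub> c = (\<lambda>s. a * c s)" "\<zero>\<^bsub>function_module U\<^esub> = (\<lambda>s. 0)"
  "function_module U\<lparr>carrier := W\<rparr> = function_module W"
  by (simp_all add: function_module_def)

lemma module_function_module:
  assumes "function_subspace U" shows "module rat_field (function_module U)"
proof (intro moduleI cring_from_type_algebra abelian_groupI)
  note D = function_subspaceD[OF assms]
  show "\<exists>d\<in>carrier (function_module U). d \<oplus>\<^bsub>function_module U\<^esub> c = \<zero>\<^bsub>function_module U\<^esub>"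
    if "c \<in> carrier (function_module U)" for c
    using that D(3)[of c "-1"] by (intro bexI[of _ "\<lambda>s. - 1 * c s"]) simp_all
qed (use function_subspaceD[OF assms] in \<open>simp_all add: algebra_simps\<close>)

lemma finsum_function_module:
  assumes U: "function_subspace U" and w: "finite A" "w \<in> A \<rightarrow> U"
  shows "(\<Oplus>\<^bsub>function_module U\<^esub>i\<in>A. w i) = (\<lambda>s. \<Sum>i\<in>A. w i s)"
proof -
  interpret module rat_field "function_module U" by (rule module_function_module[OF U])
  from w show ?thesis
  proof (induction A)
    case (insert i A)
    then have "w \<in> A \<rightarrow> carrier (function_module U)" "w i \<in> carrier (function_module U)" by auto
    then show ?case using insert by simp
  qed simp
qed

text \<open>The coset of \<open>h\<close> modulo \<open>B\<close>, described by membership, which reduces equations between cosets to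
  the closure properties of \<open>B\<close>.\<close>

definition coset :: "('a \<Rightarrow> rat) set \<Rightarrow> ('a \<Rightarrow> rat) \<Rightarrow> ('a \<Rightarrow> rat) set" where
  "coset B h = {c. (\<lambda>s. c s - h s) \<in> B}"

lemma coset_eq_iff:
  assumes "function_subspace B"
  shows "coset B h = coset B h' \<longleftrightarrow> (\<lambda>s. h s - h' s) \<in> B"
proof
  assume "coset B h = coset B h'"
  moreover have "h \<in> coset B h" using function_subspaceD(1)[OF assms] by (simp add: coset_def)
  ultimately show "(\<lambda>s. h s - h' s) \<in> B" by (simp add: coset_def)
next
  assume d: "(\<lambda>s. h s - h' s) \<in> B"
  show "coset B h = coset B h'"
    unfolding coset_def
  proof (intro Collect_cong iffI)
    fix c assume "(\<lambda>s. c s - h s) \<in> B"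
    from function_subspaceD(2)[OF assms this d] show "(\<lambda>s. c s - h' s) \<in> B" by simp
  next
    fix c assume "(\<lambda>s. c s - h' s) \<in> B"
    from function_subspaceD(4)[OF assms this d] show "(\<lambda>s. c s - h s) \<in> B" by simp
  qed
qed

lemma coset_zero: "coset B (\<lambda>s. 0) = B"
  by (simp add: coset_def)

lemma a_r_coset_function_module: "a_r_coset (function_module U) B h = coset B h"
proof -
  have "a_r_coset (function_module U) B h = (\<lambda>b s. b s + h s) ` B"
    by (auto simp: a_r_coset_def r_coset_def function_module_def)
  also have "\<dots> = coset B h"
  proof (intro equalityI subsetI)
    fix c assume "c \<in> coset B h"
    then show "c \<in> (\<lambda>b s. b s + h s) ` B"
      by (intro image_eqI[of _ _ "\<lambda>s. c s - h s"]) (auto simp: coset_def)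
  qed (auto simp: coset_def)
  finally show ?thesis .
qed

lemma carrier_quotient_module:
  "carrier (quotient_module (function_module Z) B) = coset B ` Z"
  using a_r_coset_function_module[of Z B, unfolded a_r_coset_def]
  by (auto simp: quotient_module_def A_RCOSETS_def RCOSETS_def simp del: function_module_simps(4))

lemma set_add_function_module: "set_add (function_module U) A A' = {\<lambda>s. a s + a' s | a a'. a \<in> A \<and> a' \<in> A'}"
  by (auto simp: set_add_def set_mult_def function_module_def)

lemma set_add_coset:
  assumes "function_subspace B"
  shows "set_add (function_module U) (coset B h) (coset B h') = coset B (\<lambda>s. h s + h' s)"
  unfolding set_add_function_module
proof (intro equalityI subsetI)
  fix x assume "x \<in> {\<lambda>s. a s + a' s | a a'. a \<in> coset B h \<and> a' \<in> coset B h'}"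
  then obtain a a' where x: "x = (\<lambda>s. a s + a' s)" and a: "a \<in> coset B h" "a' \<in> coset B h'" by blast
  from a have "(\<lambda>s. (a s - h s) + (a' s - h' s)) \<in> B"
    using function_subspaceD(2)[OF assms] by (simp add: coset_def)
  then show "x \<in> coset B (\<lambda>s. h s + h' s)" by (simp add: coset_def x algebra_simps)
next
  fix x assume "x \<in> coset B (\<lambda>s. h s + h' s)"
  then have "(\<lambda>s. x s - h' s) \<in> coset B h" by (simp add: coset_def algebra_simps)
  moreover have "h' \<in> coset B h'" using function_subspaceD(1)[OF assms] by (simp add: coset_def)
  moreover have "x = (\<lambda>s. (x s - h' s) + h' s)" by simp
  ultimately have "\<exists>a a'. x = (\<lambda>s. a s + a' s) \<and> a \<in> coset B h \<and> a' \<in> coset B h'"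
    by (intro exI conjI)
  then show "x \<in> {\<lambda>s. a s + a' s | a a'. a \<in> coset B h \<and> a' \<in> coset B h'}" by (simp only: mem_Collect_eq)
qed

text \<open>Multiplying a coset by \<open>a = 0\<close> element by element yields only the zero function, and adding \<open>B\<close>
  restores the zero coset.\<close>

lemma smult_coset:
  assumes "function_subspace B"
  shows "set_add (function_module U) B ((\<lambda>c s. a * c s) ` coset B h) = coset B (\<lambda>s. a * h s)"
  unfolding set_add_function_module
proof (intro equalityI subsetI)
  fix x assume "x \<in> {\<lambda>s. b s + c s | b c. b \<in> B \<and> c \<in> (\<lambda>c s. a * c s) ` coset B h}"
  then obtain b c where x: "x = (\<lambda>s. b s + a * c s)" and b: "b \<in> B" "(\<lambda>s. c s - h s) \<in> B"
    by (auto simp: coset_def)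
  from function_subspaceD(2)[OF assms b(1) function_subspaceD(3)[OF assms b(2), of a]]
  show "x \<in> coset B (\<lambda>s. a * h s)" by (simp add: coset_def x algebra_simps)
next
  fix x assume "x \<in> coset B (\<lambda>s. a * h s)"
  then have "(\<lambda>s. x s - a * h s) \<in> B" by (simp add: coset_def)
  moreover have "h \<in> coset B h" using function_subspaceD(1)[OF assms] by (simp add: coset_def)
  then have "(\<lambda>s. a * h s) \<in> (\<lambda>c s. a * c s) ` coset B h" by (rule imageI)
  moreover have "x = (\<lambda>s. (x s - a * h s) + a * h s)" by simp
  ultimately have "\<exists>b c. x = (\<lambda>s. b s + c s) \<and> b \<in> B \<and> c \<in> (\<lambda>c s. a * c s) ` coset B h"
    by (intro exI conjI)
  then show "x \<in> {\<lambda>s. b s + c s | b c. b \<in> B \<and> c \<in> (\<lambda>c s. a * c s) ` coset B h}" by (simp only: mem_Collect_eq)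
qed

context orthogonal_action
begin

lemma act_image_coset:
  assumes B: "invariant B" and g: "g \<in> carrier G"
  shows "act g ` coset B h = coset B (act g h)"
proof -
  have diff: "act g' (\<lambda>s. c s - d s) = (\<lambda>s. act g' c s - act g' d s)" if "g' \<in> carrier G" for g' c d
    using act_add[OF that, of c "\<lambda>s. -1 * d s"] act_scale[OF that, of "-1" d] by simp
  have inverse: "act g (act (inv g) c) = c" "act (inv g) (act g c) = c" for c
    using g by (simp_all add: act_mult[symmetric] act_one)
  have closed: "act g' b \<in> B" if "g' \<in> carrier G" "b \<in> B" for g' b
    using B that by (simp add: invariant_def)
  show ?thesis
  proof (intro equalityI subsetI)
    fix x assume "x \<in> act g ` coset B h"
    then obtain c where "x = act g c" "(\<lambda>s. c s - h s) \<in> B" by (auto simp: coset_def)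
    then show "x \<in> coset B (act g h)"
      using closed[OF g, of "\<lambda>s. c s - h s"] by (simp add: coset_def diff[OF g])
  next
    fix x assume "x \<in> coset B (act g h)"
    then have "act (inv g) (\<lambda>s. x s - act g h s) \<in> B" using closed g by (simp add: coset_def)
    then have "act (inv g) x \<in> coset B h"
      using g by (simp add: diff inverse coset_def)
    then show "x \<in> act g ` coset B h" by (intro image_eqI[of _ _ "act (inv g) x"]) (simp_all add: inverse)
  qed
qed

lemma group_representation_function_module:
  assumes "invariant U"
  shows "group_representation G rat_field (function_module U) act"
proof -
  have U: "function_subspace U" "\<And>g c. g \<in> carrier G \<Longrightarrow> c \<in> U \<Longrightarrow> act g c \<in> U"
    using assms by (auto simp: invariant_def)
  show ?thesis
    unfolding group_representation_def
    using U module_function_module[OF U(1)] is_group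
    by (auto simp: act_add act_scale act_one act_mult field_from_type_algebra)
qed

lemma subrepresentation_function_module:
  assumes U: "invariant U"
  shows "subrepresentation G rat_field (function_module U) act Y \<longleftrightarrow> invariant Y \<and> Y \<subseteq> U"
proof -
  have "module rat_field (function_module U)"
    using U by (intro module_function_module) (simp add: invariant_def)
  then show ?thesis
    using U by (auto simp: subrepresentation_iff invariant_def function_subspace_def)
qed

lemma irreducible_decomposition_function_module:
  assumes U: "invariant U"
  obtains r W where "irreducible_decomposition G rat_field (function_module U) act r W"
proof -
  have fsU: "function_subspace U" using U by (simp add: invariant_def)
  obtain r W where W: "orthogonal_summands U r W"
    and irr: "\<And>i Y. i < r \<Longrightarrow> invariant Y \<Longrightarrow> Y \<subseteq> W i \<Longrightarrow> Y = {\<lambda>s. 0} \<or> Y = W i"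
    and span: "\<And>u. u \<in> U \<Longrightarrow> \<exists>w. (\<forall>i<r. w i \<in> W i) \<and> u = (\<lambda>s. \<Sum>i<r. w i s)"
    by (rule orthogonal_decomposition[OF U]) (assumption | blast)+
  have Wi: "invariant (W i)" "W i \<subseteq> U" "W i \<noteq> {\<lambda>s. 0}" if "i < r" for i
    using W that by (auto simp: orthogonal_summands_def)
  have sum: "(\<Oplus>\<^bsub>function_module U\<^esub>i\<in>{..<r}. w i) = (\<lambda>s. \<Sum>i<r. w i s)"
    if "\<And>i. i < r \<Longrightarrow> w i \<in> W i" for w
    using that Wi(2) by (intro finsum_function_module[OF fsU]) (auto simp: Pi_iff subset_iff)
  have "irreducible_decomposition G rat_field (function_module U) act r W"
    unfolding irreducible_decomposition_def
  proof (intro conjI allI impI ballI)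
    fix i assume i: "i < r"
    show "subrepresentation G rat_field (function_module U) act (W i)"
      using Wi[OF i] by (simp add: subrepresentation_function_module[OF U])
    show "irreducible_representation G rat_field (function_module U\<lparr>carrier := W i\<rparr>) act"
      unfolding irreducible_representation_def function_module_simps
      using Wi[OF i] irr[OF i] group_representation_function_module
      by (auto simp: subrepresentation_function_module)
  next
    fix u assume "u \<in> carrier (function_module U)"
    then obtain w where w: "\<And>i. i < r \<Longrightarrow> w i \<in> W i" "u = (\<lambda>s. \<Sum>i<r. w i s)"
      using span[of u] by auto
    show "\<exists>!w. w \<in> (\<Pi>\<^sub>E i\<in>{..<r}. W i) \<and> u = (\<Oplus>\<^bsub>function_module U\<^esub>i\<in>{..<r}. w i)"
    proof (rule ex1I)
      let ?w = "restrict w {..<r}"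
      have "?w i \<in> W i" if "i < r" for i using w(1) that by simp
      from sum[of ?w, OF this] show "?w \<in> (\<Pi>\<^sub>E i\<in>{..<r}. W i) \<and> u = (\<Oplus>\<^bsub>function_module U\<^esub>i\<in>{..<r}. ?w i)"
        using w by auto
      fix w' assume w': "w' \<in> (\<Pi>\<^sub>E i\<in>{..<r}. W i) \<and> u = (\<Oplus>\<^bsub>function_module U\<^esub>i\<in>{..<r}. w' i)"
      then have w'W: "\<And>i. i < r \<Longrightarrow> w' i \<in> W i" by (auto simp: PiE_iff)
      have eq: "(\<lambda>s. \<Sum>i<r. w' i s) = (\<lambda>s. \<Sum>i<r. w i s)"
        using w' sum[of w', OF w'W] w(2) by simp
      show "w' = ?w"
      proof
        fix i show "w' i = ?w i"
        proof (cases "i < r")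
          case True
          then show ?thesis using orthogonal_sum_unique[OF W w'W w(1) eq True] by simp
        next
          case False
          then show ?thesis using w' by (auto simp: PiE_iff extensional_def)
        qed
      qed
    qed
  qed
  then show ?thesis by (rule that)
qed

text \<open>Each coset of \<open>B\<close> contains exactly one function orthogonal to \<open>B\<close>, namely the difference of any
  representative and its projection onto \<open>B\<close>.\<close>

lemma quotient_representation_iso:
  assumes Z: "invariant Z" and B: "invariant B" "B \<subseteq> Z"
  shows "representation_iso G rat_field (function_module (perp Z B)) act
    (quotient_module (function_module Z) B) (\<lambda>g A. act g ` A) (coset B)"
proof -
  have fsB: "function_subspace B" and Bs: "B \<subseteq> supported_on S" and fsZ: "function_subspace Z"
    using B Z by (auto simp: invariant_def)
  let ?V = "quotient_module (function_module Z) B"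
  have carrier: "carrier ?V = coset B ` Z" by (rule carrier_quotient_module)
  have "inj_on (coset B) (perp Z B)"
  proof (rule inj_onI)
    fix h h' assume h: "h \<in> perp Z B" "h' \<in> perp Z B" and "coset B h = coset B h'"
    then have d: "(\<lambda>s. h s - h' s) \<in> B" by (simp add: coset_eq_iff[OF fsB])
    have "inner_on S h (\<lambda>s. h s - h' s) = 0" "inner_on S h' (\<lambda>s. h s - h' s) = 0"
      using h d by (auto simp: perp_def)
    then have "inner_on S (\<lambda>s. h s - h' s) (\<lambda>s. h s - h' s) = 0"
      unfolding inner_on_linear(2) by simp
    then have "(\<lambda>s. h s - h' s) = (\<lambda>s. 0)"
      using d Bs by (intro inner_on_eq_0[OF finite_support]) auto
    then show "h = h'" by (simp add: fun_eq_iff)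
  qed
  moreover have "coset B ` perp Z B = coset B ` Z"
  proof (intro equalityI subsetI)
    fix A assume "A \<in> coset B ` Z"
    then obtain z where z: "z \<in> Z" "A = coset B z" by blast
    obtain p where p: "p \<in> B" "\<forall>w\<in>B. inner_on S (\<lambda>s. z s - p s) w = 0"
      using orthogonal_projection_exists[OF finite_support fsB Bs] by blast
    have "(\<lambda>s. z s - p s) \<in> perp Z B"
      using function_subspaceD(4)[OF fsZ z(1)] p B(2) by (auto simp: perp_def)
    moreover have "A = coset B (\<lambda>s. z s - p s)"
      unfolding z(2) coset_eq_iff[OF fsB] using p(1) by simp
    ultimately show "A \<in> coset B ` perp Z B" by blast
  qed (auto simp: perp_def)
  ultimately have "bij_betw (coset B) (perp Z B) (carrier ?V)"
    unfolding carrier bij_betw_def by blast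
  then show ?thesis
    unfolding representation_iso_def
    using set_add_coset[OF fsB, of Z] smult_coset[OF fsB, of Z] act_image_coset[OF B(1)]
    by (simp add: quotient_module_def)
qed

lemma quotient_representation:
  assumes Z: "invariant Z" and B: "invariant B" "B \<subseteq> Z"
  defines "V \<equiv> quotient_module (function_module Z) B"
  shows "group_representation G rat_field V (\<lambda>g A. act g ` A)"
    "\<exists>r W. irreducible_decomposition G rat_field V (\<lambda>g A. act g ` A) r W"
proof -
  have Bs: "B \<subseteq> supported_on S" "\<And>g w. g \<in> carrier G \<Longrightarrow> w \<in> B \<Longrightarrow> act g w \<in> B"
    using B by (auto simp: invariant_def)
  have H: "invariant (perp Z B)" using Bs by (rule invariant_perp[OF Z])
  note U = group_representation_function_module[OF H]
  note f = quotient_representation_iso[OF Z B, folded V_def]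
  have zero: "coset B \<zero>\<^bsub>function_module (perp Z B)\<^esub> = \<zero>\<^bsub>V\<^esub>"
    by (simp add: coset_zero V_def quotient_module_def)
  show V: "group_representation G rat_field V (\<lambda>g A. act g ` A)"
    by (rule group_representation_transport[OF U f]) (rule zero)
  obtain r W where "irreducible_decomposition G rat_field (function_module (perp Z B)) act r W"
    by (rule irreducible_decomposition_function_module[OF H])
  from irreducible_decomposition_transport[OF U V f this]
  show "\<exists>r W. irreducible_decomposition G rat_field V (\<lambda>g A. act g ` A) r W" by blast
qed

end

section \<open>Cycles and boundaries as representations\<close>

lemma supported_on_cells: "supported_on (cells n 2 k) = chains n 2 k"
  by (auto simp: supported_on_def chains_def)

lemma map_permutes_cells:
  assumes \<sigma>: "\<sigma> permutes {1..n}"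
  shows "map (map \<sigma>) s \<in> cells n 2 k \<longleftrightarrow> s \<in> cells n 2 k"
proof -
  have "distinct (map \<sigma> (concat s)) \<longleftrightarrow> distinct (concat s)"
    using permutes_inj_on[OF \<sigma>] by (simp add: distinct_map)
  moreover have "\<sigma> ` set (concat s) = \<sigma> ` {1..n} \<longleftrightarrow> set (concat s) = {1..n}"
    by (rule inj_image_eq_iff[OF permutes_inj[OF \<sigma>]])
  ultimately show ?thesis
    unfolding cells_iff permutes_image[OF \<sigma>] map_concat[symmetric] by simp
qed

lemma map_map_inverse:
  assumes "\<sigma> permutes {1..n}"
  shows "map (map \<sigma>) (map (map (inv' \<sigma>)) s) = s" "map (map (inv' \<sigma>)) (map (map \<sigma>) s) = s"
  using permutes_inverses[OF assms] by (simp_all add: o_def)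

lemma orthogonal_action_cells: "orthogonal_action (sym_group n) (cells n 2 k) chain_action"
proof (intro orthogonal_action.intro sym_group_is_group orthogonal_action_axioms.intro)
  show "finite (cells n 2 k)" by (rule finite_cells)
  show "chain_action \<one>\<^bsub>sym_group n\<^esub> c = c" for c
    by (simp add: chain_action_def sym_group_one)
  fix \<sigma> assume "\<sigma> \<in> carrier (sym_group n)"
  then have \<sigma>: "\<sigma> permutes {1..n}" by (simp add: sym_group_carrier)
  show "chain_action \<sigma> c \<in> supported_on (cells n 2 k)" if "c \<in> supported_on (cells n 2 k)" for c
    using that map_permutes_cells[OF permutes_inv[OF \<sigma>]] by (auto simp: supported_on_def chain_action_def)
  show "chain_action \<sigma> (\<lambda>s. c s + d s) = (\<lambda>s. chain_action \<sigma> c s + chain_action \<sigma> d s)" for c d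
    by (simp add: chain_action_def)
  show "chain_action \<sigma> (\<lambda>s. a * c s) = (\<lambda>s. a * chain_action \<sigma> c s)" for a c
    by (simp add: chain_action_def)
  show "inner_on (cells n 2 k) (chain_action \<sigma> c) (chain_action \<sigma> d) = inner_on (cells n 2 k) c d" for c d
    unfolding inner_on_def chain_action_def
    by (rule sum.reindex_bij_witness[of _ "map (map \<sigma>)" "map (map (inv' \<sigma>))"])
      (use map_permutes_cells[OF \<sigma>] map_permutes_cells[OF permutes_inv[OF \<sigma>]] map_map_inverse[OF \<sigma>] in auto)
  fix \<tau> assume "\<tau> \<in> carrier (sym_group n)"
  then have \<tau>: "\<tau> permutes {1..n}" by (simp add: sym_group_carrier)
  have "inv' (\<sigma> \<circ> \<tau>) = inv' \<tau> \<circ> inv' \<sigma>"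
    by (rule o_inv_distrib[OF permutes_bij[OF \<sigma>] permutes_bij[OF \<tau>]])
  then show "chain_action (\<sigma> \<otimes>\<^bsub>sym_group n\<^esub> \<tau>) c = chain_action \<sigma> (chain_action \<tau> c)" for c
    by (simp add: chain_action_def sym_group_mult o_def)
qed

lemma symbol_boundary_action:
  "symbol_boundary (chain_action \<sigma> c) = chain_action \<sigma> (symbol_boundary c)"
  unfolding chain_action_def by (rule ext) (rule symbol_boundary_map)

lemma cycles_eq: "cycles n 2 k = {c \<in> chains n 2 k. symbol_boundary c = (\<lambda>t. 0)}"
  using boundary_eq_symbol_boundary by (auto simp: cycles_def)

lemma boundaries_eq: "boundaries n 2 k = symbol_boundary ` chains n 2 (Suc k)"
  using boundary_eq_symbol_boundary by (auto simp: boundaries_def)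

lemma function_subspace_chains: "function_subspace (chains n 2 k)"
  by (auto simp: function_subspace_def chains_def)

lemma boundaries_subset_cycles: "boundaries n 2 k \<subseteq> cycles n 2 k"
  using symbol_boundary_in_chains symbol_boundary_boundary by (auto simp: boundaries_eq cycles_eq)

lemma chain_action_chains:
  assumes "\<sigma> permutes {1..n}" "c \<in> chains n 2 k"
  shows "chain_action \<sigma> c \<in> chains n 2 k"
  using orthogonal_action.act_supported[OF orthogonal_action_cells, of \<sigma> n c k] assms
  by (simp add: supported_on_cells sym_group_carrier)

lemma invariant_cycles: "orthogonal_action.invariant (sym_group n) (cells n 2 k) chain_action (cycles n 2 k)"
proof -
  have "chain_action \<sigma> c \<in> cycles n 2 k" if "\<sigma> permutes {1..n}" "c \<in> cycles n 2 k" for \<sigma> c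
    using that chain_action_chains by (auto simp: cycles_eq symbol_boundary_action) (simp add: chain_action_def)
  then show ?thesis
    unfolding orthogonal_action.invariant_def[OF orthogonal_action_cells] supported_on_cells
    using function_subspaceD[OF function_subspace_chains]
    by (auto simp: function_subspace_def cycles_eq symbol_boundary_add symbol_boundary_scale sym_group_carrier)
qed

lemma invariant_boundaries:
  "orthogonal_action.invariant (sym_group n) (cells n 2 k) chain_action (boundaries n 2 k)"
proof -
  note D = function_subspaceD[OF function_subspace_chains]
  have "function_subspace (boundaries n 2 k)"
    unfolding function_subspace_def boundaries_eq
  proof (intro conjI ballI allI)
    show "(\<lambda>s. 0) \<in> symbol_boundary ` chains n 2 (Suc k)"
      by (rule image_eqI[OF _ D(1)]) (simp add: fun_eq_iff)
    fix a c assume "c \<in> symbol_boundary ` chains n 2 (Suc k)"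
    then obtain x where x: "x \<in> chains n 2 (Suc k)" "c = symbol_boundary x" by blast
    show "(\<lambda>s. a * c s) \<in> symbol_boundary ` chains n 2 (Suc k)"
      by (rule image_eqI[OF _ D(3)[OF x(1), of a]]) (simp add: x symbol_boundary_scale fun_eq_iff)
  next
    fix c d assume "c \<in> symbol_boundary ` chains n 2 (Suc k)" "d \<in> symbol_boundary ` chains n 2 (Suc k)"
    then obtain x y where x: "x \<in> chains n 2 (Suc k)" "c = symbol_boundary x"
      "y \<in> chains n 2 (Suc k)" "d = symbol_boundary y" by blast
    show "(\<lambda>s. c s + d s) \<in> symbol_boundary ` chains n 2 (Suc k)"
      by (rule image_eqI[OF _ D(2)[OF x(1,3)]]) (simp add: x symbol_boundary_add fun_eq_iff)
  qed
  moreover have "chain_action \<sigma> c \<in> boundaries n 2 k" if "\<sigma> permutes {1..n}" "c \<in> boundaries n 2 k" for \<sigma> c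
    using that chain_action_chains by (auto simp: boundaries_eq symbol_boundary_action[symmetric])
  moreover have "boundaries n 2 k \<subseteq> chains n 2 k"
    using symbol_boundary_in_chains by (auto simp: boundaries_eq)
  ultimately show ?thesis
    unfolding orthogonal_action.invariant_def[OF orthogonal_action_cells] supported_on_cells
    by (auto simp: sym_group_carrier)
qed

section \<open>Antisymmetrization\<close>

text \<open>Without the usual factor \<open>1 / n!\<close>, so that an alternating chain is multiplied by \<open>n!\<close>.\<close>

definition antisymmetrization :: "nat \<Rightarrow> chain \<Rightarrow> chain" where
  "antisymmetrization n c =
     (\<lambda>s. \<Sum>\<sigma> | \<sigma> permutes {1..n}. of_int (sign \<sigma>) * chain_action \<sigma> c s)"

lemma alternating_antisymmetrization: "alternating n (antisymmetrization n c)"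
  unfolding alternating_def
proof (intro allI impI ext)
  fix \<tau> s assume \<tau>: "\<tau> permutes {1..n}"
  let ?P = "{\<sigma>. \<sigma> permutes {1..n}}" and ?s = "of_int (sign \<tau>) :: rat"
  have ss: "?s * (?s * x) = x" for x
    by (simp add: mult.assoc[symmetric] of_int_mult[symmetric] del: of_int_mult)
  have "antisymmetrization n c s =
      (\<Sum>\<sigma>\<in>?P. of_int (sign (\<tau> \<circ> \<sigma>)) * chain_action (\<tau> \<circ> \<sigma>) c s)"
    unfolding antisymmetrization_def by (rule setum_permutations_compose_left[OF \<tau>])
  also have "\<dots> = (\<Sum>\<sigma>\<in>?P. ?s * (of_int (sign \<sigma>) * chain_action \<tau> (chain_action \<sigma> c) s))"
  proof (intro sum.cong refl)
    fix \<sigma> assume "\<sigma> \<in> ?P"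
    then have \<sigma>: "\<sigma> permutes {1..n}" by simp
    have "sign (\<tau> \<circ> \<sigma>) = sign \<tau> * sign \<sigma>"
      using \<sigma> \<tau> by (intro sign_compose) (auto simp: permutation_permutes)
    moreover have "chain_action (\<tau> \<circ> \<sigma>) c = chain_action \<tau> (chain_action \<sigma> c)"
      using orthogonal_action.act_mult[OF orthogonal_action_cells, of \<tau> n \<sigma> c] \<sigma> \<tau>
      by (simp add: sym_group_carrier sym_group_mult)
    ultimately show "of_int (sign (\<tau> \<circ> \<sigma>)) * chain_action (\<tau> \<circ> \<sigma>) c s =
        ?s * (of_int (sign \<sigma>) * chain_action \<tau> (chain_action \<sigma> c) s)" by simp
  qed
  also have "\<dots> = ?s * chain_action \<tau> (antisymmetrization n c) s"
    unfolding antisymmetrization_def chain_action_def by (simp add: sum_distrib_left)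
  finally show "chain_action \<tau> (antisymmetrization n c) s = ?s * antisymmetrization n c s"
    by (simp add: ss)
qed

lemma antisymmetrization_chains:
  assumes "c \<in> chains n 2 k" shows "antisymmetrization n c \<in> chains n 2 k"
  unfolding antisymmetrization_def
  by (intro function_subspace_sum[OF function_subspace_chains] function_subspaceD(3)[OF function_subspace_chains]
      finite_permutations chain_action_chains assms) auto

lemma antisymmetrization_alternating:
  assumes "alternating n c"
  shows "antisymmetrization n c = (\<lambda>s. fact n * c s)"
proof
  fix s
  have "antisymmetrization n c s = (\<Sum>\<sigma> | \<sigma> permutes {1..n}. c s)"
    unfolding antisymmetrization_def
  proof (intro sum.cong refl)
    fix \<sigma> assume "\<sigma> \<in> {\<sigma>. \<sigma> permutes {1..n}}"
    then have "chain_action \<sigma> c s = of_int (sign \<sigma>) * c s"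
      using assms by (simp add: alternating_def)
    then show "of_int (sign \<sigma>) * chain_action \<sigma> c s = c s"
      by (simp add: mult.assoc[symmetric] of_int_mult[symmetric] del: of_int_mult)
  qed
  moreover have "card {\<sigma>. \<sigma> permutes {1..n}} = fact n"
    by (rule card_permutations) simp_all
  ultimately show "antisymmetrization n c s = fact n * c s" by simp
qed

lemma symbol_boundary_antisymmetrization:
  "symbol_boundary (antisymmetrization n c) = antisymmetrization n (symbol_boundary c)"
  unfolding antisymmetrization_def
  by (rule ext) (simp add: symbol_boundary_sum symbol_boundary_scale symbol_boundary_action finite_permutations)

text \<open>If the chain of \<open>z\<close> were the boundary of \<open>c\<close>, then the antisymmetrization of \<open>c\<close>, an alternating chain,
  would have \<open>n!\<close> times the chain of \<open>z\<close> as its boundary, and the corresponding word chain would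
  bound \<open>z\<close> up to the factor \<open>n!\<close>.\<close>

lemma sign_chain_not_boundary:
  assumes z: "z \<in> word_chains n" "\<And>g. g \<in> word_chains n \<Longrightarrow> z \<noteq> word_boundary g"
  shows "sign_chain n z \<notin> boundaries n 2 k"
proof
  assume "sign_chain n z \<in> boundaries n 2 k"
  then obtain c where c: "c \<in> chains n 2 (Suc k)" "sign_chain n z = symbol_boundary c"
    by (auto simp: boundaries_eq)
  define g where "g = chain_word n (antisymmetrization n c)"
  have g: "g \<in> word_chains n"
    unfolding g_def using chain_word_graded[OF antisymmetrization_chains[OF c(1)]] graded_subset_word_chains by blast
  have "sign_chain n (word_boundary g) = symbol_boundary (antisymmetrization n c)"
    unfolding symbol_boundary_sign_chain[symmetric] g_def
    using sign_chain_chain_word[OF antisymmetrization_chains[OF c(1)] alternating_antisymmetrization] by simp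
  also have "\<dots> = (\<lambda>s. fact n * sign_chain n z s)"
    unfolding symbol_boundary_antisymmetrization c(2)[symmetric]
    by (rule antisymmetrization_alternating[OF alternating_sign_chain])
  also have "\<dots> = sign_chain n (\<lambda>w. fact n * z w)" by (auto simp: signed_chain_def)
  finally have "chain_word n (sign_chain n (word_boundary g)) = chain_word n (sign_chain n (\<lambda>w. fact n * z w))"
    by simp
  then have "word_boundary g = (\<lambda>w. fact n * z w)"
    using g z(1) by (simp add: chain_word_sign_chain word_boundary_in_word_chains word_chains_linear)
  then have "word_boundary (\<lambda>w. (1 / fact n) * g w) = z"
    unfolding word_boundary_scale by simp
  moreover have "(\<lambda>w. (1 / fact n) * g w) \<in> word_chains n" using g by (rule word_chains_linear(3))
  ultimately show False using z(2) by metis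
qed

lemma alternating_cycle_word:
  assumes h: "h \<in> cycles n 2 k" "alternating n h"
  obtains f where "f \<in> graded_word_chains n k" "word_boundary f = (\<lambda>w. 0)" "h = sign_chain n f"
proof
  let ?f = "chain_word n h"
  have hc: "h \<in> chains n 2 k" "symbol_boundary h = (\<lambda>t. 0)" using h(1) by (auto simp: cycles_eq)
  show f: "?f \<in> graded_word_chains n k" by (rule chain_word_graded[OF hc(1)])
  show hf: "h = sign_chain n ?f" using sign_chain_chain_word[OF hc(1) h(2)] by simp
  have "sign_chain n (word_boundary ?f) = (\<lambda>t. 0)"
    unfolding symbol_boundary_sign_chain[symmetric] hf[symmetric] by (rule hc(2))
  then have "chain_word n (sign_chain n (word_boundary ?f)) = (\<lambda>w. 0)"
    by (simp add: chain_word_def)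
  then show "word_boundary ?f = (\<lambda>w. 0)"
    unfolding chain_word_sign_chain[OF word_boundary_in_word_chains[OF subsetD[OF graded_subset_word_chains f]]] .
qed

section \<open>The sign representation in the homology\<close>

lemma cell_homology_eq:
  "cell_homology n 2 k = quotient_module (function_module (cycles n 2 k)) (boundaries n 2 k)"
  by (simp add: cell_homology_def chain_module_def function_module_def)

text \<open>The group permutes the representatives that are orthogonal to the boundaries.  As each class has
  only one of them, that of a sign vector is itself alternating, and not only up to boundaries.\<close>

lemma homology_sign_vector:
  assumes v: "sign_vector n (cell_homology n 2 k) homology_action v"
  obtains f where "f \<in> graded_word_chains n k" "word_boundary f = (\<lambda>w. 0)"
    "v = coset (boundaries n 2 k) (sign_chain n f)"
proof -
  interpret A: orthogonal_action "sym_group n" "cells n 2 k" chain_action by (rule orthogonal_action_cells)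
  let ?B = "boundaries n 2 k" and ?Z = "cycles n 2 k"
  let ?H = "A.perp ?Z ?B"
  have H: "A.invariant ?H"
    using invariant_boundaries[of n k] by (intro A.invariant_perp invariant_cycles) (auto simp: A.invariant_def)
  have fsH: "function_subspace ?H" using H by (simp add: A.invariant_def)
  have act: "homology_action = (\<lambda>\<sigma> A. chain_action \<sigma> ` A)" by (simp add: homology_action_def fun_eq_iff)
  note iso = A.quotient_representation_iso[OF invariant_cycles invariant_boundaries boundaries_subset_cycles,
      folded cell_homology_eq act]
  note I = representation_isoD[OF iso]
  have vc: "v \<in> carrier (cell_homology n 2 k)" using v by (simp add: sign_vector_def)
  then obtain h where h: "h \<in> ?H" "v = coset ?B h" using I(1) by (auto simp: bij_betw_def)
  have "alternating n h"
    unfolding alternating_def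
  proof (intro allI impI)
    fix \<sigma> assume "\<sigma> permutes {1..n}"
    then have \<sigma>: "\<sigma> \<in> carrier (sym_group n)" by (simp add: sym_group_carrier)
    have "coset ?B (chain_action \<sigma> h) = homology_action \<sigma> v"
      using I(5)[OF \<sigma>, of h] h by simp
    also have "\<dots> = of_int (sign \<sigma>) \<odot>\<^bsub>cell_homology n 2 k\<^esub> v"
      using v \<sigma> by (simp add: sign_vector_def)
    also have "\<dots> = coset ?B (\<lambda>s. of_int (sign \<sigma>) * h s)"
      using I(4)[of "of_int (sign \<sigma>)" h] h by simp
    finally have eq: "coset ?B (chain_action \<sigma> h) = coset ?B (\<lambda>s. of_int (sign \<sigma>) * h s)" .
    have "inj_on (coset ?B) ?H" using I(1) by (simp add: bij_betw_def)
    moreover have "chain_action \<sigma> h \<in> ?H" using H \<sigma> h(1) by (simp add: A.invariant_def)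
    moreover have "(\<lambda>s. of_int (sign \<sigma>) * h s) \<in> ?H" by (rule function_subspaceD(3)[OF fsH h(1)])
    ultimately show "chain_action \<sigma> h = (\<lambda>s. of_int (sign \<sigma>) * h s)" using eq by (simp add: inj_on_eq_iff)
  qed
  moreover have "h \<in> ?Z" using h(1) by (simp add: A.perp_def)
  ultimately obtain f where "f \<in> graded_word_chains n k" "word_boundary f = (\<lambda>w. 0)" "h = sign_chain n f"
    using alternating_cycle_word by blast
  with h(2) show ?thesis by (intro that) auto
qed

lemma function_subspace_boundaries: "function_subspace (boundaries n 2 k)"
  using invariant_boundaries[of n k] by (simp add: orthogonal_action.invariant_def[OF orthogonal_action_cells])

lemma coset_sign_chain_sum:
  assumes g: "g \<in> graded_word_chains n (Suc k)"
  shows "coset (boundaries n 2 k) (sign_chain n (\<lambda>w. f w + word_boundary g w)) =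
    coset (boundaries n 2 k) (sign_chain n f)"
  unfolding coset_eq_iff[OF function_subspace_boundaries]
proof -
  have "(\<lambda>s. sign_chain n (\<lambda>w. f w + word_boundary g w) s - sign_chain n f s) = sign_chain n (word_boundary g)"
    by (auto simp: signed_chain_def algebra_simps)
  also have "\<dots> = symbol_boundary (sign_chain n g)" by (rule symbol_boundary_sign_chain[symmetric])
  also have "\<dots> \<in> boundaries n 2 k"
    unfolding boundaries_eq using sign_chain_in_chains[OF g] by (rule imageI)
  finally show "(\<lambda>s. sign_chain n (\<lambda>w. f w + word_boundary g w) s - sign_chain n f s) \<in> boundaries n 2 k" .
qed

theorem corollary6p5:
  fixes n k :: nat
  assumes "n \<ge> 1"
  shows "occurs_with_multiplicity (sym_group n) (ring_of_type_algebra :: rat ring)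
           sign_space sign_action
           (cell_homology n 2 k) homology_action
           (if int n - 3 * int k = 0 \<or> int n - 3 * int k = 1 then 1 else 0)"
proof -
  interpret A: orthogonal_action "sym_group n" "cells n 2 k" chain_action by (rule orthogonal_action_cells)
  let ?V = "cell_homology n 2 k" and ?B = "boundaries n 2 k"
  have act: "homology_action = (\<lambda>\<sigma> A. chain_action \<sigma> ` A)" by (simp add: homology_action_def fun_eq_iff)
  note rep = A.quotient_representation[OF invariant_cycles invariant_boundaries boundaries_subset_cycles,
      folded cell_homology_eq act]
  obtain r W where dec: "irreducible_decomposition (sym_group n) rat_field ?V homology_action r W"
    using rep(2) by blast
  have zero: "\<zero>\<^bsub>?V\<^esub> = ?B" by (simp add: cell_homology_eq quotient_module_def)
  show ?thesis
  proof (cases "n = 3 * k \<or> n = 3 * k + 1")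
    case True
    then obtain z where z: "z \<in> graded_word_chains n k" "word_boundary z = (\<lambda>w. 0)"
      and nb: "\<And>g. g \<in> word_chains n \<Longrightarrow> z \<noteq> word_boundary g"
      and span: "\<And>f. f \<in> graded_word_chains n k \<Longrightarrow> word_boundary f = (\<lambda>w. 0) \<Longrightarrow>
        \<exists>c. \<exists>g\<in>graded_word_chains n (Suc k). f = (\<lambda>w. c * z w + word_boundary g w)"
      by (rule graded_homology_line) blast
    let ?z = "sign_chain n z"
    let ?v = "coset ?B ?z"
    have smult: "a \<odot>\<^bsub>?V\<^esub> coset ?B h = coset ?B (\<lambda>s. a * h s)" for a h
      using smult_coset[OF function_subspace_boundaries] by (simp add: cell_homology_eq quotient_module_def)
    have zZ: "?z \<in> cycles n 2 k"
      using sign_chain_in_chains[OF z(1)]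
      by (simp add: cycles_eq symbol_boundary_sign_chain z(2) signed_chain_zero)
    have sv: "sign_vector n ?V homology_action ?v"
      unfolding sign_vector_def
    proof (intro conjI ballI)
      show "?v \<in> carrier ?V"
        using zZ by (auto simp: cell_homology_eq carrier_quotient_module)
      fix \<sigma> assume \<sigma>: "\<sigma> \<in> carrier (sym_group n)"
      then have "chain_action \<sigma> ?z = (\<lambda>s. of_int (sign \<sigma>) * ?z s)"
        using alternating_sign_chain[of n z] by (simp add: alternating_def sym_group_carrier)
      then show "homology_action \<sigma> ?v = of_int (sign \<sigma>) \<odot>\<^bsub>?V\<^esub> ?v"
        using A.act_image_coset[OF invariant_boundaries \<sigma>, of ?z] by (simp add: act smult)
    qed
    have "?v \<noteq> coset ?B (\<lambda>s. 0)"
      unfolding coset_eq_iff[OF function_subspace_boundaries]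
      using sign_chain_not_boundary[of z n k] z(1) nb graded_subset_word_chains by auto
    then have "?v \<noteq> \<zero>\<^bsub>?V\<^esub>" by (simp add: zero coset_zero)
    moreover have "\<exists>c. v = c \<odot>\<^bsub>?V\<^esub> ?v" if v: "sign_vector n ?V homology_action v" for v
    proof -
      obtain f where f: "f \<in> graded_word_chains n k" "word_boundary f = (\<lambda>w. 0)" "v = coset ?B (sign_chain n f)"
        by (rule homology_sign_vector[OF v])
      obtain c g where g: "g \<in> graded_word_chains n (Suc k)" "f = (\<lambda>w. c * z w + word_boundary g w)"
        using span[OF f(1,2)] by blast
      have "v = coset ?B (sign_chain n (\<lambda>w. c * z w))"
        unfolding f(3) g(2) by (rule coset_sign_chain_sum[OF g(1)])
      also have "sign_chain n (\<lambda>w. c * z w) = (\<lambda>s. c * ?z s)" by (auto simp: signed_chain_def)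
      finally show ?thesis unfolding smult by blast
    qed
    ultimately have "occurs_with_multiplicity (sym_group n) rat_field sign_space sign_action ?V homology_action 1"
      by (rule sign_multiplicity_one[OF rep(1) dec sv])
    moreover have "int n - 3 * int k = 0 \<or> int n - 3 * int k = 1" using True by auto
    ultimately show ?thesis by simp
  next
    case False
    have "v = \<zero>\<^bsub>?V\<^esub>" if v: "sign_vector n ?V homology_action v" for v
    proof -
      obtain f where f: "f \<in> graded_word_chains n k" "word_boundary f = (\<lambda>w. 0)" "v = coset ?B (sign_chain n f)"
        by (rule homology_sign_vector[OF v])
      obtain g where g: "g \<in> graded_word_chains n (Suc k)" "f = word_boundary g"
        using graded_homology_zero[OF _ _ f(1,2)] False by blast
      have "v = coset ?B (sign_chain n (\<lambda>w. 0))"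
        using coset_sign_chain_sum[OF g(1), of "\<lambda>w. 0"] unfolding f(3) g(2) by simp
      then show ?thesis by (simp add: signed_chain_zero coset_zero zero)
    qed
    then have "occurs_with_multiplicity (sym_group n) rat_field sign_space sign_action ?V homology_action 0"
      by (rule sign_multiplicity_zero[OF rep(1) dec])
    moreover have "\<not> (int n - 3 * int k = 0 \<or> int n - 3 * int k = 1)" using False by auto
    ultimately show ?thesis by simp
  qed
qed

end
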